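(* There is an algorithm which, given as input a coloured poset $(P,\le^P)$ with colouring $\lambda:P\to\Lambda$ and an order-invariant first-order sentence $\varphi$, decides whether $P\models\varphi$ in time $f(w,|\varphi|)\cdot|P|^2$, where $w$ is the width of $(P,\le^P)$ and $f$ is some function.
   Context: A poset $(P,\le^P)$ is a set with a reflexive, transitive, antisymmetric binary relation. An antichain is a set $A\subseteq P$ such that $x\le^P y$ with $x,y\in A$ implies $x=y$; the width of the poset is the maximum size of an antichain. A coloured poset is a poset with a map $\lambda:P\to\Lambda$ to a set of colours, viewed as a structure with the binary relation $\le^P$ and a unary predicate for each colour. A first-order sentence $\varphi$ over this signature extended by a binary symbol $<$ is order-invariant if for all such structures and all linear orders $<_1,<_2$ of $P$, $(P,<_1)\models\varphi$ iff $(P,<_2)\models\varphi$; $P\models\varphi$ means $(P,<)\models\varphi$ for some (equivalently every) linear order $<$ on $P$. $|P|$ denotes the length of a suitable encoding of $(P,\le^P)$. *)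

theory Defs
  imports Main
begin

section \<open>Coloured posets\<close>

definition antichain_on :: "'a set \<Rightarrow> 'a rel \<Rightarrow> 'a set \<Rightarrow> bool" where
  "antichain_on P r A \<longleftrightarrow> A \<subseteq> P \<and> (\<forall>x\<in>A. \<forall>y\<in>A. (x, y) \<in> r \<longrightarrow> x = y)"

definition width :: "'a set \<Rightarrow> 'a rel \<Rightarrow> nat" where
  "width P r = Max (card ` {A. antichain_on P r A})"

definition finite_coloured_poset :: "'c set \<Rightarrow> 'a set \<Rightarrow> 'a rel \<Rightarrow> ('a \<Rightarrow> 'c) \<Rightarrow> bool" where
  "finite_coloured_poset \<Lambda> P r col \<longleftrightarrow> finite P \<and> partial_order_on P r \<and> col ` P \<subseteq> \<Lambda>"


section \<open>First-order logic over ordered coloured posets\<close>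

text \<open>Variables are named by natural numbers; \<open>Leq\<close> is the poset relation, \<open>Less\<close> the
  additional order symbol, and \<open>HasCol k\<close> the unary predicate of the colour \<open>k\<close>.\<close>

datatype 'c fo =
    Equal nat nat
  | Leq nat nat
  | Less nat nat
  | HasCol 'c nat
  | Neg "'c fo"
  | Conj "'c fo" "'c fo"
  | Disj "'c fo" "'c fo"
  | Exists nat "'c fo"
  | Forall nat "'c fo"

primrec free_vars :: "'c fo \<Rightarrow> nat set" where
  "free_vars (Equal x y) = {x, y}"
| "free_vars (Leq x y) = {x, y}"
| "free_vars (Less x y) = {x, y}"
| "free_vars (HasCol k x) = {x}"
| "free_vars (Neg \<phi>) = free_vars \<phi>"
| "free_vars (Conj \<phi> \<psi>) = free_vars \<phi> \<union> free_vars \<psi>"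
| "free_vars (Disj \<phi> \<psi>) = free_vars \<phi> \<union> free_vars \<psi>"
| "free_vars (Exists x \<phi>) = free_vars \<phi> - {x}"
| "free_vars (Forall x \<phi>) = free_vars \<phi> - {x}"

text \<open>The set of colours occurring in a formula is the \<open>set_fo\<close> provided by the datatype.\<close>

definition sentence_over :: "'c set \<Rightarrow> 'c fo \<Rightarrow> bool" where
  "sentence_over \<Lambda> \<phi> \<longleftrightarrow> free_vars \<phi> = {} \<and> set_fo \<phi> \<subseteq> \<Lambda>"

primrec sat :: "'a set \<Rightarrow> 'a rel \<Rightarrow> ('a \<Rightarrow> 'c) \<Rightarrow> 'a rel \<Rightarrow> (nat \<Rightarrow> 'a) \<Rightarrow> 'c fo \<Rightarrow> bool" where
  "sat P r col s \<sigma> (Equal x y) \<longleftrightarrow> \<sigma> x = \<sigma> y"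
| "sat P r col s \<sigma> (Leq x y) \<longleftrightarrow> (\<sigma> x, \<sigma> y) \<in> r"
| "sat P r col s \<sigma> (Less x y) \<longleftrightarrow> (\<sigma> x, \<sigma> y) \<in> s"
| "sat P r col s \<sigma> (HasCol k x) \<longleftrightarrow> col (\<sigma> x) = k"
| "sat P r col s \<sigma> (Neg \<phi>) \<longleftrightarrow> \<not> sat P r col s \<sigma> \<phi>"
| "sat P r col s \<sigma> (Conj \<phi> \<psi>) \<longleftrightarrow> sat P r col s \<sigma> \<phi> \<and> sat P r col s \<sigma> \<psi>"
| "sat P r col s \<sigma> (Disj \<phi> \<psi>) \<longleftrightarrow> sat P r col s \<sigma> \<phi> \<or> sat P r col s \<sigma> \<psi>"
| "sat P r col s \<sigma> (Exists x \<phi>) \<longleftrightarrow> (\<exists>a\<in>P. sat P r col s (\<sigma>(x := a)) \<phi>)"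
| "sat P r col s \<sigma> (Forall x \<phi>) \<longleftrightarrow> (\<forall>a\<in>P. sat P r col s (\<sigma>(x := a)) \<phi>)"

text \<open>Truth of a sentence in \<open>(P, <)\<close>. The assignment is immaterial for sentences; quantifying over
  all of them (also when \<open>P\<close> is empty) avoids choosing one.\<close>

definition true_in :: "'a set \<Rightarrow> 'a rel \<Rightarrow> ('a \<Rightarrow> 'c) \<Rightarrow> 'a rel \<Rightarrow> 'c fo \<Rightarrow> bool" where
  "true_in P r col s \<phi> \<longleftrightarrow> (\<forall>\<sigma>. sat P r col s \<sigma> \<phi>)"

text \<open>Structures are finite. Every finite structure is isomorphic to one whose elements are natural
  numbers, so ranging over the latter loses nothing.\<close>

definition order_invariant :: "'c set \<Rightarrow> 'c fo \<Rightarrow> bool" where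
  "order_invariant \<Lambda> \<phi> \<longleftrightarrow>
     (\<forall>(P :: nat set) r col s1 s2.
        finite_coloured_poset \<Lambda> P r col \<longrightarrow>
        strict_linear_order_on P s1 \<longrightarrow> strict_linear_order_on P s2 \<longrightarrow>
        (true_in P r col s1 \<phi> \<longleftrightarrow> true_in P r col s2 \<phi>))"

definition poset_models :: "'a set \<Rightarrow> 'a rel \<Rightarrow> ('a \<Rightarrow> 'c) \<Rightarrow> 'c fo \<Rightarrow> bool" where
  "poset_models P r col \<phi> \<longleftrightarrow> (\<exists>s. strict_linear_order_on P s \<and> true_in P r col s \<phi>)"


section \<open>Encodings as sequences of machine words\<close>

text \<open>The elements are listed in an arbitrary order \<open>xs\<close>; the poset is given by its size followed by
  the adjacency matrix of the order relation, row by row.\<close>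

definition encode_poset :: "'a list \<Rightarrow> 'a rel \<Rightarrow> nat list" where
  "encode_poset xs r =
     length xs # concat (map (\<lambda>x. map (\<lambda>y. if (x, y) \<in> r then 1 else 0) xs) xs)"

text \<open>Formulas in prefix notation. A variable or colour name takes one word.\<close>

primrec encode_fo :: "nat fo \<Rightarrow> nat list" where
  "encode_fo (Equal x y) = [0, x, y]"
| "encode_fo (Leq x y) = [1, x, y]"
| "encode_fo (Less x y) = [2, x, y]"
| "encode_fo (HasCol k x) = [3, k, x]"
| "encode_fo (Neg \<phi>) = 4 # encode_fo \<phi>"
| "encode_fo (Conj \<phi> \<psi>) = 5 # encode_fo \<phi> @ encode_fo \<psi>"
| "encode_fo (Disj \<phi> \<psi>) = 6 # encode_fo \<phi> @ encode_fo \<psi>"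
| "encode_fo (Exists x \<phi>) = 7 # x # encode_fo \<phi>"
| "encode_fo (Forall x \<phi>) = 8 # x # encode_fo \<phi>"

definition encode_instance :: "'a list \<Rightarrow> 'a rel \<Rightarrow> ('a \<Rightarrow> nat) \<Rightarrow> nat fo \<Rightarrow> nat list" where
  "encode_instance xs r col \<phi> = encode_poset xs r @ map col xs @ encode_fo \<phi>"


section \<open>Random access machines\<close>

text \<open>
  The machine has the operations of the classical unit-cost random access machine of Cook and
  Reckhow: constants, addition, (truncated) subtraction and indirect addressing, but no
  multiplication. The control flow is structured, and a program can name only finitely many of the
  registers; everything else lives in the memory. Every instruction and every test of a register
  takes one step.
\<close>

datatype ram =
    SetConst nat nat       \<comment> \<open>\<open>R\<^sub>i := k\<close>\<close>
  | Add nat nat nat        \<comment> \<open>\<open>R\<^sub>i := R\<^sub>j + R\<^sub>k\<close>\<close>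
  | Sub nat nat nat        \<comment> \<open>\<open>R\<^sub>i := R\<^sub>j - R\<^sub>k\<close>\<close>
  | Load nat nat           \<comment> \<open>\<open>R\<^sub>i := M[R\<^sub>j]\<close>\<close>
  | Store nat nat          \<comment> \<open>\<open>M[R\<^sub>i] := R\<^sub>j\<close>\<close>
  | Seq ram ram
  | IfNZ nat ram ram
  | WhileNZ nat ram

type_synonym ram_state = "(nat \<Rightarrow> nat) \<times> (nat \<Rightarrow> nat)"  \<comment> \<open>registers and memory\<close>

inductive ram_exec :: "ram \<Rightarrow> ram_state \<Rightarrow> nat \<Rightarrow> ram_state \<Rightarrow> bool" where
  SetConst: "ram_exec (SetConst i k) (R, M) 1 (R(i := k), M)"
| Add: "ram_exec (Add i j k) (R, M) 1 (R(i := R j + R k), M)"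
| Sub: "ram_exec (Sub i j k) (R, M) 1 (R(i := R j - R k), M)"
| Load: "ram_exec (Load i j) (R, M) 1 (R(i := M (R j)), M)"
| Store: "ram_exec (Store i j) (R, M) 1 (R, M(R i := R j))"
| Seq: "ram_exec c1 S t1 S' \<Longrightarrow> ram_exec c2 S' t2 S'' \<Longrightarrow> ram_exec (Seq c1 c2) S (t1 + t2) S''"
| IfTrue: "R i \<noteq> 0 \<Longrightarrow> ram_exec c1 (R, M) t S \<Longrightarrow> ram_exec (IfNZ i c1 c2) (R, M) (Suc t) S"
| IfFalse: "R i = 0 \<Longrightarrow> ram_exec c2 (R, M) t S \<Longrightarrow> ram_exec (IfNZ i c1 c2) (R, M) (Suc t) S"
| WhileFalse: "R i = 0 \<Longrightarrow> ram_exec (WhileNZ i c) (R, M) 1 (R, M)"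
| WhileTrue: "R i \<noteq> 0 \<Longrightarrow> ram_exec c (R, M) t1 S \<Longrightarrow> ram_exec (WhileNZ i c) S t2 S'
    \<Longrightarrow> ram_exec (WhileNZ i c) (R, M) (Suc (t1 + t2)) S'"

inductive_cases SetConstE: "ram_exec (SetConst i k) S t S'"
inductive_cases AddE: "ram_exec (Add i j k) S t S'"
inductive_cases SubE: "ram_exec (Sub i j k) S t S'"
inductive_cases LoadE: "ram_exec (Load i j) S t S'"
inductive_cases StoreE: "ram_exec (Store i j) S t S'"
inductive_cases SeqE: "ram_exec (Seq c1 c2) S t S'"
inductive_cases IfNZE: "ram_exec (IfNZ i c1 c2) S t S'"
inductive_cases WhileNZE: "ram_exec (WhileNZ i c) S t S'"

lemma ram_exec_deterministic:
  "ram_exec c S t S' \<Longrightarrow> ram_exec c S u T' \<Longrightarrow> u = t \<and> T' = S'"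
proof (induction arbitrary: u T' rule: ram_exec.induct)
  case (SetConst i k R M)
  then show ?case by (rule SetConstE) simp
next
  case (Add i j k R M)
  then show ?case by (rule AddE) simp
next
  case (Sub i j k R M)
  then show ?case by (rule SubE) simp
next
  case (Load i j R M)
  then show ?case by (rule LoadE) simp
next
  case (Store i j R M)
  then show ?case by (rule StoreE) simp
next
  case (Seq c1 S t1 S' c2 t2 S'')
  from Seq.prems show ?case by (rule SeqE) (use Seq.IH in blast)
next
  case (IfTrue R i c1 M t S c2)
  from IfTrue.prems show ?case by (rule IfNZE) (use IfTrue.hyps(1) IfTrue.IH in \<open>metis Pair_inject neq0_conv\<close>)+
next
  case (IfFalse R i c2 M t S c1)
  from IfFalse.prems show ?case by (rule IfNZE) (use IfFalse.hyps(1) IfFalse.IH in \<open>metis Pair_inject neq0_conv\<close>)+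
next
  case (WhileFalse R i c M)
  from WhileFalse.prems show ?case by (rule WhileNZE) (use WhileFalse.hyps in simp_all)
next
  case (WhileTrue R i c M t1 S t2 S')
  from WhileTrue.prems show ?case
    by (rule WhileNZE) (use WhileTrue.hyps(1) WhileTrue.IH in \<open>metis Pair_inject neq0_conv\<close>)+
qed

text \<open>Initially the input occupies the memory from address 0 on, register 0 holds its length, and all
  else is 0. The result is read off register 0.\<close>

definition ram_init :: "nat list \<Rightarrow> ram_state" where
  "ram_init w = ((\<lambda>_. 0)(0 := length w), (\<lambda>a. if a < length w then w ! a else 0))"

definition ram_computes_in :: "ram \<Rightarrow> nat list \<Rightarrow> nat \<Rightarrow> nat \<Rightarrow> bool" where
  "ram_computes_in c w t v \<longleftrightarrow> (\<exists>R M. ram_exec c (ram_init w) t (R, M) \<and> R 0 = v)"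

end

theory Submission
  imports Defs
begin

text \<open>
  The algorithm partitions the poset into at most \<open>w\<close> chains by augmenting paths and takes for \<open><\<close> the
  concatenation of these chains, refined by colour, which order-invariance permits. On pairs of
  elements it then runs rounds of the refinement \<open>T(x, y) \<mapsto> {(T(x, z), T(z, y)) | z}\<close>, starting with
  the atomic types. The number of classes is bounded in terms of the width, the formula and the
  number of rounds.

  The reason why pairs suffice: on a chain, every class of pairs is an intersection of relations that
  are closed under moving the left argument down and the right argument up, and of complements of
  converses of such relations. For a fixed left or right argument these cut out initial or final segments
  of the chain, for which pairwise intersections being nonempty implies that the total intersection is nonempty.
  Hence the condition that some \<open>z\<close> has prescribed types with all members of a tuple is determined
  by the types of the pairs in the tuple, and a back-and-forth argument shows that tuples whose pairs
  have equal types after \<open>q\<close> rounds satisfy the same formulas of quantifier rank \<open>q\<close>.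

  It follows that every quantifier may be restricted to a set of representatives of bounded size,
  and the sentence is evaluated over the assignments with values in these sets.
\<close>

section \<open>Types of pairs\<close>

text \<open>The poset part of the encoding has n^2 + 1 words for n elements, so quadratic time means
  n^4 steps. Comparing two pairs in a round of refinement tries all pairs of midpoints, n^2 of them.
  Each pair is compared only with one representative of every class found so far, so a round costs
  n^4 up to a factor depending on w and the sentence; everything else is at most cubic in n.

  The width enters through the number of labels. A label combines a chain with a colour, where all
  colours absent from the sentence count as one. A sentence of l tokens thus leads to at most w * (l
  + 1) labels, however large the palette is. The linear order is chosen so that labels,
  \<open>le\<close> and equality define it without quantifiers; otherwise the atomic type of a pair
  would not decide it.

  The machine works with l instead of the quantifier rank and with token positions instead of
  quantifier depths. The function f appears in the analysis only: all loops run up to numbers that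
  have actually been reached.\<close>

locale labelled_poset =
  fixes n :: nat and le :: "nat \<Rightarrow> nat \<Rightarrow> bool" and u :: "nat \<Rightarrow> nat"
  assumes le_refl: "x < n \<Longrightarrow> le x x"
    and le_antisym: "x < n \<Longrightarrow> y < n \<Longrightarrow> le x y \<Longrightarrow> le y x \<Longrightarrow> x = y"
    and le_trans: "x < n \<Longrightarrow> y < n \<Longrightarrow> z < n \<Longrightarrow> le x y \<Longrightarrow> le y z \<Longrightarrow> le x z"
    and label_chain: "x < n \<Longrightarrow> y < n \<Longrightarrow> u x = u y \<Longrightarrow> le x y \<or> le y x"
begin

text \<open>A set version of the two-dimensional Weisfeiler-Leman refinement: midpoints are matched
  but not counted, which keeps the number of classes bounded. Level 0 does not record whether
  \<open>x = y\<close>; reflexivity and antisymmetry recover it from \<open>le\<close>.\<close>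

primrec eqv :: "nat \<Rightarrow> nat \<Rightarrow> nat \<Rightarrow> nat \<Rightarrow> nat \<Rightarrow> bool" where
  "eqv 0 x y x' y' \<longleftrightarrow> u x = u x' \<and> u y = u y' \<and> le x y = le x' y' \<and> le y x = le y' x'"
| "eqv (Suc q) x y x' y' \<longleftrightarrow>
     (\<forall>z<n. \<exists>z'<n. eqv q x z x' z' \<and> eqv q z y z' y') \<and>
     (\<forall>z'<n. \<exists>z<n. eqv q x z x' z' \<and> eqv q z y z' y')"

lemma eqv_refl: "eqv q x y x y"
  by (induction q arbitrary: x y) auto

lemma eqv_sym: "eqv q x y x' y' \<Longrightarrow> eqv q x' y' x y"
  by (induction q arbitrary: x y x' y') (simp, simp, blast)

lemma eqv_trans: "eqv q x y x' y' \<Longrightarrow> eqv q x' y' x'' y'' \<Longrightarrow> eqv q x y x'' y''"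
proof (induction q arbitrary: x y x' y' x'' y'')
  case (Suc q)
  show ?case unfolding eqv.simps
  proof (intro conjI allI impI)
    fix z assume "z < n"
    then obtain z' where z': "z' < n" "eqv q x z x' z'" "eqv q z y z' y'" using Suc.prems(1) by auto
    then obtain z'' where "z'' < n" "eqv q x' z' x'' z''" "eqv q z' y' z'' y''" using Suc.prems(2) by auto
    then show "\<exists>z'<n. eqv q x z x'' z' \<and> eqv q z y z' y''" using z' Suc.IH by blast
  next
    fix z'' assume "z'' < n"
    then obtain z' where z': "z' < n" "eqv q x' z' x'' z''" "eqv q z' y' z'' y''" using Suc.prems(2) by auto
    then obtain z where "z < n" "eqv q x z x' z'" "eqv q z y z' y'" using Suc.prems(1) by auto
    then show "\<exists>z<n. eqv q x z x'' z'' \<and> eqv q z y z'' y''" using z' Suc.IH by blast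
  qed
qed simp

lemma eqv_swap: "eqv q x y x' y' \<Longrightarrow> eqv q y x y' x'"
proof (induction q arbitrary: x y x' y')
  case (Suc q)
  then show ?case unfolding eqv.simps by meson
qed auto

text \<open>For positive \<open>q\<close> only the first half of each midpoint condition is used;
  its swapped form is the second half for the pair \<open>(x, x)\<close>.\<close>

lemma eqv_diag:
  assumes "x < n" "y < n" "x' < n" "y' < n" "eqv q x y x' y'"
  shows "eqv q x x x' x'"
proof (cases q)
  case 0
  then show ?thesis using assms le_refl by auto
next
  case (Suc p)
  show ?thesis unfolding Suc eqv.simps
    using assms(5) eqv_swap unfolding Suc eqv.simps by meson
qed

lemma eqv_diag': "x < n \<Longrightarrow> y < n \<Longrightarrow> x' < n \<Longrightarrow> y' < n \<Longrightarrow> eqv q x y x' y' \<Longrightarrow> eqv q y y y' y'"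
  using eqv_diag eqv_swap by blast

lemma eqv_Suc:
  assumes "x < n" "y < n" "x' < n" "y' < n" "eqv (Suc q) x y x' y'"
  shows "eqv q x y x' y'"
  using assms
proof (induction q arbitrary: x y x' y')
  case 0
  \<comment> \<open>Take the midpoint \<open>x\<close> itself: its answer \<open>z'\<close> is
    related to \<open>x'\<close> by \<open>le\<close> both ways, hence equal to it.\<close>
  then obtain z' where z': "z' < n" "eqv 0 x x x' z'" "eqv 0 x y z' y'" by auto
  then have "z' = x'" using 0 le_refl le_antisym by auto
  then show ?case using z' by simp
next
  case (Suc q)
  show ?case unfolding eqv.simps(2)[of q]
  proof (intro conjI allI impI)
    fix z assume z: "z < n"
    then obtain z' where "z' < n" "eqv (Suc q) x z x' z'" "eqv (Suc q) z y z' y'"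
      using Suc.prems(5) unfolding eqv.simps(2)[of "Suc q"] by blast
    then show "\<exists>z'<n. eqv q x z x' z' \<and> eqv q z y z' y'" using Suc.IH Suc.prems z by blast
  next
    fix z' assume z': "z' < n"
    then obtain z where "z < n" "eqv (Suc q) x z x' z'" "eqv (Suc q) z y z' y'"
      using Suc.prems(5) unfolding eqv.simps(2)[of "Suc q"] by blast
    then show "\<exists>z<n. eqv q x z x' z' \<and> eqv q z y z' y'" using Suc.IH Suc.prems z' by blast
  qed
qed

declare eqv.simps(2) [simp del]

lemma eqv_0: "x < n \<Longrightarrow> y < n \<Longrightarrow> x' < n \<Longrightarrow> y' < n \<Longrightarrow> eqv q x y x' y' \<Longrightarrow> eqv 0 x y x' y'"
proof (induction q)
  case (Suc q)
  then show ?case using eqv_Suc[OF Suc.prems(1-4)] by blast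
qed

lemma eqv_label: "x < n \<Longrightarrow> y < n \<Longrightarrow> x' < n \<Longrightarrow> y' < n \<Longrightarrow> eqv q x y x' y' \<Longrightarrow> u x = u x' \<and> u y = u y'"
  using eqv_0[of x y x' y' q] by simp

text \<open>\<open>wd q R\<close>: \<open>R\<close> is a union of classes of \<open>eqv q\<close>, and it is weakening, that is, closed under
  moving its left argument down and its right argument up along a label class. On a label class
  such relations cut out initial or final segments, for which a one-dimensional Helly theorem
  replaces quantifier elimination.\<close>

definition wd :: "nat \<Rightarrow> (nat \<Rightarrow> nat \<Rightarrow> bool) \<Rightarrow> bool" where
  "wd q R \<longleftrightarrow>
     (\<forall>x' x y y'. x' < n \<longrightarrow> x < n \<longrightarrow> y < n \<longrightarrow> y' < n \<longrightarrow> u x' = u x \<longrightarrow> le x' x \<longrightarrow> u y = u y' \<longrightarrow>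
        le y y' \<longrightarrow> R x y \<longrightarrow> R x' y') \<and>
     (\<forall>x y x' y'. x < n \<longrightarrow> y < n \<longrightarrow> x' < n \<longrightarrow> y' < n \<longrightarrow> eqv q x y x' y' \<longrightarrow> R x y \<longrightarrow> R x' y')"

lemma wd_mono:
  "wd q R \<Longrightarrow> x' < n \<Longrightarrow> x < n \<Longrightarrow> y < n \<Longrightarrow> y' < n \<Longrightarrow> u x' = u x \<Longrightarrow> le x' x \<Longrightarrow> u y = u y' \<Longrightarrow>
     le y y' \<Longrightarrow> R x y \<Longrightarrow> R x' y'"
  unfolding wd_def by blast

lemma wd_eqv:
  "wd q R \<Longrightarrow> x < n \<Longrightarrow> y < n \<Longrightarrow> x' < n \<Longrightarrow> y' < n \<Longrightarrow> eqv q x y x' y' \<Longrightarrow> R x y \<longleftrightarrow> R x' y'"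
  unfolding wd_def by (elim conjE) (meson eqv_sym)

text \<open>Complement and converse each turn weakening around, so together they preserve it. In
  \<open>extend\<close> this upgrades implications over all such relations to equivalences.\<close>

lemma wd_compl:
  assumes "wd q R" shows "wd q (\<lambda>x y. \<not> R y x)"
proof -
  have "\<not> R y' x'" if "x' < n" "x < n" "y < n" "y' < n" "u x' = u x" "le x' x" "u y = u y'" "le y y'" "\<not> R y x"
    for x x' y y' using wd_mono[OF assms, of y y' x' x] that by metis
  moreover have "\<not> R y' x'" if "x < n" "y < n" "x' < n" "y' < n" "eqv q x y x' y'" "\<not> R y x" for x y x' y'
    using wd_eqv[OF assms, of y x y' x'] that eqv_swap by blast
  ultimately show ?thesis unfolding wd_def by blast
qed

lemma wd_le: "wd 0 le"
  unfolding wd_def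
proof (intro conjI allI impI)
  fix x' x y y' assume "x' < n" "x < n" "y < n" "y' < n" "le x' x" "le y y'" "le x y"
  then show "le x' y'" using le_trans[of x' x y] le_trans[of x' y y'] by blast
qed simp

text \<open>The composed relation expresses that a final segment cut out by \<open>R\<close> and an
  initial segment cut out by \<open>S\<close> meet inside the diagonal class of \<open>z\<close>.
  The midpoint costs one round of refinement.\<close>

lemma wd_comp:
  assumes R: "wd q R" and S: "wd q S" and z: "z < n"
  shows "wd (Suc q) (\<lambda>p s. \<exists>t<n. eqv q z z t t \<and> R p t \<and> S t s)"
  unfolding wd_def
proof (intro conjI allI impI)
  fix x' x y y'
  assume *: "x' < n" "x < n" "y < n" "y' < n" "u x' = u x" "le x' x" "u y = u y'" "le y y'"
    "\<exists>t<n. eqv q z z t t \<and> R x t \<and> S t y"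
  then obtain t where t: "t < n" "eqv q z z t t" "R x t" "S t y" by blast
  then have "R x' t" "S t y'" using * wd_mono[OF R, of x' x t t] wd_mono[OF S, of t t y y'] le_refl by auto
  then show "\<exists>t<n. eqv q z z t t \<and> R x' t \<and> S t y'" using t by blast
next
  fix x y x' y'
  assume *: "x < n" "y < n" "x' < n" "y' < n" "eqv (Suc q) x y x' y'"
    "\<exists>t<n. eqv q z z t t \<and> R x t \<and> S t y"
  then obtain t where t: "t < n" "eqv q z z t t" "R x t" "S t y" by blast
  then obtain t' where t': "t' < n" "eqv q x t x' t'" "eqv q t y t' y'" using *(5) by (auto simp: eqv.simps(2))
  then have "R x' t'" "S t' y'" using wd_eqv[OF R] wd_eqv[OF S] t * by blast+
  moreover have "eqv q z z t' t'" using t(2) eqv_trans[OF t(2)] eqv_diag[OF _ _ _ _ t'(3)] t * t' by blast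
  ultimately show "\<exists>t<n. eqv q z z t t \<and> R x' t \<and> S t y'" using t' by blast
qed

section \<open>Helly's theorem on a chain and the extension of tuples\<close>

text \<open>Final segments of a chain are nested, and so are initial segments. The smallest of each
  kind therefore lies in all of its kind, and a common element of these two belongs to
  everything.\<close>

lemma helly:
  fixes K :: "'b set"
  assumes "finite K" "\<U> \<noteq> {}" "\<D> \<noteq> {}"
    and total: "\<And>x y. x \<in> K \<Longrightarrow> y \<in> K \<Longrightarrow> r x y \<or> r y x"
    and up: "\<And>U x y. U \<in> \<U> \<Longrightarrow> x \<in> U \<Longrightarrow> y \<in> K \<Longrightarrow> r x y \<Longrightarrow> y \<in> U" "\<And>U. U \<in> \<U> \<Longrightarrow> U \<subseteq> K"
    and down: "\<And>D x y. D \<in> \<D> \<Longrightarrow> y \<in> D \<Longrightarrow> x \<in> K \<Longrightarrow> r x y \<Longrightarrow> x \<in> D" "\<And>D. D \<in> \<D> \<Longrightarrow> D \<subseteq> K"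
    and meet: "\<And>U D. U \<in> \<U> \<Longrightarrow> D \<in> \<D> \<Longrightarrow> U \<inter> D \<noteq> {}"
  shows "\<exists>z\<in>K. (\<forall>U\<in>\<U>. z \<in> U) \<and> (\<forall>D\<in>\<D>. z \<in> D)"
proof -
  obtain U0 where U0: "U0 \<in> \<U>" "\<And>U. U \<in> \<U> \<Longrightarrow> card U0 \<le> card U"
    using \<open>\<U> \<noteq> {}\<close> ex_has_least_nat[of "\<lambda>V. V \<in> \<U>" _ card] by blast
  obtain D0 where D0: "D0 \<in> \<D>" "\<And>D. D \<in> \<D> \<Longrightarrow> card D0 \<le> card D"
    using \<open>\<D> \<noteq> {}\<close> ex_has_least_nat[of "\<lambda>V. V \<in> \<D>" _ card] by blast
  have "U0 \<subseteq> U" if "U \<in> \<U>" for U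
  proof (rule ccontr)
    assume n: "\<not> U0 \<subseteq> U"
    then obtain a where a: "a \<in> U0" "a \<notin> U" by blast
    have "U \<subseteq> U0"
    proof
      fix b assume "b \<in> U"
      then show "b \<in> U0" using up total a U0(1) that by (meson subsetD)
    qed
    then have "card U < card U0" using a U0 up \<open>finite K\<close> by (metis finite_subset psubset_card_mono psubsetI)
    then show False using U0 that by force
  qed
  moreover have "D0 \<subseteq> D" if "D \<in> \<D>" for D
  proof (rule ccontr)
    assume n: "\<not> D0 \<subseteq> D"
    then obtain a where a: "a \<in> D0" "a \<notin> D" by blast
    have "D \<subseteq> D0"
    proof
      fix b assume "b \<in> D"
      then show "b \<in> D0" using down total a D0(1) that by (meson subsetD)
    qed
    then have "card D < card D0" using a D0 down \<open>finite K\<close> by (metis finite_subset psubset_card_mono psubsetI)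
    then show False using D0 that by force
  qed
  ultimately show ?thesis using meet[OF U0(1) D0(1)] up(2)[OF U0(1)] by blast
qed

text \<open>The substitute for quantifier elimination at level \<open>q\<close>: it lets
  \<open>extend\<close> reach full equivalence although only relations that cut out segments are
  handled.\<close>

definition sep :: "nat \<Rightarrow> bool" where
  "sep q \<longleftrightarrow> (\<forall>x y x' y'. x < n \<longrightarrow> y < n \<longrightarrow> x' < n \<longrightarrow> y' < n \<longrightarrow>
     eqv q x x x' x' \<longrightarrow> eqv q y y y' y' \<longrightarrow>
     (\<forall>R. wd q R \<longrightarrow> (R x y \<longleftrightarrow> R x' y') \<and> (R y x \<longleftrightarrow> R y' x')) \<longrightarrow> eqv q x y x' y')"

text \<open>The candidates for \<open>z'\<close> are the elements with the diagonal type of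
  \<open>z\<close>; they share a label and form a chain. Each weakening relation between some
  \<open>a i\<close> and \<open>z\<close> cuts a segment out of this chain on the side of
  \<open>b\<close>. That two segments meet is a composition of relations, which \<open>agree\<close>
  transfers, and \<open>helly\<close> yields one \<open>z'\<close> for all.\<close>

lemma extend:
  assumes sep: "sep q" and I: "I \<noteq> {}"
    and ab: "\<And>i. i \<in> I \<Longrightarrow> a i < n \<and> b i < n"
    and diag: "\<And>i. i \<in> I \<Longrightarrow> eqv q (a i) (a i) (b i) (b i)"
    and agree: "\<And>i j R. i \<in> I \<Longrightarrow> j \<in> I \<Longrightarrow> wd (Suc q) R \<Longrightarrow> R (a i) (a j) \<longleftrightarrow> R (b i) (b j)"
    and z: "z < n"
  shows "\<exists>z'<n. \<forall>i\<in>I. eqv q (a i) z (b i) z'"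
proof -
  define K where "K = {t. t < n \<and> eqv q z z t t}"
  define \<U> where "\<U> = {{t \<in> K. R (b i) t} | i R. i \<in> I \<and> wd q R \<and> R (a i) z}"
  define \<D> where "\<D> = {{t \<in> K. R t (b i)} | i R. i \<in> I \<and> wd q R \<and> R z (a i)}"
  have lab: "u t = u z" if "t \<in> K" for t using that eqv_label[of z z t t] z unfolding K_def by auto
  have Kn: "t < n" if "t \<in> K" for t using that unfolding K_def by auto
  have triv: "wd q (\<lambda>_ _. True)" by (simp add: wd_def)
  obtain i0 where i0: "i0 \<in> I" using I by blast
  have "\<exists>z'\<in>K. (\<forall>U\<in>\<U>. z' \<in> U) \<and> (\<forall>D\<in>\<D>. z' \<in> D)"
  proof (rule helly[where r = le])
    show "finite K" unfolding K_def by simp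
    show "\<U> \<noteq> {}" "\<D> \<noteq> {}" unfolding \<U>_def \<D>_def using i0 triv by blast+
    show "le x y \<or> le y x" if "x \<in> K" "y \<in> K" for x y using label_chain Kn lab that by metis
  next
    fix U x y assume "U \<in> \<U>" "x \<in> U" "y \<in> K" "le x y"
    then obtain i R where R: "U = {t \<in> K. R (b i) t}" "i \<in> I" "wd q R" "x \<in> K" "R (b i) x"
      unfolding \<U>_def by blast
    have "R (b i) y"
      using wd_mono[OF R(3), of "b i" "b i" x y] R ab le_refl Kn \<open>y \<in> K\<close> \<open>le x y\<close> lab by metis
    then show "y \<in> U" using R \<open>y \<in> K\<close> by blast
  next
    fix D x y assume "D \<in> \<D>" "y \<in> D" "x \<in> K" "le x y"
    then obtain i R where R: "D = {t \<in> K. R t (b i)}" "i \<in> I" "wd q R" "y \<in> K" "R y (b i)"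
      unfolding \<D>_def by blast
    have "R x (b i)"
      using wd_mono[OF R(3), of x y "b i" "b i"] R ab le_refl Kn \<open>x \<in> K\<close> \<open>le x y\<close> lab by metis
    then show "x \<in> D" using R \<open>x \<in> K\<close> by blast
  next
    fix U D assume "U \<in> \<U>" "D \<in> \<D>"
    then obtain i R j S where R: "U = {t \<in> K. R (b i) t}" "i \<in> I" "wd q R" "R (a i) z"
      and S: "D = {t \<in> K. S t (b j)}" "j \<in> I" "wd q S" "S z (a j)"
      unfolding \<U>_def \<D>_def by blast
    \<comment> \<open>\<open>z\<close> is itself a midpoint for \<open>a i\<close> and
      \<open>a j\<close>; the composition has level \<open>Suc q\<close>, so \<open>agree\<close>
      carries it over to \<open>b i\<close> and \<open>b j\<close>.\<close>
    have "\<exists>t<n. eqv q z z t t \<and> R (a i) t \<and> S t (a j)" using z eqv_refl R S by blast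
    then have "\<exists>t<n. eqv q z z t t \<and> R (b i) t \<and> S t (b j)"
      using agree[OF R(2) S(2) wd_comp[OF R(3) S(3) z]] by blast
    then show "U \<inter> D \<noteq> {}" unfolding R(1) S(1) K_def by blast
  qed (auto simp: \<U>_def \<D>_def)
  then obtain z' where z': "z' \<in> K" "\<And>U. U \<in> \<U> \<Longrightarrow> z' \<in> U" "\<And>D. D \<in> \<D> \<Longrightarrow> z' \<in> D" by blast
  have fwd: "(R (a i) z \<longrightarrow> R (b i) z') \<and> (R z (a i) \<longrightarrow> R z' (b i))" if "i \<in> I" "wd q R" for i R
  proof (intro conjI impI)
    assume "R (a i) z"
    then have "{t \<in> K. R (b i) t} \<in> \<U>" using that unfolding \<U>_def by blast
    from z'(2)[OF this] show "R (b i) z'" by blast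
  next
    assume "R z (a i)"
    then have "{t \<in> K. R t (b i)} \<in> \<D>" using that unfolding \<D>_def by blast
    from z'(3)[OF this] show "R z' (b i)" by blast
  qed
  have "eqv q (a i) z (b i) z'" if "i \<in> I" for i
  proof -
    \<comment> \<open>\<open>helly\<close> gives implications from \<open>a\<close> to
      \<open>b\<close> only; the complement of the converse of \<open>R\<close> supplies their
      reversals.\<close>
    have "(R (a i) z \<longleftrightarrow> R (b i) z') \<and> (R z (a i) \<longleftrightarrow> R z' (b i))" if "wd q R" for R
      using fwd[OF \<open>i \<in> I\<close> that] fwd[OF \<open>i \<in> I\<close> wd_compl[OF that]] by blast
    moreover have "eqv q z z z' z'" using z' unfolding K_def by blast
    ultimately show ?thesis
      using sep[unfolded sep_def, rule_format, of "a i" z "b i" z'] ab[OF that] diag[OF that] z Kn[OF z'(1)]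
      by metis
  qed
  then show ?thesis using z' Kn by blast
qed

text \<open>At level 0 the diagonal types give the labels, and \<open>le\<close> is weakening. In
  the step, answering a midpoint of \<open>(x, y)\<close> is a one-point extension of this
  two-element tuple, so \<open>extend\<close> applies with separation at \<open>q\<close>.\<close>

lemma sep: "sep q"
proof (induction q)
  case 0
  then show ?case unfolding sep_def using wd_le by simp
next
  case (Suc q)
  have half: "\<exists>z'<n. eqv q x z x' z' \<and> eqv q z y z' y'"
    if xy: "x < n" "y < n" "x' < n" "y' < n" "eqv (Suc q) x x x' x'" "eqv (Suc q) y y y' y'"
      and R: "\<And>R. wd (Suc q) R \<Longrightarrow> (R x y \<longleftrightarrow> R x' y') \<and> (R y x \<longleftrightarrow> R y' x')" and "z < n"
    for x y x' y' z
  proof -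
    define a where "a = (\<lambda>i. if i then x else y)"
    define b where "b = (\<lambda>i. if i then x' else y')"
    have "\<exists>z'<n. \<forall>i\<in>UNIV. eqv q (a i) z (b i) z'"
    proof (rule extend[OF Suc.IH])
      show "eqv q (a i) (a i) (b i) (b i)" for i
        using xy eqv_Suc by (simp add: a_def b_def del: eqv.simps)
      show "R (a i) (a j) \<longleftrightarrow> R (b i) (b j)" if "wd (Suc q) R" for i j R
        using R[OF that] wd_eqv[OF that, of x x x' x'] wd_eqv[OF that, of y y y' y'] xy
        by (simp add: a_def b_def del: eqv.simps)
    qed (use xy \<open>z < n\<close> in \<open>auto simp: a_def b_def\<close>)
    then obtain z' where "z' < n" "eqv q x z x' z'" "eqv q y z y' z'"
      unfolding a_def b_def by (metis (full_types) UNIV_I)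
    then show ?thesis using eqv_swap by blast
  qed
  show ?case unfolding sep_def
  proof (intro allI impI)
    fix x y x' y'
    assume xy: "x < n" "y < n" "x' < n" "y' < n" "eqv (Suc q) x x x' x'" "eqv (Suc q) y y y' y'"
      and R: "\<forall>R. wd (Suc q) R \<longrightarrow> (R x y \<longleftrightarrow> R x' y') \<and> (R y x \<longleftrightarrow> R y' x')"
    have "\<exists>z<n. eqv q x z x' z' \<and> eqv q z y z' y'" if "z' < n" for z'
      using half[of x' y' x y z'] xy R that eqv_sym by (metis (no_types, lifting))
    then show "eqv (Suc q) x y x' y'" using half[of x y x' y'] xy R by (simp add: eqv.simps(2))
  qed
qed

text \<open>Weakening relations of level \<open>Suc q\<close> cannot tell the two tuples apart,
  which is all that \<open>extend\<close> asks, whatever their length. The new element costs one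
  round.\<close>

lemma back_and_forth:
  assumes "\<And>i. i \<in> I \<Longrightarrow> a i < n \<and> b i < n"
    and "\<And>i j. i \<in> I \<Longrightarrow> j \<in> I \<Longrightarrow> eqv (Suc q) (a i) (a j) (b i) (b j)" and "z < n"
  shows "\<exists>z'<n. eqv q z z z' z' \<and> (\<forall>i\<in>I. eqv q (a i) z (b i) z')"
proof (cases "I = {}")
  case True
  then show ?thesis using assms eqv_refl by blast
next
  case False
  have "\<exists>z'<n. \<forall>i\<in>I. eqv q (a i) z (b i) z'"
  proof (rule extend[OF sep False assms(1)])
    show "eqv q (a i) (a i) (b i) (b i)" if "i \<in> I" for i using eqv_Suc assms that by blast
    show "R (a i) (a j) \<longleftrightarrow> R (b i) (b j)" if "i \<in> I" "j \<in> I" "wd (Suc q) R" for i j R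
      using wd_eqv assms that by blast
  qed (use assms in auto)
  then obtain z' where "z' < n" "\<forall>i\<in>I. eqv q (a i) z (b i) z'" by blast
  moreover obtain i where "i \<in> I" using False by blast
  ultimately show ?thesis using eqv_diag'[of "a i" z "b i" z'] assms by blast
qed

section \<open>The linear order of the labels and the truth of formulas\<close>

definition lt_rel :: "nat rel" where
  "lt_rel = {(x, y). x < n \<and> y < n \<and> (u x < u y \<or> u x = u y \<and> le x y \<and> x \<noteq> y)}"

definition le_rel :: "nat rel" where
  "le_rel = {(x, y). x < n \<and> y < n \<and> le x y}"

lemma strict_linear_lt_rel: "strict_linear_order_on {..<n} lt_rel"
  unfolding strict_linear_order_on_def
proof (intro conjI)
  show "trans lt_rel"
  proof (rule transI)
    fix x y z assume "(x, y) \<in> lt_rel" "(y, z) \<in> lt_rel"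
    then show "(x, z) \<in> lt_rel" using le_trans[of x y z] le_antisym[of x y] unfolding lt_rel_def by auto
  qed
  show "irrefl lt_rel" unfolding lt_rel_def irrefl_def by auto
  show "total_on {..<n} lt_rel" unfolding lt_rel_def total_on_def
    using label_chain by (auto, metis linorder_neq_iff)
qed

end

primrec rank :: "'c fo \<Rightarrow> nat" where
  "rank (Equal x y) = 0"
| "rank (Leq x y) = 0"
| "rank (Less x y) = 0"
| "rank (HasCol k x) = 0"
| "rank (Neg \<phi>) = rank \<phi>"
| "rank (Conj \<phi> \<psi>) = max (rank \<phi>) (rank \<psi>)"
| "rank (Disj \<phi> \<psi>) = max (rank \<phi>) (rank \<psi>)"
| "rank (Exists x \<phi>) = Suc (rank \<phi>)"
| "rank (Forall x \<phi>) = Suc (rank \<phi>)"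

text \<open>\<open>C\<close> will be the set of tokens of the sentence. Colours outside it may mix
  within a label, so the number of labels does not depend on the palette.\<close>

locale coloured_poset = labelled_poset +
  fixes col :: "nat \<Rightarrow> 'c" and C :: "'c set"
  assumes label_col: "x < n \<Longrightarrow> y < n \<Longrightarrow> u x = u y \<Longrightarrow> k \<in> C \<Longrightarrow> col x = k \<longleftrightarrow> col y = k"
begin

abbreviation "holds \<equiv> sat {..<n} le_rel col lt_rel"

text \<open>Every quantifier adds its variable to \<open>X\<close> and uses up one of the
  \<open>q\<close> rounds.\<close>

lemma sat_eqv:
  assumes "set_fo \<phi> \<subseteq> C" "free_vars \<phi> \<subseteq> X" "rank \<phi> \<le> q"
    and "\<And>v. v \<in> X \<Longrightarrow> \<sigma> v < n \<and> \<tau> v < n"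
    and "\<And>v v'. v \<in> X \<Longrightarrow> v' \<in> X \<Longrightarrow> eqv q (\<sigma> v) (\<sigma> v') (\<tau> v) (\<tau> v')"
  shows "holds \<sigma> \<phi> \<longleftrightarrow> holds \<tau> \<phi>"
  using assms
proof (induction \<phi> arbitrary: X q \<sigma> \<tau>)
  case (Equal x y)
  then have "eqv 0 (\<sigma> x) (\<sigma> y) (\<tau> x) (\<tau> y)" by (intro eqv_0[of _ _ _ _ q]) auto
  then show ?case using Equal le_refl le_antisym by (simp, metis)
next
  case (Leq x y)
  then have "eqv 0 (\<sigma> x) (\<sigma> y) (\<tau> x) (\<tau> y)" by (intro eqv_0[of _ _ _ _ q]) auto
  then show ?case using Leq by (simp add: le_rel_def)
next
  case (Less x y)
  then have *: "eqv 0 (\<sigma> x) (\<sigma> y) (\<tau> x) (\<tau> y)" by (intro eqv_0[of _ _ _ _ q]) auto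
  then have "\<sigma> x = \<sigma> y \<longleftrightarrow> \<tau> x = \<tau> y" using Less le_refl le_antisym by (simp, metis)
  then show ?case using Less * by (simp add: lt_rel_def)
next
  case (HasCol k x)
  then have "eqv 0 (\<sigma> x) (\<sigma> x) (\<tau> x) (\<tau> x)" by (intro eqv_0[of _ _ _ _ q]) auto
  then show ?case using HasCol label_col by simp
next
  case (Neg \<phi>)
  then show ?case by simp
next
  case (Conj \<phi> \<psi>)
  from Conj.prems show ?case
    using Conj.IH(1)[of X q \<sigma> \<tau>] Conj.IH(2)[of X q \<sigma> \<tau>] by simp
next
  case (Disj \<phi> \<psi>)
  from Disj.prems show ?case
    using Disj.IH(1)[of X q \<sigma> \<tau>] Disj.IH(2)[of X q \<sigma> \<tau>] by simp
next
  case (Exists x \<phi>)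
  have step: "\<exists>z'<n. holds (\<tau>(x := z')) \<phi>"
    if H: "\<And>v. v \<in> X \<Longrightarrow> \<sigma> v < n \<and> \<tau> v < n"
      "\<And>v v'. v \<in> X \<Longrightarrow> v' \<in> X \<Longrightarrow> eqv q (\<sigma> v) (\<sigma> v') (\<tau> v) (\<tau> v')" "z < n" "holds (\<sigma>(x := z)) \<phi>"
    for z \<sigma> \<tau>
  proof -
    obtain p where q: "q = Suc p" using Exists.prems(3) by (cases q) auto
    obtain z' where z': "z' < n" "eqv p z z z' z'" "\<forall>i\<in>X. eqv p (\<sigma> i) z (\<tau> i) z'"
      using back_and_forth[of X \<sigma> \<tau> p z] H(1,3) H(2)[unfolded q] by blast
    \<comment> \<open>Pairs of old values drop to level \<open>p\<close> as well, to match the pairs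
      with the new value.\<close>
    have e: "eqv p (\<sigma> v) (\<sigma> v') (\<tau> v) (\<tau> v')" if "v \<in> X" "v' \<in> X" for v v'
      using eqv_Suc[OF _ _ _ _ H(2)[OF that, unfolded q]] H(1) that by blast
    have "holds (\<sigma>(x := z)) \<phi> \<longleftrightarrow> holds (\<tau>(x := z')) \<phi>"
    proof (rule Exists.IH[of "insert x X" p])
      show "eqv p ((\<sigma>(x := z)) v) ((\<sigma>(x := z)) v') ((\<tau>(x := z')) v) ((\<tau>(x := z')) v')"
        if "v \<in> insert x X" "v' \<in> insert x X" for v v'
        using that z' eqv_swap[OF z'(3)[rule_format]] e by (cases "v = x"; cases "v' = x") auto
    qed (use Exists.prems(1-3) H(1,3) z'(1) q in auto)
    then show ?thesis using H(4) z'(1) by blast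
  qed
  have "(\<exists>z<n. holds (\<sigma>(x := z)) \<phi>) \<longleftrightarrow> (\<exists>z<n. holds (\<tau>(x := z)) \<phi>)"
  proof
    assume "\<exists>z<n. holds (\<sigma>(x := z)) \<phi>"
    then obtain z where "z < n" "holds (\<sigma>(x := z)) \<phi>" by blast
    from step[of \<sigma> \<tau>, OF Exists.prems(4,5) this] show "\<exists>z<n. holds (\<tau>(x := z)) \<phi>" .
  next
    assume "\<exists>z<n. holds (\<tau>(x := z)) \<phi>"
    then obtain z where "z < n" "holds (\<tau>(x := z)) \<phi>" by blast
    from step[of \<tau> \<sigma>, OF Exists.prems(4)[THEN conj_commute[THEN iffD1]] eqv_sym[OF Exists.prems(5)] this]
    show "\<exists>z<n. holds (\<sigma>(x := z)) \<phi>" .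
  qed
  then show ?case by auto
next
  case (Forall x \<phi>)
  \<comment> \<open>Counterexamples are transferred, so the argument for the existential quantifier
    can be repeated.\<close>
  have step: "\<exists>z'<n. \<not> holds (\<tau>(x := z')) \<phi>"
    if H: "\<And>v. v \<in> X \<Longrightarrow> \<sigma> v < n \<and> \<tau> v < n"
      "\<And>v v'. v \<in> X \<Longrightarrow> v' \<in> X \<Longrightarrow> eqv q (\<sigma> v) (\<sigma> v') (\<tau> v) (\<tau> v')" "z < n" "\<not> holds (\<sigma>(x := z)) \<phi>"
    for z \<sigma> \<tau>
  proof -
    obtain p where q: "q = Suc p" using Forall.prems(3) by (cases q) auto
    obtain z' where z': "z' < n" "eqv p z z z' z'" "\<forall>i\<in>X. eqv p (\<sigma> i) z (\<tau> i) z'"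
      using back_and_forth[of X \<sigma> \<tau> p z] H(1,3) H(2)[unfolded q] by blast
    have e: "eqv p (\<sigma> v) (\<sigma> v') (\<tau> v) (\<tau> v')" if "v \<in> X" "v' \<in> X" for v v'
      using eqv_Suc[OF _ _ _ _ H(2)[OF that, unfolded q]] H(1) that by blast
    have "holds (\<sigma>(x := z)) \<phi> \<longleftrightarrow> holds (\<tau>(x := z')) \<phi>"
    proof (rule Forall.IH[of "insert x X" p])
      show "eqv p ((\<sigma>(x := z)) v) ((\<sigma>(x := z)) v') ((\<tau>(x := z')) v) ((\<tau>(x := z')) v')"
        if "v \<in> insert x X" "v' \<in> insert x X" for v v'
        using that z' eqv_swap[OF z'(3)[rule_format]] e by (cases "v = x"; cases "v' = x") auto
    qed (use Forall.prems(1-3) H(1,3) z'(1) q in auto)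
    then show ?thesis using H(4) z'(1) by blast
  qed
  have "(\<exists>z<n. \<not> holds (\<sigma>(x := z)) \<phi>) \<longleftrightarrow> (\<exists>z<n. \<not> holds (\<tau>(x := z)) \<phi>)"
  proof
    assume "\<exists>z<n. \<not> holds (\<sigma>(x := z)) \<phi>"
    then obtain z where "z < n" "\<not> holds (\<sigma>(x := z)) \<phi>" by blast
    from step[of \<sigma> \<tau>, OF Forall.prems(4,5) this] show "\<exists>z<n. \<not> holds (\<tau>(x := z)) \<phi>" .
  next
    assume "\<exists>z<n. \<not> holds (\<tau>(x := z)) \<phi>"
    then obtain z where "z < n" "\<not> holds (\<tau>(x := z)) \<phi>" by blast
    from step[of \<tau> \<sigma>, OF Forall.prems(4)[THEN conj_commute[THEN iffD1]] eqv_sym[OF Forall.prems(5)] this]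
    show "\<exists>z<n. \<not> holds (\<sigma>(x := z)) \<phi>" .
  qed
  then show ?case by auto
qed

end

section \<open>The number of classes of pairs\<close>

text \<open>\<open>c\<close> labels form \<open>c * c\<close> pairs, and \<open>le\<close> in the
  two directions has four cases. A round replaces the class of a pair by a set of pairs of
  classes.\<close>

primrec class_bound :: "nat \<Rightarrow> nat \<Rightarrow> nat" where
  "class_bound c 0 = 4 * (c * c)"
| "class_bound c (Suc q) = 2 ^ (class_bound c q * class_bound c q)"

context coloured_poset
begin

text \<open>Pairs of values that do not involve \<open>x\<close> are the same on both sides, so only
  the types towards the new value matter. This lets a quantifier range over representatives.\<close>

lemma candidates:
  assumes "set_fo \<psi> \<subseteq> C" "rank \<psi> \<le> q" "z < n" "e < n"
    and "eqv q z z e e" "\<And>v. v \<in> free_vars \<psi> - {x} \<Longrightarrow> \<sigma> v < n \<and> eqv q (\<sigma> v) z (\<sigma> v) e"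
  shows "holds (\<sigma>(x := z)) \<psi> \<longleftrightarrow> holds (\<sigma>(x := e)) \<psi>"
proof (rule sat_eqv[where X = "free_vars \<psi>" and q = q])
  fix v v' assume v: "v \<in> free_vars \<psi>" "v' \<in> free_vars \<psi>"
  then show "eqv q ((\<sigma>(x := z)) v) ((\<sigma>(x := z)) v') ((\<sigma>(x := e)) v) ((\<sigma>(x := e)) v')"
    using assms(5,6) eqv_refl eqv_swap by (cases "v = x"; cases "v' = x") auto
qed (use assms in auto)

end

context labelled_poset
begin

lemma code_pairs:
  assumes "finite S" "card S \<le> b" "\<And>x y. x < n \<Longrightarrow> y < n \<Longrightarrow> G x y \<in> S"
  shows "\<exists>F. (\<forall>x<n. \<forall>y<n. F x y < b) \<and>
    (\<forall>x<n. \<forall>y<n. \<forall>x'<n. \<forall>y'<n. G x y = G x' y' \<longleftrightarrow> F x y = (F x' y' :: nat))"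
proof -
  obtain g where g: "inj_on g S" "g ` S \<subseteq> {..<b}"
    using inj_on_iff_card_le[OF assms(1), of "{..<b}"] assms(2) by auto
  show ?thesis
    by (rule exI[of _ "\<lambda>x y. g (G x y)"]) (use g assms(3) in \<open>auto dest: inj_onD[OF g(1)]\<close>)
qed

text \<open>Turns the back-and-forth clause of a round into equality of two sets of class numbers,
  which can be counted.\<close>

lemma image_eq_iff:
  assumes "\<And>z z'. z < n \<Longrightarrow> z' < n \<Longrightarrow> E z z' \<longleftrightarrow> f z = g z'"
  shows "f ` {..<n} = g ` {..<n} \<longleftrightarrow> (\<forall>z<n. \<exists>z'<n. E z z') \<and> (\<forall>z'<n. \<exists>z<n. E z z')"
proof
  assume e: "f ` {..<n} = g ` {..<n}"
  show "(\<forall>z<n. \<exists>z'<n. E z z') \<and> (\<forall>z'<n. \<exists>z<n. E z z')"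
  proof (intro conjI allI impI)
    fix z assume z: "z < n"
    then have "f z \<in> g ` {..<n}" using e by blast
    then show "\<exists>z'<n. E z z'" using assms z by auto
  next
    fix z assume z: "z < n"
    then have "g z \<in> f ` {..<n}" using e by blast
    then show "\<exists>z'<n. E z' z" using assms z by auto
  qed
next
  assume e: "(\<forall>z<n. \<exists>z'<n. E z z') \<and> (\<forall>z'<n. \<exists>z<n. E z z')"
  show "f ` {..<n} = g ` {..<n}"
  proof (intro set_eqI iffI)
    fix v assume "v \<in> f ` {..<n}"
    then obtain z z' where "v = f z" "z < n" "z' < n" "E z z'" using e by blast
    then show "v \<in> g ` {..<n}" using assms by auto
  next
    fix v assume "v \<in> g ` {..<n}"
    then obtain z z' where "v = g z'" "z < n" "z' < n" "E z z'" using e by blast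
    then show "v \<in> f ` {..<n}" using assms by (metis image_eqI lessThan_iff)
  qed
qed

lemma eqv_classes:
  assumes "card (u ` {..<n}) \<le> c"
  shows "\<exists>F. (\<forall>x<n. \<forall>y<n. F x y < class_bound c q) \<and>
    (\<forall>x<n. \<forall>y<n. \<forall>x'<n. \<forall>y'<n. eqv q x y x' y' \<longleftrightarrow> F x y = (F x' y' :: nat))"
proof (induction q)
  case 0
  let ?U = "u ` {..<n}"
  have "\<exists>F. (\<forall>x<n. \<forall>y<n. F x y < class_bound c 0) \<and>
    (\<forall>x<n. \<forall>y<n. \<forall>x'<n. \<forall>y'<n. (\<lambda>x y. (u x, u y, le x y, le y x)) x y = (\<lambda>x y. (u x, u y, le x y, le y x)) x' y'
      \<longleftrightarrow> F x y = (F x' y' :: nat))"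
  proof (rule code_pairs[where S = "?U \<times> ?U \<times> UNIV \<times> UNIV"])
    have "card ?U * card ?U \<le> c * c" using assms by (intro mult_le_mono)
    then show "card (?U \<times> ?U \<times> (UNIV::bool set) \<times> (UNIV::bool set)) \<le> class_bound c 0"
      by (simp add: card_cartesian_product card_UNIV_bool del: UNIV_Times_UNIV)
  qed auto
  then show ?case by auto
next
  case (Suc q)
  let ?b = "class_bound c q"
  obtain F where F: "\<And>x y. x < n \<Longrightarrow> y < n \<Longrightarrow> F x y < ?b"
    "\<And>x y x' y'. x < n \<Longrightarrow> y < n \<Longrightarrow> x' < n \<Longrightarrow> y' < n \<Longrightarrow> eqv q x y x' y' \<longleftrightarrow> F x y = (F x' y' :: nat)"
    using Suc by metis
  let ?G = "\<lambda>x y. (\<lambda>z. (F x z, F z y)) ` {..<n}"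
  have G: "eqv (Suc q) x y x' y' \<longleftrightarrow> ?G x y = ?G x' y'" if "x < n" "y < n" "x' < n" "y' < n" for x y x' y'
    unfolding eqv.simps(2) by (rule image_eq_iff[symmetric]) (use F(2) that in simp)
  have "\<exists>F. (\<forall>x<n. \<forall>y<n. F x y < class_bound c (Suc q)) \<and>
    (\<forall>x<n. \<forall>y<n. \<forall>x'<n. \<forall>y'<n. ?G x y = ?G x' y' \<longleftrightarrow> F x y = (F x' y' :: nat))"
    by (rule code_pairs[where S = "Pow ({..<?b} \<times> {..<?b})"]) (use F(1) in \<open>auto simp: card_Pow card_cartesian_product\<close>)
  then show ?case using G by auto
qed

text \<open>Bounds the number of representatives that the program collects during a round.\<close>

lemma inequivalent_pairs_bound:
  assumes "card (u ` {..<n}) \<le> c" "\<And>r. r < k \<Longrightarrow> X r < n \<and> Y r < n"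
    and "\<And>r r'. r < r' \<Longrightarrow> r' < k \<Longrightarrow> \<not> eqv q (X r) (Y r) (X r') (Y r')"
  shows "k \<le> class_bound c q"
proof -
  obtain F where F: "\<And>x y. x < n \<Longrightarrow> y < n \<Longrightarrow> F x y < class_bound c q"
    "\<And>x y x' y'. x < n \<Longrightarrow> y < n \<Longrightarrow> x' < n \<Longrightarrow> y' < n \<Longrightarrow> eqv q x y x' y' \<longleftrightarrow> F x y = (F x' y' :: nat)"
    using eqv_classes[OF assms(1)] by metis
  have "F (X r) (Y r) \<noteq> F (X r') (Y r')" if "r < r'" "r' < k" for r r'
    using assms(3)[OF that] assms(2)[of r] assms(2)[of r'] F(2) that by auto
  then have "inj_on (\<lambda>r. F (X r) (Y r)) {..<k}" by (intro linorder_inj_onI) auto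
  then have "card {..<k} \<le> card {..<class_bound c q}"
    by (rule card_inj_on_le) (use assms(2) F(1) in auto)
  then show ?thesis by simp
qed

end

text \<open>Meant for one round of selection: \<open>d e\<close> is the diagonal type of the chosen
  element number \<open>e\<close>, and \<open>f j e\<close> its type towards the \<open>j\<close>-th
  older one; in all \<open>Suc m\<close> numbers below \<open>K\<close>.\<close>

lemma distinct_vectors_bound:
  assumes "a \<le> b" "\<And>e. a \<le> e \<Longrightarrow> e < b \<Longrightarrow> d e < (K::nat) \<and> (\<forall>j<m. f j e < K)"
    and "\<And>e e'. a \<le> e \<Longrightarrow> e < e' \<Longrightarrow> e' < b \<Longrightarrow> \<not> (d e = d e' \<and> (\<forall>j<m. f j e = f j e'))"
  shows "b - a \<le> K ^ Suc m"
proof -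
  let ?v = "\<lambda>e. d e # map (\<lambda>j. f j e) [0..<m]"
  have "inj_on ?v {a..<b}"
  proof (rule linorder_inj_onI)
    fix e e' assume *: "e < e'" "e \<in> {a..<b}" "e' \<in> {a..<b}"
    then show "?v e \<noteq> ?v e'" using assms(3)[of e e'] by auto
  qed auto
  then have "card {a..<b} \<le> card {xs. set xs \<subseteq> {..<K} \<and> length xs = Suc m}"
    by (rule card_inj_on_le) (use assms(2) finite_lists_length_eq[of "{..<K}"] in auto)
  then show ?thesis using card_lists_length_eq[of "{..<K}" "Suc m"] by simp
qed

section \<open>Chain partitions as matchings, and Koenig's antichain\<close>

locale strict_poset =
  fixes n :: nat and lt :: "nat \<Rightarrow> nat \<Rightarrow> bool"
  assumes lt_irrefl: "x < n \<Longrightarrow> \<not> lt x x"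
    and lt_trans: "x < n \<Longrightarrow> y < n \<Longrightarrow> z < n \<Longrightarrow> lt x y \<Longrightarrow> lt y z \<Longrightarrow> lt x z"
begin

text \<open>A chain partition as a matching: \<open>nx x = Suc y\<close> and \<open>pv y = Suc x\<close> say that \<open>y\<close> follows \<open>x\<close> in
  its chain, and 0 stands for none. While an augmenting path is being flipped, \<open>cur = Suc y\<close> names
  the element \<open>y\<close> that has lost its predecessor and whose entry in \<open>pv\<close> is out of date.\<close>

definition matching :: "nat \<Rightarrow> (nat \<Rightarrow> nat) \<Rightarrow> (nat \<Rightarrow> nat) \<Rightarrow> bool" where
  "matching cur nx pv \<longleftrightarrow>
     (\<forall>x<n. nx x \<noteq> 0 \<longrightarrow> nx x - 1 < n \<and> lt x (nx x - 1) \<and> nx x \<noteq> cur \<and> pv (nx x - 1) = Suc x) \<and>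
     (\<forall>y<n. Suc y \<noteq> cur \<longrightarrow> pv y \<noteq> 0 \<longrightarrow> pv y - 1 < n \<and> nx (pv y - 1) = Suc y)"

lemma matching_start: "matching 0 nx pv \<Longrightarrow> y < n \<Longrightarrow> pv y = 0 \<Longrightarrow> matching (Suc y) nx pv"
  unfolding matching_def by auto

text \<open>Giving \<open>y\<close> to \<open>x\<close> orphans the former successor of
  \<open>x\<close>, which becomes the new \<open>cur\<close>. If there was none, the new
  \<open>cur\<close> is 0 and the matching is consistent again.\<close>

lemma matching_flip:
  assumes "matching (Suc y) nx pv" "y < n" "x < n" "lt x y"
  shows "matching (nx x) (nx(x := Suc y)) (pv(y := Suc x))"
  unfolding matching_def
proof (intro conjI allI impI)
  fix x' assume x': "x' < n" "(nx(x := Suc y)) x' \<noteq> 0"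
  have a: "\<And>x. x < n \<Longrightarrow> nx x \<noteq> 0 \<Longrightarrow> nx x - 1 < n \<and> lt x (nx x - 1) \<and> nx x \<noteq> Suc y \<and> pv (nx x - 1) = Suc x"
    using assms(1) unfolding matching_def by blast
  show "(nx(x := Suc y)) x' - 1 < n" "lt x' ((nx(x := Suc y)) x' - 1)"
    using a[of x'] x' assms by (auto split: if_splits)
  \<comment> \<open>\<open>pv\<close> inverts \<open>nx\<close>, so no element besides
    \<open>x\<close> pointed to the old successor of \<open>x\<close>.\<close>
  show "(nx(x := Suc y)) x' \<noteq> nx x"
  proof
    assume e: "(nx(x := Suc y)) x' = nx x"
    show False
    proof (cases "x' = x")
      case True
      then show False using e a[of x] assms(3) by auto
    next
      case False
      then show False using e a[of x] a[of x'] x' assms(3) by auto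
    qed
  qed
  show "(pv(y := Suc x)) ((nx(x := Suc y)) x' - 1) = Suc x'"
    using a[of x'] x' by (auto split: if_splits)
next
  fix y' assume y': "y' < n" "Suc y' \<noteq> nx x" "(pv(y := Suc x)) y' \<noteq> 0"
  then show "(pv(y := Suc x)) y' - 1 < n" "(nx(x := Suc y)) ((pv(y := Suc x)) y' - 1) = Suc y'"
    using assms unfolding matching_def by (auto split: if_splits)
qed

text \<open>A Koenig certificate in the bipartite graph of \<open>lt\<close>: \<open>Z\<close> on
  the left and \<open>T\<close> on the right contain the unmatched left vertices, are closed under
  alternating paths, and contain no unmatched right vertex.\<close>

definition stuck :: "(nat \<Rightarrow> nat) \<Rightarrow> (nat \<Rightarrow> nat) \<Rightarrow> bool" where
  "stuck nx pv \<longleftrightarrow> (\<exists>Z T. Z \<subseteq> {..<n} \<and> T \<subseteq> {..<n} \<and> (\<forall>x<n. nx x = 0 \<longrightarrow> x \<in> Z) \<and>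
     (\<forall>x\<in>Z. \<forall>y<n. lt x y \<longrightarrow> y \<in> T) \<and> (\<forall>y\<in>T. pv y \<noteq> 0 \<and> pv y - 1 \<in> Z))"

definition pred :: "(nat \<Rightarrow> nat) \<Rightarrow> nat \<Rightarrow> nat" where
  "pred pv x = (if pv x = 0 then x else pv x - 1)"

text \<open>\<open>pred\<close> is stationary at the bottom of a chain, and \<open>n\<close> steps
  always reach the bottom, so this value names the chain.\<close>

definition root :: "(nat \<Rightarrow> nat) \<Rightarrow> nat \<Rightarrow> nat" where
  "root pv x = (pred pv ^^ n) x"

context
  fixes nx pv assumes M: "matching 0 nx pv"
begin

lemma matching_next: "x < n \<Longrightarrow> nx x \<noteq> 0 \<Longrightarrow> nx x - 1 < n \<and> lt x (nx x - 1) \<and> pv (nx x - 1) = Suc x"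
  using M unfolding matching_def by blast

lemma matching_prev: "y < n \<Longrightarrow> pv y \<noteq> 0 \<Longrightarrow> pv y - 1 < n \<and> nx (pv y - 1) = Suc y"
  using M unfolding matching_def by (metis nat.distinct(1))

lemma pred_less: "x < n \<Longrightarrow> pred pv x < n"
  using matching_prev[of x] unfolding pred_def by auto

lemma pred_lt: "x < n \<Longrightarrow> pv x \<noteq> 0 \<Longrightarrow> lt (pred pv x) x"
  using matching_prev[of x] matching_next[of "pv x - 1"] unfolding pred_def by auto

lemma pred_inj: "x < n \<Longrightarrow> y < n \<Longrightarrow> pv x \<noteq> 0 \<Longrightarrow> pv y \<noteq> 0 \<Longrightarrow> pred pv x = pred pv y \<Longrightarrow> x = y"
  using matching_prev[of x] matching_prev[of y] unfolding pred_def by auto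

lemma funpow_pred_less: "x < n \<Longrightarrow> (pred pv ^^ k) x < n"
  by (induction k) (auto simp: pred_less)

text \<open>The number of elements below is the measure for inductions down a chain.\<close>

lemma lt_wf_down: "x < n \<Longrightarrow> lt y x \<Longrightarrow> y < n \<Longrightarrow> card {z. z < n \<and> lt z y} < card {z. z < n \<and> lt z x}"
proof (rule psubset_card_mono)
  assume "x < n" "lt y x" "y < n"
  then have "{z. z < n \<and> lt z y} \<subseteq> {z. z < n \<and> lt z x}" "y \<in> {z. z < n \<and> lt z x}"
    using lt_trans[of _ y x] by blast+
  then show "{z. z < n \<and> lt z y} \<subset> {z. z < n \<and> lt z x}" using lt_irrefl[OF \<open>y < n\<close>] by blast
qed simp

lemma lt_wf_up: "x < n \<Longrightarrow> lt x y \<Longrightarrow> y < n \<Longrightarrow> card {z. z < n \<and> lt y z} < card {z. z < n \<and> lt x z}"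
proof (rule psubset_card_mono)
  assume "x < n" "lt x y" "y < n"
  then have "{z. z < n \<and> lt y z} \<subseteq> {z. z < n \<and> lt x z}" "y \<in> {z. z < n \<and> lt x z}"
    using lt_trans[of x y] by blast+
  then show "{z. z < n \<and> lt y z} \<subset> {z. z < n \<and> lt x z}" using lt_irrefl[OF \<open>y < n\<close>] by blast
qed simp

lemma bottom_aux: "x < n \<Longrightarrow> card {z. z < n \<and> lt z x} \<le> k \<Longrightarrow> pv ((pred pv ^^ k) x) = 0"
proof (induction k arbitrary: x)
  case 0
  then show ?case using pred_lt[of x] pred_less[of x] by (auto simp: card_eq_0_iff)
next
  case (Suc k)
  show ?case
  proof (cases "pv x = 0")
    case True
    then have "(pred pv ^^ j) x = x" for j by (induction j) (auto simp: pred_def)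
    then show ?thesis using True by metis
  next
    case False
    have "card {z. z < n \<and> lt z (pred pv x)} \<le> k"
      using lt_wf_down[of x "pred pv x"] pred_lt pred_less False Suc.prems by fastforce
    then show ?thesis using Suc.IH[of "pred pv x"] pred_less Suc.prems by (simp add: funpow_swap1)
  qed
qed

lemma root_bottom: "x < n \<Longrightarrow> pv (root pv x) = 0"
  unfolding root_def
  by (rule bottom_aux) (auto intro: order_trans[OF card_mono[of "{..<n}"]])

lemma root_pred: "x < n \<Longrightarrow> root pv (pred pv x) = root pv x"
proof -
  assume "x < n"
  have "root pv (pred pv x) = pred pv (root pv x)" unfolding root_def by (simp add: funpow_swap1)
  then show ?thesis using root_bottom[OF \<open>x < n\<close>] by (simp add: pred_def)
qed

lemma funpow_pred_le: "y < n \<Longrightarrow> (pred pv ^^ k) y = y \<or> lt ((pred pv ^^ k) y) y"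
proof (induction k)
  case (Suc k)
  let ?z = "(pred pv ^^ k) y"
  have z: "?z < n" using funpow_pred_less Suc.prems by blast
  show ?case
  proof (cases "pv ?z = 0")
    case True
    then have "pred pv ?z = ?z" by (simp add: pred_def)
    then show ?thesis using Suc by simp
  next
    case False
    then show ?thesis using Suc pred_lt[OF z] lt_trans[OF pred_less[OF z] z Suc.prems] by auto
  qed
qed simp

lemma depth_exists:
  assumes "x < n"
  obtains k where "pv ((pred pv ^^ k) x) = 0" "\<forall>j<k. pv ((pred pv ^^ j) x) \<noteq> 0" "(pred pv ^^ k) x = root pv x"
proof -
  define k where "k = (LEAST k. pv ((pred pv ^^ k) x) = 0)"
  have ex: "pv ((pred pv ^^ n) x) = 0" using root_bottom[OF assms] by (simp add: root_def)
  let ?P = "\<lambda>k. pv ((pred pv ^^ k) x) = 0"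
  have k: "pv ((pred pv ^^ k) x) = 0" "k \<le> n"
    unfolding k_def using LeastI[of ?P n] Least_le[of ?P n] ex by auto
  have "(pred pv ^^ j) ((pred pv ^^ k) x) = (pred pv ^^ k) x" for j
    using k(1) by (induction j) (auto simp: pred_def)
  from this[of "n - k"] have "(pred pv ^^ k) x = root pv x"
    using k(2) by (simp add: root_def flip: funpow_add[THEN fun_cong, unfolded comp_def])
  then show ?thesis using that[of k] k(1) not_less_Least unfolding k_def by metis
qed

text \<open>\<open>pred\<close> is injective away from the bottoms, so both paths can be retraced
  from their common end until the shorter one is used up; what remains of the longer one leads from
  \<open>y\<close> to \<open>x\<close>.\<close>

lemma depth_compare:
  assumes "x < n" "y < n" "a \<le> b" "(pred pv ^^ a) x = (pred pv ^^ b) y"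
    and "\<forall>j<a. pv ((pred pv ^^ j) x) \<noteq> 0" "\<forall>j<b. pv ((pred pv ^^ j) y) \<noteq> 0"
  shows "(pred pv ^^ (b - a)) y = x"
  using assms
proof (induction a arbitrary: x y b)
  case (Suc a)
  then obtain b' where b: "b = Suc b'" by (cases b) auto
  have "(pred pv ^^ (b' - a)) (pred pv y) = pred pv x"
  proof (rule Suc.IH)
    show "\<forall>j<a. pv ((pred pv ^^ j) (pred pv x)) \<noteq> 0" "\<forall>j<b'. pv ((pred pv ^^ j) (pred pv y)) \<noteq> 0"
      using Suc.prems(5,6) b by (auto simp: funpow_swap1 simp flip: funpow.simps(2)[THEN fun_cong, unfolded comp_def])
  qed (use Suc.prems b pred_less in \<open>auto simp: funpow_swap1\<close>)
  then have "pred pv ((pred pv ^^ (b' - a)) y) = pred pv x" by (simp add: funpow_swap1)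
  moreover have "pv ((pred pv ^^ (b' - a)) y) \<noteq> 0" using Suc.prems(6) b by simp
  moreover have "pv x \<noteq> 0" using Suc.prems(5) by (metis funpow_0 zero_less_Suc)
  ultimately have "(pred pv ^^ (b' - a)) y = x" using pred_inj funpow_pred_less Suc.prems by blast
  then show ?case using b by simp
qed simp

lemma root_chain:
  assumes "x < n" "y < n" "root pv x = root pv y"
  shows "x = y \<or> lt x y \<or> lt y x"
proof -
  obtain a where a: "\<forall>j<a. pv ((pred pv ^^ j) x) \<noteq> 0" "(pred pv ^^ a) x = root pv x"
    using depth_exists[OF assms(1)] by metis
  obtain b where b: "\<forall>j<b. pv ((pred pv ^^ j) y) \<noteq> 0" "(pred pv ^^ b) y = root pv y"
    using depth_exists[OF assms(2)] by metis
  have "(\<exists>k. (pred pv ^^ k) y = x) \<or> (\<exists>k. (pred pv ^^ k) x = y)"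
    using depth_compare[of x y a b] depth_compare[of y x b a] a b assms by (metis nle_le)
  then show ?thesis using funpow_pred_le assms by metis
qed

text \<open>Koenig's argument: the elements in \<open>Z - T\<close> form an antichain that meets every chain.\<close>

lemma stuck_antichain:
  assumes "stuck nx pv"
  shows "\<exists>A\<subseteq>{..<n}. (\<forall>x\<in>A. \<forall>y\<in>A. \<not> lt x y) \<and> card (root pv ` {..<n}) \<le> card A"
proof -
  obtain Z T where Z: "Z \<subseteq> {..<n}" "\<And>x. x < n \<Longrightarrow> nx x = 0 \<Longrightarrow> x \<in> Z"
    "\<And>x y. x \<in> Z \<Longrightarrow> y < n \<Longrightarrow> lt x y \<Longrightarrow> y \<in> T" "\<And>y. y \<in> T \<Longrightarrow> pv y \<noteq> 0 \<and> pv y - 1 \<in> Z"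
    using assms unfolding stuck_def by metis
  \<comment> \<open>Walk down the chain: an element of \<open>T\<close> has its predecessor in
    \<open>Z\<close>, and the walk ends outside \<open>T\<close>, since members of \<open>T\<close>
    always have a predecessor.\<close>
  have down: "\<exists>v\<in>Z - T. root pv v = root pv x" if "x \<in> Z" for x
    using that
  proof (induction "card {z. z < n \<and> lt z x}" arbitrary: x rule: less_induct)
    case less
    then have x: "x < n" using Z by auto
    show ?case
    proof (cases "x \<in> T")
      case True
      then have p: "pv x \<noteq> 0" "pred pv x \<in> Z" using Z(4)[of x] by (auto simp: pred_def)
      from less.hyps[OF lt_wf_down[OF x pred_lt[OF x p(1)] pred_less[OF x]] p(2)]
      show ?thesis using root_pred[OF x] by simp
    next
      case False
      then show ?thesis using less.prems by blast
    qed
  qed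
  \<comment> \<open>Walk up the chain to its top, which has no successor and therefore lies in
    \<open>Z\<close>.\<close>
  have up: "\<exists>v\<in>Z. root pv v = root pv x" if "x < n" for x
    using that
  proof (induction "card {z. z < n \<and> lt x z}" arbitrary: x rule: less_induct)
    case less
    show ?case
    proof (cases "nx x = 0")
      case True
      then show ?thesis using Z less.prems by blast
    next
      case False
      let ?y = "nx x - 1"
      have y: "?y < n" "lt x ?y" "pv ?y = Suc x" using matching_next False less.prems by blast+
      then have "root pv ?y = root pv x" using root_pred[OF y(1)] by (simp add: pred_def)
      then show ?thesis using less.hyps[OF lt_wf_up[OF less.prems y(2,1)] y(1)] by simp
    qed
  qed
  have "root pv ` {..<n} \<subseteq> root pv ` (Z - T)" 
  proof
    fix b assume "b \<in> root pv ` {..<n}"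
    then obtain x where "x < n" "b = root pv x" by blast
    then obtain v where "v \<in> Z - T" "root pv v = b" using up down by metis
    then show "b \<in> root pv ` (Z - T)" by blast
  qed
  moreover have "finite (Z - T)" using Z(1) finite_subset by blast
  ultimately have "card (root pv ` {..<n}) \<le> card (Z - T)"
    by (meson card_image_le card_mono finite_imageI order_trans)
  moreover have "Z - T \<subseteq> {..<n}" "\<forall>x\<in>Z - T. \<forall>y\<in>Z - T. \<not> lt x y" using Z by blast+
  ultimately show ?thesis by blast
qed

end

end

section \<open>Augmenting paths\<close>

context strict_poset
begin

definition matched :: "(nat \<Rightarrow> nat) \<Rightarrow> nat" where
  "matched nx = card {x. x < n \<and> nx x \<noteq> 0}"

text \<open>The search for an augmenting path: \<open>q\<close> is a queue of \<open>qn\<close> elements whose successors in the order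
  are to be visited, \<open>vis\<close> marks the visited elements, \<open>par y\<close> is the queue position from which \<open>y\<close>
  was reached, and \<open>fin = Suc y\<close> records a visited \<open>y\<close> without predecessor in its chain. Positions
  decrease along the path back from \<open>y\<close>, so flipping it terminates.\<close>

definition search_inv where
  "search_inv nx pv q qn vis par fin \<longleftrightarrow>
     (\<forall>j<qn. q j < n \<and> (nx (q j) \<noteq> 0 \<longrightarrow> vis (nx (q j) - 1) \<noteq> (0::nat) \<and> par (nx (q j) - 1) < j)) \<and>
     inj_on q {..<qn} \<and>
     (\<forall>y<n. vis y \<noteq> 0 \<longrightarrow> par y < qn \<and> lt (q (par y)) y \<and>
        (pv y = 0 \<longrightarrow> fin \<noteq> 0) \<and> (pv y \<noteq> 0 \<longrightarrow> pv y - 1 \<in> q ` {..<qn})) \<and>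
     (fin \<noteq> 0 \<longrightarrow> fin - 1 < n \<and> vis (fin - 1) \<noteq> 0 \<and> pv (fin - 1) = 0) \<and>
     (\<forall>x<n. nx x = 0 \<longrightarrow> x \<in> q ` {..<qn})"

text \<open>The queue holds each element at most once. Hence \<open>n\<close> rounds of the search
  exhaust it, and its positions are below \<open>n\<close>.\<close>

lemma search_inv_qn_le:
  assumes "search_inv nx pv q qn vis par fin"
  shows "qn \<le> n"
proof -
  have "inj_on q {..<qn}" "q ` {..<qn} \<subseteq> {..<n}" using assms unfolding search_inv_def by auto
  then have "card {..<qn} \<le> card {..<n}" by (intro card_inj_on_le) auto
  then show ?thesis by simp
qed

lemma search_inv_free:
  assumes I: "search_inv nx pv q qn vis par fin" and M: "matching 0 nx pv"
    and "i < qn" "y < n" "lt (q i) y" "vis y = 0" "pv y = 0"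
  shows "search_inv nx pv q qn (vis(y := 1)) (par(y := i)) (Suc y)"
  using I assms(3-) unfolding search_inv_def by auto

lemma search_inv_push:
  assumes I: "search_inv nx pv q qn vis par fin" and M: "matching 0 nx pv"
    and y: "i < qn" "y < n" "lt (q i) y" "vis y = 0" "pv y \<noteq> 0"
  shows "search_inv nx pv (q(qn := pv y - 1)) (Suc qn) (vis(y := 1)) (par(y := i)) fin"
proof -
  let ?x = "pv y - 1"
  have x: "?x < n" "nx ?x = Suc y" using M y unfolding matching_def by auto
  have I1: "\<And>j. j < qn \<Longrightarrow> q j < n \<and> (nx (q j) \<noteq> 0 \<longrightarrow> vis (nx (q j) - 1) \<noteq> 0 \<and> par (nx (q j) - 1) < j)"
    and I2: "inj_on q {..<qn}"
    and I3: "\<And>y. y < n \<Longrightarrow> vis y \<noteq> 0 \<Longrightarrow> par y < qn \<and> lt (q (par y)) y \<and>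
        (pv y = 0 \<longrightarrow> fin \<noteq> 0) \<and> (pv y \<noteq> 0 \<longrightarrow> pv y - 1 \<in> q ` {..<qn})"
    and I4: "fin \<noteq> 0 \<longrightarrow> fin - 1 < n \<and> vis (fin - 1) \<noteq> 0 \<and> pv (fin - 1) = 0"
    and I5: "\<And>x. x < n \<Longrightarrow> nx x = 0 \<Longrightarrow> x \<in> q ` {..<qn}"
    using I unfolding search_inv_def by blast+
  \<comment> \<open>Were this element queued already, its successor \<open>y\<close> would be marked
    as visited.\<close>
  have new: "?x \<notin> q ` {..<qn}"
  proof
    assume "?x \<in> q ` {..<qn}"
    then obtain j where "j < qn" "q j = ?x" by auto
    then show False using I1[of j] x y by simp
  qed
  show ?thesis unfolding search_inv_def
  proof (intro conjI allI impI)
    show "inj_on (q(qn := ?x)) {..<Suc qn}"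
      using I2 new by (simp add: lessThan_Suc inj_on_fun_updI)
    fix j assume j: "j < Suc qn"
    show "(q(qn := ?x)) j < n" using I1[of j] x j by auto
    assume nz: "nx ((q(qn := ?x)) j) \<noteq> 0"
    show "(vis(y := 1)) (nx ((q(qn := ?x)) j) - 1) \<noteq> 0"
      using I1[of j] x j nz by (cases "j = qn") auto
    show "(par(y := i)) (nx ((q(qn := ?x)) j) - 1) < j"
      using I1[of j] x j nz y by (cases "j = qn") auto
  next
    fix y' assume y': "y' < n" "(vis(y := 1)) y' \<noteq> 0"
    show "(par(y := i)) y' < Suc qn" using I3[of y'] y y' by (auto split: if_splits)
    show "lt ((q(qn := ?x)) ((par(y := i)) y')) y'" using I3[of y'] y y' by (auto split: if_splits)
    show "fin \<noteq> 0" if "pv y' = 0" using I3[of y'] y y' that by (auto split: if_splits)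
    show "pv y' - 1 \<in> (q(qn := ?x)) ` {..<Suc qn}" if nz: "pv y' \<noteq> 0"
    proof (cases "y' = y")
      case True
      then show ?thesis by (intro image_eqI[of _ _ qn]) auto
    next
      case False
      then obtain j where "j < qn" "pv y' - 1 = q j" using I3[of y'] y' nz False by auto
      then show ?thesis by (intro image_eqI[of _ _ j]) auto
    qed
  next
    fix x' assume "x' < n" "nx x' = 0"
    then obtain j where "j < qn" "x' = q j" using I5[of x'] by auto
    then show "x' \<in> (q(qn := ?x)) ` {..<Suc qn}" by (intro image_eqI[of _ _ j]) auto
  qed (use I4 y in auto)
qed

text \<open>An exhausted search that met no element without predecessor is itself the certificate:
  the queue on the left, the visited elements on the right.\<close>

lemma search_stuck:
  assumes I: "search_inv nx pv q qn vis par 0"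
    and closed: "\<And>j y. j < qn \<Longrightarrow> y < n \<Longrightarrow> lt (q j) y \<Longrightarrow> vis y \<noteq> 0"
  shows "stuck nx pv"
  unfolding stuck_def
proof (intro exI conjI)
  show "q ` {..<qn} \<subseteq> {..<n}" "\<forall>x<n. nx x = 0 \<longrightarrow> x \<in> q ` {..<qn}"
    using I unfolding search_inv_def by auto
  show "{y. y < n \<and> vis y \<noteq> 0} \<subseteq> {..<n}" by auto
  show "\<forall>x\<in>q ` {..<qn}. \<forall>y<n. lt x y \<longrightarrow> y \<in> {y. y < n \<and> vis y \<noteq> 0}" using closed by auto
  show "\<forall>y\<in>{y. y < n \<and> vis y \<noteq> 0}. pv y \<noteq> 0 \<and> pv y - 1 \<in> q ` {..<qn}"
    using I unfolding search_inv_def by blast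
qed

text \<open>For the case that every round of the outer loop succeeds: then no element is left
  without successor, and empty sets are a certificate.\<close>

lemma perfect_stuck:
  assumes "n \<le> matched nx"
  shows "stuck nx pv"
proof -
  have "{x. x < n \<and> nx x \<noteq> 0} = {..<n}"
    using assms by (intro card_seteq) (auto simp: matched_def)
  then show ?thesis unfolding stuck_def by (intro exI[of _ "{}"]) auto
qed

text \<open>The queue position drops at every flip, so \<open>par (cur - 1) + t < n\<close> bounds
  their number. Successors at positions up to \<open>par (cur - 1)\<close> are still the old ones,
  so the search data describe the rest of the path. The gain of one matched element arrives when
  \<open>cur\<close> becomes 0.\<close>

definition flip_inv where
  "flip_inv nx q vis par t cur nx' pv' \<longleftrightarrow> matching cur nx' pv' \<and>
     (cur \<noteq> 0 \<longrightarrow> cur - 1 < n \<and> vis (cur - 1) \<noteq> (0::nat) \<and> par (cur - 1) + t < n \<and>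
        (\<forall>j\<le>par (cur - 1). nx' (q j) = nx (q j))) \<and>
     matched nx' + (if cur = 0 then 0 else 1) = Suc (matched nx)"

lemma flip_inv_start:
  assumes "search_inv nx pv q qn vis par fin" "matching 0 nx pv" "fin \<noteq> 0"
  shows "flip_inv nx q vis par 0 fin nx pv"
proof -
  have f: "fin - 1 < n" "vis (fin - 1) \<noteq> 0" "pv (fin - 1) = 0" "par (fin - 1) < qn"
    using assms unfolding search_inv_def by blast+
  then show ?thesis unfolding flip_inv_def
    using matching_start[OF assms(2) f(1,3)] assms(3) search_inv_qn_le[OF assms(1)] by simp
qed

lemma flip_inv_step:
  assumes I: "search_inv nx pv q qn vis par fin"
    and F: "flip_inv nx q vis par t cur nx' pv'" and cur: "cur \<noteq> 0"
  defines "x \<equiv> q (par (cur - 1))"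
  shows "flip_inv nx q vis par (Suc t) (nx' x) (nx'(x := cur)) (pv'(cur - 1 := Suc x))"
proof -
  let ?y = "cur - 1"
  have y: "?y < n" "vis ?y \<noteq> 0" "par ?y + t < n" "\<And>j. j \<le> par ?y \<Longrightarrow> nx' (q j) = nx (q j)"
    and M: "matching cur nx' pv'" and c: "matched nx' = matched nx"
    using F cur unfolding flip_inv_def by auto
  have p: "par ?y < qn" "lt x ?y" using I y unfolding search_inv_def x_def by blast+
  then have x: "x < n" using I unfolding search_inv_def x_def by blast
  have M': "matching (nx' x) (nx'(x := cur)) (pv'(?y := Suc x))"
    using matching_flip[of ?y nx' pv' x] M y p x cur by simp
  have nx: "nx' x = nx x" using y(4) unfolding x_def by simp
  \<comment> \<open>The search invariant at the queue position of \<open>x\<close>: a successor of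
    \<open>x\<close> was reached from an earlier position.\<close>
  have cont: "nx' x - 1 < n \<and> vis (nx' x - 1) \<noteq> 0 \<and> par (nx' x - 1) < par ?y" if "nx' x \<noteq> 0"
    using I p(1) that M x unfolding search_inv_def nx matching_def x_def by (metis nx x_def)
  have inj: "q j \<noteq> x" if "j < par ?y" for j
    using I p(1) that unfolding search_inv_def x_def by (metis inj_onD lessThan_iff less_trans nat_less_le)
  have card: "matched (nx'(x := cur)) = (if nx' x = 0 then Suc (matched nx') else matched nx')"
  proof (cases "nx' x = 0")
    case True
    then have "{z. z < n \<and> (nx'(x := cur)) z \<noteq> 0} = insert x {z. z < n \<and> nx' z \<noteq> 0}"
      using x cur by auto
    then show ?thesis using True by (simp add: matched_def)
  next
    case False
    then have "{z. z < n \<and> (nx'(x := cur)) z \<noteq> 0} = {z. z < n \<and> nx' z \<noteq> 0}"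
      using cur by auto
    then show ?thesis using False by (simp add: matched_def)
  qed
  show ?thesis unfolding flip_inv_def
  proof (intro conjI impI M')
    assume nz: "nx' x \<noteq> 0"
    show "\<forall>j\<le>par (nx' x - 1). (nx'(x := cur)) (q j) = nx (q j)"
      using inj cont[OF nz] y(4) by auto
  qed (use cont y(3) card c in auto)
qed

lemma flip_inv_end: "flip_inv nx q vis par n cur nx' pv' \<Longrightarrow> cur = 0 \<and> matching 0 nx' pv' \<and> matched nx' = Suc (matched nx)"
  unfolding flip_inv_def by (cases "cur = 0") auto

end

section \<open>Programs with bounded loops\<close>

datatype exp = N nat | Len | Inp exp | Arr nat exp | Plus exp exp | Minus exp exp

text \<open>A loop evaluates its bound once on entry, so every program terminates, and its effect
  and running time are given by primitive recursion.\<close>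

datatype com = Skip | Asg nat exp exp | Sq com com | Cond exp com com | For bool nat exp com

type_synonym st = "nat \<Rightarrow> nat \<Rightarrow> nat"

text \<open>The arrays are unbounded and therefore interleaved behind the input: cell
  \<open>i\<close> of array \<open>k\<close> has address \<open>64 * i + k + length w\<close>.
  Multiplying by 64 takes six doublings, which addition can do.\<close>

definition mem :: "nat list \<Rightarrow> st \<Rightarrow> nat \<Rightarrow> nat" where
  "mem w s a = (if a < length w then w ! a
     else s ((a - length w) mod 64) ((a - length w) div 64))"

primrec ev :: "nat list \<Rightarrow> st \<Rightarrow> exp \<Rightarrow> nat" where
  "ev w s (N k) = k"
| "ev w s Len = length w"
| "ev w s (Inp e) = mem w s (ev w s e)"
| "ev w s (Arr k e) = s k (ev w s e)"
| "ev w s (Plus e1 e2) = ev w s e1 + ev w s e2"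
| "ev w s (Minus e1 e2) = ev w s e1 - ev w s e2"

definition upd :: "st \<Rightarrow> nat \<Rightarrow> nat \<Rightarrow> nat \<Rightarrow> st" where
  "upd s k i v = s(k := (s k)(i := v))"

lemma upd_apply: "upd s k i v k' = (if k' = k then (s k)(i := v) else s k')"
  by (simp add: upd_def)

primrec loop :: "(nat \<Rightarrow> st \<Rightarrow> st) \<Rightarrow> nat \<Rightarrow> st \<Rightarrow> st" where
  "loop f 0 s = s"
| "loop f (Suc m) s = f m (loop f m s)"

primrec exe :: "nat list \<Rightarrow> com \<Rightarrow> st \<Rightarrow> st" where
  "exe w Skip s = s"
| "exe w (Asg k e1 e2) s = upd s k (ev w s e1) (ev w s e2)"
| "exe w (Sq c1 c2) s = exe w c2 (exe w c1 s)"
| "exe w (Cond e c1 c2) s = (if ev w s e \<noteq> 0 then exe w c1 s else exe w c2 s)"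
| "exe w (For b k e c) s = loop (\<lambda>i t. exe w c (upd t k 0 i)) (ev w s e) s"

text \<open>Exact step counts of the compiled code. The 10 of an array access is 9 for
  \<open>addr\<close> and one for the load.\<close>

primrec exp_time :: "exp \<Rightarrow> nat" where
  "exp_time (N k) = 1"
| "exp_time Len = 2"
| "exp_time (Inp e) = exp_time e + 1"
| "exp_time (Arr k e) = exp_time e + 10"
| "exp_time (Plus e1 e2) = exp_time e1 + exp_time e2 + 1"
| "exp_time (Minus e1 e2) = exp_time e1 + exp_time e2 + 1"

text \<open>The 10 of an assignment is \<open>addr\<close> and the store. A loop takes 7 extra steps
  per round: the test, three to store the index and three to update the registers; the 2 are its
  initialisation and the last test.\<close>

primrec run_time :: "nat list \<Rightarrow> com \<Rightarrow> st \<Rightarrow> nat" where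
  "run_time w Skip s = 1"
| "run_time w (Asg k e1 e2) s = exp_time e1 + exp_time e2 + 10"
| "run_time w (Sq c1 c2) s = run_time w c1 s + run_time w c2 (exe w c1 s)"
| "run_time w (Cond e c1 c2) s = exp_time e + 1 + (if ev w s e \<noteq> 0 then run_time w c1 s else run_time w c2 s)"
| "run_time w (For b k e c) s = exp_time e + 2 +
     (\<Sum>i<ev w s e. run_time w c (upd (loop (\<lambda>i t. exe w c (upd t k 0 i)) i s) k 0 i) + 7)"

primrec wf_exp :: "exp \<Rightarrow> bool" where
  "wf_exp (N k) = True"
| "wf_exp Len = True"
| "wf_exp (Inp e) = wf_exp e"
| "wf_exp (Arr k e) = (k < 64 \<and> wf_exp e)"
| "wf_exp (Plus e1 e2) = (wf_exp e1 \<and> wf_exp e2)"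
| "wf_exp (Minus e1 e2) = (wf_exp e1 \<and> wf_exp e2)"

primrec wf_com :: "com \<Rightarrow> bool" where
  "wf_com Skip = True"
| "wf_com (Asg k e1 e2) = (k < 64 \<and> wf_exp e1 \<and> wf_exp e2)"
| "wf_com (Sq c1 c2) = (wf_com c1 \<and> wf_com c2)"
| "wf_com (Cond e c1 c2) = (wf_exp e \<and> wf_com c1 \<and> wf_com c2)"
| "wf_com (For b k e c) = (k < 64 \<and> wf_exp e \<and> wf_com c)"

text \<open>Turns an index \<open>i\<close> in register \<open>d\<close> into the address of cell \<open>i\<close> of array \<open>k\<close>;
  register 0 keeps the length of the input throughout.\<close>

definition addr :: "nat \<Rightarrow> nat \<Rightarrow> ram" where
  "addr d k = Seq (Add d d d) (Seq (Add d d d) (Seq (Add d d d) (Seq (Add d d d) (Seq (Add d d d)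
     (Seq (Add d d d) (Seq (SetConst (Suc d) k) (Seq (Add d d (Suc d)) (Add d d 0))))))))"

text \<open>The registers from \<open>d\<close> on form a stack: the value is left in
  \<open>d\<close>, and those below \<open>d\<close> are preserved.\<close>

primrec comp_exp :: "nat \<Rightarrow> exp \<Rightarrow> ram" where
  "comp_exp d (N k) = SetConst d k"
| "comp_exp d Len = Seq (SetConst d 0) (Add d d 0)"
| "comp_exp d (Inp e) = Seq (comp_exp d e) (Load d d)"
| "comp_exp d (Arr k e) = Seq (comp_exp d e) (Seq (addr d k) (Load d d))"
| "comp_exp d (Plus e1 e2) = Seq (comp_exp d e1) (Seq (comp_exp (Suc d) e2) (Add d d (Suc d)))"
| "comp_exp d (Minus e1 e2) = Seq (comp_exp d e1) (Seq (comp_exp (Suc d) e2) (Sub d d (Suc d)))"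

text \<open>In a loop, register \<open>d\<close> counts the rounds left and \<open>Suc d\<close>
  holds the index, which is copied to cell 0 of array \<open>k\<close> before each round. The body
  may overwrite that cell without affecting the iteration.\<close>

primrec comp_com :: "nat \<Rightarrow> com \<Rightarrow> ram" where
  "comp_com d Skip = SetConst d 0"
| "comp_com d (Asg k e1 e2) = Seq (comp_exp d e1) (Seq (addr d k) (Seq (comp_exp (Suc d) e2) (Store d (Suc d))))"
| "comp_com d (Sq c1 c2) = Seq (comp_com d c1) (comp_com d c2)"
| "comp_com d (Cond e c1 c2) = Seq (comp_exp d e) (IfNZ d (comp_com d c1) (comp_com d c2))"
| "comp_com d (For b k e c) = Seq (comp_exp d e) (Seq (SetConst (Suc d) 0) (WhileNZ d
     (Seq (SetConst (d+2) k) (Seq (Add (d+2) (d+2) 0) (Seq (Store (d+2) (Suc d))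
       (Seq (comp_com (d+2) c) (Seq (SetConst (d+2) 1) (Seq (Add (Suc d) (Suc d) (d+2)) (Sub d d (d+2))))))))))"

lemma mem_cell: "k < 64 \<Longrightarrow> mem w s (64 * i + k + length w) = s k i"
  by (simp add: mem_def)

lemma mem_upd:
  assumes "k < 64"
  shows "mem w (upd s k i v) = (mem w s)(64 * i + k + length w := v)"
proof
  fix a
  show "mem w (upd s k i v) a = ((mem w s)(64 * i + k + length w := v)) a"
  proof (cases "a = 64 * i + k + length w \<or> a < length w")
    case True
    then show ?thesis using assms by (auto simp: mem_def upd_apply)
  next
    case False
    then obtain b where b: "a = b + length w" by (metis add.commute le_Suc_ex not_less)
    have "\<not> (b mod 64 = k \<and> b div 64 = i)"
      using False b by (metis mult_div_mod_eq)
    then show ?thesis using b False by (auto simp: mem_def upd_apply)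
  qed
qed

text \<open>The lemmas of the inductive definition restated with an equation for the running time, so that
  they compose by resolution.\<close>

lemma exec_Const: "S' = (R(i := k), M) \<Longrightarrow> t = 1 \<Longrightarrow> ram_exec (SetConst i k) (R, M) t S'"
  by hypsubst (rule ram_exec.SetConst)
lemma exec_Add: "S' = (R(i := R j + R k), M) \<Longrightarrow> t = 1 \<Longrightarrow> ram_exec (Add i j k) (R, M) t S'"
  by hypsubst (rule ram_exec.Add)
lemma exec_Sub: "S' = (R(i := R j - R k), M) \<Longrightarrow> t = 1 \<Longrightarrow> ram_exec (Sub i j k) (R, M) t S'"
  by hypsubst (rule ram_exec.Sub)
lemma exec_Load: "S' = (R(i := M (R j)), M) \<Longrightarrow> t = 1 \<Longrightarrow> ram_exec (Load i j) (R, M) t S'"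
  by hypsubst (rule ram_exec.Load)
lemma exec_Store: "S' = (R, M(R i := R j)) \<Longrightarrow> t = 1 \<Longrightarrow> ram_exec (Store i j) (R, M) t S'"
  by hypsubst (rule ram_exec.Store)
lemma exec_Seq: "ram_exec c1 S t1 S' \<Longrightarrow> ram_exec c2 S' t2 S'' \<Longrightarrow> t = t1 + t2 \<Longrightarrow> ram_exec (Seq c1 c2) S t S''"
  by (simp add: ram_exec.Seq)

lemma addr_exec:
  assumes "0 < d"
  shows "\<exists>R'. ram_exec (addr d k) (R, M) 9 (R', M) \<and> R' d = 64 * R d + k + R 0 \<and> (\<forall>i<d. R' i = R i)"
proof -
  let ?R = "R(d := 64 * R d, Suc d := k, d := 64 * R d + k + R 0)"
  have "ram_exec (addr d k) (R, M) 9 (?R, M)"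
    unfolding addr_def
    apply (rule exec_Seq, rule exec_Add, rule refl, rule refl)+
        apply (rule exec_Seq, rule exec_Const, rule refl, rule refl)
       apply (rule exec_Seq, rule exec_Add, rule refl, rule refl)
       apply (rule exec_Add)
    using assms by (auto simp: fun_eq_iff)
  then show ?thesis using assms by (intro exI[of _ ?R]) auto
qed

lemma comp_exp_exec:
  assumes "wf_exp e" "0 < d" "R 0 = length w"
  shows "\<exists>R'. ram_exec (comp_exp d e) (R, mem w s) (exp_time e) (R', mem w s) \<and> R' d = ev w s e \<and> (\<forall>i<d. R' i = R i)"
  using assms
proof (induction e arbitrary: d R)
  case (N k)
  then show ?case by (auto intro!: exI[of _ "R(d := k)"] exec_Const)
next
  case Len
  then show ?case
    by (auto intro!: exI[of _ "R(d := length w)"] exec_Seq exec_Const exec_Add)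
next
  case (Inp e)
  then obtain R' where R': "ram_exec (comp_exp d e) (R, mem w s) (exp_time e) (R', mem w s)"
      "R' d = ev w s e" "\<forall>i<d. R' i = R i" by auto metis
  then have "ram_exec (comp_exp d (Inp e)) (R, mem w s) (exp_time (Inp e)) (R'(d := ev w s (Inp e)), mem w s)"
    by (auto intro!: exec_Seq[OF R'(1)] exec_Load)
  moreover have "(R'(d := ev w s (Inp e))) d = ev w s (Inp e)" "\<forall>i<d. (R'(d := ev w s (Inp e))) i = R i"
    using R' by auto
  ultimately show ?case by blast
next
  case (Arr k e)
  then obtain R1 where R1: "ram_exec (comp_exp d e) (R, mem w s) (exp_time e) (R1, mem w s)"
      "R1 d = ev w s e" "\<forall>i<d. R1 i = R i" by auto metis
  obtain R2 where R2: "ram_exec (addr d k) (R1, mem w s) 9 (R2, mem w s)"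
      "R2 d = 64 * R1 d + k + R1 0" "\<forall>i<d. R2 i = R1 i"
    using addr_exec \<open>0 < d\<close> by blast
  have R20: "R2 d = 64 * ev w s e + k + length w"
    using R2 R1 Arr.prems by simp
  have "ram_exec (comp_exp d (Arr k e)) (R, mem w s) (exp_time (Arr k e)) (R2(d := s k (ev w s e)), mem w s)"
    unfolding comp_exp.simps
    apply (rule exec_Seq[OF R1(1)])
     apply (rule exec_Seq[OF R2(1)])
      apply (rule exec_Load)
    using Arr.prems R20 mem_cell[of k w s "ev w s e"] by simp_all
  moreover have "(R2(d := s k (ev w s e))) d = ev w s (Arr k e)" "\<forall>i<d. (R2(d := s k (ev w s e))) i = R i"
    using R1 R2 by auto
  ultimately show ?case by blast
next
  case (Plus e1 e2)
  then obtain R1 where R1: "ram_exec (comp_exp d e1) (R, mem w s) (exp_time e1) (R1, mem w s)"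
      "R1 d = ev w s e1" "\<forall>i<d. R1 i = R i" by auto metis
  with Plus.IH(2)[of "Suc d" R1] Plus.prems obtain R2 where R2:
      "ram_exec (comp_exp (Suc d) e2) (R1, mem w s) (exp_time e2) (R2, mem w s)"
      "R2 (Suc d) = ev w s e2" "\<forall>i<Suc d. R2 i = R1 i" by auto
  have "ram_exec (comp_exp d (Plus e1 e2)) (R, mem w s) (exp_time (Plus e1 e2)) (R2(d := R2 d + R2 (Suc d)), mem w s)"
    by (auto intro!: exec_Seq[OF R1(1)] exec_Seq[OF R2(1)] exec_Add)
  moreover have "(R2(d := R2 d + R2 (Suc d))) d = ev w s (Plus e1 e2)"
    "\<forall>i<d. (R2(d := R2 d + R2 (Suc d))) i = R i"
    using R1 R2 by auto
  ultimately show ?case by blast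
next
  case (Minus e1 e2)
  then obtain R1 where R1: "ram_exec (comp_exp d e1) (R, mem w s) (exp_time e1) (R1, mem w s)"
      "R1 d = ev w s e1" "\<forall>i<d. R1 i = R i" by auto metis
  with Minus.IH(2)[of "Suc d" R1] Minus.prems obtain R2 where R2:
      "ram_exec (comp_exp (Suc d) e2) (R1, mem w s) (exp_time e2) (R2, mem w s)"
      "R2 (Suc d) = ev w s e2" "\<forall>i<Suc d. R2 i = R1 i" by auto
  have "ram_exec (comp_exp d (Minus e1 e2)) (R, mem w s) (exp_time (Minus e1 e2)) (R2(d := R2 d - R2 (Suc d)), mem w s)"
    by (auto intro!: exec_Seq[OF R1(1)] exec_Seq[OF R2(1)] exec_Sub)
  moreover have "(R2(d := R2 d - R2 (Suc d))) d = ev w s (Minus e1 e2)"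
    "\<forall>i<d. (R2(d := R2 d - R2 (Suc d))) i = R i"
    using R1 R2 by auto
  ultimately show ?case by blast
qed

lemma comp_com_exec:
  assumes "wf_com c" "0 < d" "R 0 = length w"
  shows "\<exists>R'. ram_exec (comp_com d c) (R, mem w s) (run_time w c s) (R', mem w (exe w c s)) \<and> (\<forall>i<d. R' i = R i)"
  using assms
proof (induction c arbitrary: d R s)
  case Skip
  then show ?case by (auto intro!: exI[of _ "R(d := 0)"] exec_Const)
next
  case (Asg k e1 e2)
  then obtain R1 where R1: "ram_exec (comp_exp d e1) (R, mem w s) (exp_time e1) (R1, mem w s)"
      "R1 d = ev w s e1" "\<forall>i<d. R1 i = R i" using comp_exp_exec[of e1 d R w s] by auto
  obtain R2 where R2: "ram_exec (addr d k) (R1, mem w s) 9 (R2, mem w s)"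
      "R2 d = 64 * R1 d + k + R1 0" "\<forall>i<d. R2 i = R1 i"
    using addr_exec \<open>0 < d\<close> by blast
  obtain R3 where R3: "ram_exec (comp_exp (Suc d) e2) (R2, mem w s) (exp_time e2) (R3, mem w s)"
      "R3 (Suc d) = ev w s e2" "\<forall>i<Suc d. R3 i = R2 i"
    using comp_exp_exec[of e2 "Suc d" R2 w s] R1 R2 Asg.prems by auto
  have R3d: "R3 d = 64 * ev w s e1 + k + length w"
    using R3 R2 R1 Asg.prems by simp
  have "ram_exec (comp_com d (Asg k e1 e2)) (R, mem w s) (run_time w (Asg k e1 e2) s) (R3, mem w (exe w (Asg k e1 e2) s))"
    unfolding comp_com.simps
    apply (rule exec_Seq[OF R1(1)])
     apply (rule exec_Seq[OF R2(1)])
      apply (rule exec_Seq[OF R3(1)])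
       apply (rule exec_Store)
    using R3d R3(2) Asg.prems by (simp_all add: mem_upd)
  moreover have "\<forall>i<d. R3 i = R i" using R1 R2 R3 by auto
  ultimately show ?case by blast
next
  case (Sq c1 c2)
  then obtain R1 where R1: "ram_exec (comp_com d c1) (R, mem w s) (run_time w c1 s) (R1, mem w (exe w c1 s))"
      "\<forall>i<d. R1 i = R i" by auto metis
  with Sq.IH(2)[of d R1] Sq.prems obtain R2 where R2:
      "ram_exec (comp_com d c2) (R1, mem w (exe w c1 s)) (run_time w c2 (exe w c1 s)) (R2, mem w (exe w c2 (exe w c1 s)))"
      "\<forall>i<d. R2 i = R1 i" by auto metis
  show ?case using R1 R2 by (intro exI[of _ R2]) (auto intro!: exec_Seq[OF R1(1) R2(1)])
next
  case (Cond e c1 c2)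
  then obtain R1 where R1: "ram_exec (comp_exp d e) (R, mem w s) (exp_time e) (R1, mem w s)"
      "R1 d = ev w s e" "\<forall>i<d. R1 i = R i" using comp_exp_exec[of e d R w s] by auto
  show ?case
  proof (cases "ev w s e = 0")
    case True
    obtain R2 where R2: "ram_exec (comp_com d c2) (R1, mem w s) (run_time w c2 s) (R2, mem w (exe w c2 s))"
      "\<forall>i<d. R2 i = R1 i" using Cond.IH(2)[of d R1 s] Cond.prems R1 by auto
    show ?thesis using R1 R2 True
      by (intro exI[of _ R2]) (auto intro!: exec_Seq[OF R1(1) ram_exec.IfFalse[OF _ R2(1)]])
  next
    case False
    obtain R2 where R2: "ram_exec (comp_com d c1) (R1, mem w s) (run_time w c1 s) (R2, mem w (exe w c1 s))"
      "\<forall>i<d. R2 i = R1 i" using Cond.IH(1)[of d R1 s] Cond.prems R1 by auto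
    have "R1 d \<noteq> 0" using False R1 by simp
    from exec_Seq[OF R1(1) ram_exec.IfTrue[OF this R2(1)] refl]
    show ?thesis using R1 R2 False by (intro exI[of _ R2]) auto
  qed
next
  case (For b k e c)
  define lp where "lp = (\<lambda>i. loop (\<lambda>i t. exe w c (upd t k 0 i)) i s)"
  let ?m = "ev w s e"
  let ?body = "Seq (SetConst (d+2) k) (Seq (Add (d+2) (d+2) 0) (Seq (Store (d+2) (Suc d))
       (Seq (comp_com (d+2) c) (Seq (SetConst (d+2) 1) (Seq (Add (Suc d) (Suc d) (d+2)) (Sub d d (d+2)))))))"
  obtain R1 where R1: "ram_exec (comp_exp d e) (R, mem w s) (exp_time e) (R1, mem w s)"
      "R1 d = ?m" "\<forall>i<d. R1 i = R i" using comp_exp_exec[of e d R w s] For.prems by auto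
  \<comment> \<open>\<open>i\<close> rounds are done and \<open>j\<close> remain; the induction runs
    over \<open>j\<close>.\<close>
  have wh: "\<exists>R'. ram_exec (WhileNZ d ?body) (R2, mem w (lp i))
        ((\<Sum>i=i..<?m. run_time w c (upd (lp i) k 0 i) + 7) + 1) (R', mem w (lp ?m)) \<and> (\<forall>i<d. R' i = R i)"
    if "i + j = ?m" "R2 d = j" "R2 (Suc d) = i" "\<forall>i<d. R2 i = R i" for i j R2
    using that
  proof (induction j arbitrary: i R2)
    case 0
    then show ?case using ram_exec.WhileFalse[of R2 d] by auto
  next
    case (Suc j)
    have R20: "R2 0 = length w" using Suc.prems For.prems by auto
    let ?s = "upd (lp i) k 0 i"
    let ?R3 = "R2(d+2 := k + length w)"
    have "?R3 0 = length w" using R20 by simp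
    then obtain R4 where R4: "ram_exec (comp_com (d+2) c) (?R3, mem w ?s) (run_time w c ?s) (R4, mem w (exe w c ?s))"
      "\<forall>i<d+2. R4 i = ?R3 i"
      using For.IH[of "d+2" ?R3 ?s] For.prems(1) by (meson add_gr_0 wf_com.simps(5) zero_less_numeral)
    have R4d: "R4 d = Suc j" "R4 (Suc d) = i" using R4(2) Suc.prems by auto
    let ?R5 = "R4(d+2 := 1, Suc d := Suc i, d := j)"
    have lpS: "exe w c ?s = lp (Suc i)" by (simp add: lp_def)
    have bd: "ram_exec ?body (R2, mem w (lp i)) (run_time w c ?s + 6) (?R5, mem w (lp (Suc i)))"
      apply (rule exec_Seq, rule exec_Const, rule refl, rule refl)
       apply (rule exec_Seq, rule exec_Add, rule refl, rule refl)
        apply (rule exec_Seq, rule exec_Store, rule refl, rule refl)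
         apply (rule exec_Seq[where S' = "(R4, mem w (exe w c ?s))" and ?t1.0 = "run_time w c ?s"])
           apply (use R4(1) R20 Suc.prems For.prems in \<open>simp add: mem_upd\<close>)
          apply (rule exec_Seq, rule exec_Const, rule refl, rule refl)
           apply (rule exec_Seq, rule exec_Add, rule refl, rule refl)
            apply (rule exec_Sub)
      using R4d by (simp_all add: lpS fun_upd_twist)
    have "\<exists>R'. ram_exec (WhileNZ d ?body) (?R5, mem w (lp (Suc i)))
        ((\<Sum>i=Suc i..<?m. run_time w c (upd (lp i) k 0 i) + 7) + 1) (R', mem w (lp ?m)) \<and> (\<forall>i<d. R' i = R i)"
      using Suc.prems R4 by (intro Suc.IH) auto
    then obtain R' where R': "ram_exec (WhileNZ d ?body) (?R5, mem w (lp (Suc i)))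
        ((\<Sum>i=Suc i..<?m. run_time w c (upd (lp i) k 0 i) + 7) + 1) (R', mem w (lp ?m))" "\<forall>i<d. R' i = R i" by blast
    have "R2 d \<noteq> 0" using Suc.prems by simp
    note ram_exec.WhileTrue[OF this bd R'(1)]
    moreover have "(\<Sum>i=i..<?m. run_time w c (upd (lp i) k 0 i) + 7) =
        (run_time w c ?s + 7) + (\<Sum>i=Suc i..<?m. run_time w c (upd (lp i) k 0 i) + 7)"
      using Suc.prems by (intro sum.atLeast_Suc_lessThan) auto
    ultimately show ?case using R'(2) by (intro exI[of _ R']) simp
  qed
  obtain R' where R': "ram_exec (WhileNZ d ?body) (R1(Suc d := 0), mem w (lp 0))
        ((\<Sum>i=0..<?m. run_time w c (upd (lp i) k 0 i) + 7) + 1) (R', mem w (lp ?m))" "\<forall>i<d. R' i = R i"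
    using wh[of 0 ?m "R1(Suc d := 0)"] R1 by auto
  have "ram_exec (comp_com d (For b k e c)) (R, mem w s) (run_time w (For b k e c) s) (R', mem w (exe w (For b k e c) s))"
    unfolding comp_com.simps
    apply (rule exec_Seq[OF R1(1)])
     apply (rule exec_Seq, rule exec_Const, rule refl, rule refl)
      apply (use R'(1) in \<open>simp add: lp_def\<close>)
    by (simp_all add: lp_def lessThan_atLeast0)
  then show ?case using R'(2) by blast
qed

lemma mem_init: "ram_init w = ((\<lambda>_. 0)(0 := length w), mem w (\<lambda>_ _. 0))"
  by (auto simp: ram_init_def mem_def fun_eq_iff)

text \<open>All addresses depend on the input length in register 0, so only the very last
  instruction replaces it by the result.\<close>

definition compile :: "com \<Rightarrow> exp \<Rightarrow> ram" where
  "compile c e = Seq (comp_com 1 c) (Seq (comp_exp 1 e) (Seq (SetConst 2 0) (Add 0 1 2)))"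

lemma compile_computes:
  assumes "wf_com c" "wf_exp e"
  shows "ram_computes_in (compile c e) w (run_time w c (\<lambda>_ _. 0) + exp_time e + 2)
           (ev w (exe w c (\<lambda>_ _. 0)) e)"
proof -
  let ?s = "exe w c (\<lambda>_ _. 0)"
  obtain R1 where R1: "ram_exec (comp_com 1 c) (ram_init w) (run_time w c (\<lambda>_ _. 0)) (R1, mem w ?s)"
      "R1 0 = length w"
    using comp_com_exec[of c 1 "(\<lambda>_. 0)(0 := length w)" w "\<lambda>_ _. 0"] assms by (auto simp: mem_init)
  obtain R2 where R2: "ram_exec (comp_exp 1 e) (R1, mem w ?s) (exp_time e) (R2, mem w ?s)" "R2 1 = ev w ?s e"
    using comp_exp_exec[of e 1 R1 w ?s] assms R1 by auto
  have "ram_exec (compile c e) (ram_init w) (run_time w c (\<lambda>_ _. 0) + exp_time e + 2) (R2(2 := 0, 0 := R2 1), mem w ?s)"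
    unfolding compile_def
    apply (rule exec_Seq[OF R1(1)])
     apply (rule exec_Seq[OF R2(1)])
      apply (rule exec_Seq, rule exec_Const, rule refl, rule refl)
       apply (rule exec_Add)
    by auto
  then show ?thesis unfolding ram_computes_in_def using R2 by fastforce
qed

text \<open>Every loop carries a flag: \<open>bounded w B Q c s\<close> says that in the run of \<open>c\<close> from \<open>s\<close> all loops
  flagged \<open>True\<close> are bounded by \<open>B\<close> and all others by \<open>Q\<close>. The exponents \<open>big_depth\<close> and \<open>small_depth\<close> of the
  resulting time bound are nesting depths.\<close>

primrec bounded :: "nat list \<Rightarrow> nat \<Rightarrow> nat \<Rightarrow> com \<Rightarrow> st \<Rightarrow> bool" where
  "bounded w B Q Skip s = True"
| "bounded w B Q (Asg k e1 e2) s = True"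
| "bounded w B Q (Sq c1 c2) s = (bounded w B Q c1 s \<and> bounded w B Q c2 (exe w c1 s))"
| "bounded w B Q (Cond e c1 c2) s = (if ev w s e \<noteq> 0 then bounded w B Q c1 s else bounded w B Q c2 s)"
| "bounded w B Q (For b k e c) s = (ev w s e \<le> (if b then B else Q) \<and>
     (\<forall>i<ev w s e. bounded w B Q c (upd (loop (\<lambda>i t. exe w c (upd t k 0 i)) i s) k 0 i)))"

primrec weight :: "com \<Rightarrow> nat" where
  "weight Skip = 1"
| "weight (Asg k e1 e2) = exp_time e1 + exp_time e2 + 10"
| "weight (Sq c1 c2) = weight c1 + weight c2"
| "weight (Cond e c1 c2) = exp_time e + 1 + (weight c1 + weight c2)"
| "weight (For b k e c) = exp_time e + 9 + weight c"

primrec big_depth :: "com \<Rightarrow> nat" where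
  "big_depth Skip = 0"
| "big_depth (Asg k e1 e2) = 0"
| "big_depth (Sq c1 c2) = max (big_depth c1) (big_depth c2)"
| "big_depth (Cond e c1 c2) = max (big_depth c1) (big_depth c2)"
| "big_depth (For b k e c) = (if b then 1 else 0) + big_depth c"

primrec small_depth :: "com \<Rightarrow> nat" where
  "small_depth Skip = 0"
| "small_depth (Asg k e1 e2) = 0"
| "small_depth (Sq c1 c2) = max (small_depth c1) (small_depth c2)"
| "small_depth (Cond e c1 c2) = max (small_depth c1) (small_depth c2)"
| "small_depth (For b k e c) = (if b then 0 else 1) + small_depth c"

text \<open>As \<open>B\<close> and \<open>Q\<close> are at least 1, each part of a program can be
  charged with the largest powers that occur, while \<open>weight\<close> collects the
  constants.\<close>

lemma run_time_le:
  assumes "1 \<le> B" "1 \<le> Q" "bounded w B Q c s"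
  shows "run_time w c s \<le> weight c * (Q ^ small_depth c * B ^ big_depth c)"
  using assms(3)
proof (induction c arbitrary: s)
  case Skip
  then show ?case by simp
next
  case (Asg k e1 e2)
  then show ?case by simp
next
  case (Sq c1 c2)
  have mono: "Q ^ i * B ^ j \<le> Q ^ i' * B ^ j'" if "i \<le> i'" "j \<le> j'" for i j i' j'
    using that assms by (intro mult_mono power_increasing) auto
  let ?X = "Q ^ small_depth (Sq c1 c2) * B ^ big_depth (Sq c1 c2)"
  have "run_time w c1 s \<le> weight c1 * ?X"
    using Sq.IH(1)[of s] Sq.prems mono[of "small_depth c1" "small_depth (Sq c1 c2)" "big_depth c1" "big_depth (Sq c1 c2)"]
    by (simp add: order_trans[OF _ mult_le_mono2])
  moreover have "run_time w c2 (exe w c1 s) \<le> weight c2 * ?X"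
    using Sq.IH(2)[of "exe w c1 s"] Sq.prems mono[of "small_depth c2" "small_depth (Sq c1 c2)" "big_depth c2" "big_depth (Sq c1 c2)"]
    by (simp add: order_trans[OF _ mult_le_mono2])
  ultimately show ?case by (simp add: add_mult_distrib)
next
  case (Cond e c1 c2)
  have mono: "Q ^ i * B ^ j \<le> Q ^ i' * B ^ j'" if "i \<le> i'" "j \<le> j'" for i j i' j'
    using that assms by (intro mult_mono power_increasing) auto
  let ?X = "Q ^ small_depth (Cond e c1 c2) * B ^ big_depth (Cond e c1 c2)"
  have X: "1 \<le> ?X" using mono[of 0 "small_depth (Cond e c1 c2)" 0 "big_depth (Cond e c1 c2)"] by simp
  have "ev w s e \<noteq> 0 \<Longrightarrow> run_time w c1 s \<le> weight c1 * ?X"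
    using Cond.IH(1)[of s] Cond.prems mono[of "small_depth c1" "small_depth (Cond e c1 c2)" "big_depth c1" "big_depth (Cond e c1 c2)"]
    by (simp add: order_trans[OF _ mult_le_mono2])
  moreover have "ev w s e = 0 \<Longrightarrow> run_time w c2 s \<le> weight c2 * ?X"
    using Cond.IH(2)[of s] Cond.prems mono[of "small_depth c2" "small_depth (Cond e c1 c2)" "big_depth c2" "big_depth (Cond e c1 c2)"]
    by (simp add: order_trans[OF _ mult_le_mono2])
  moreover have "exp_time e + 1 \<le> (exp_time e + 1) * ?X" using X by (metis mult.right_neutral mult_le_mono2)
  ultimately show ?case
    unfolding weight.simps run_time.simps add_mult_distrib by (smt (verit) add_mono le_add1 le_add2 order_trans)
next
  case (For b k e c)
  let ?l = "if b then B else Q"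
  let ?Y = "Q ^ small_depth c * B ^ big_depth c"
  have Y: "1 \<le> ?Y" using assms by simp
  have l: "1 \<le> ?l" using assms by simp
  have X: "Q ^ small_depth (For b k e c) * B ^ big_depth (For b k e c) = ?l * ?Y" by simp
  have "run_time w (For b k e c) s \<le> exp_time e + 2 + (\<Sum>i<ev w s e. weight c * ?Y + 7)"
    using For.IH For.prems unfolding run_time.simps by (intro add_left_mono sum_mono add_right_mono) auto
  also have "\<dots> \<le> exp_time e + 2 + ?l * (weight c * ?Y + 7)"
    using For.prems by (simp del: mult_Suc)
  also have "\<dots> \<le> (exp_time e + 2) * (?l * ?Y) + ?l * (weight c * ?Y + 7 * ?Y)"
  proof -
    have "1 * 1 \<le> ?l * ?Y" by (intro mult_le_mono l Y)
    then have "(exp_time e + 2) * 1 \<le> (exp_time e + 2) * (?l * ?Y)" by (intro mult_le_mono) auto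
    moreover have "7 * 1 \<le> 7 * ?Y" by (intro mult_le_mono Y) auto
    ultimately show ?thesis by (intro add_mono mult_le_mono) auto
  qed
  also have "\<dots> = weight (For b k e c) * (?l * ?Y)" by (simp add: algebra_simps)
  finally show ?case using X by metis
qed

primrec written :: "com \<Rightarrow> nat set" where
  "written Skip = {}"
| "written (Asg k e1 e2) = {k}"
| "written (Sq c1 c2) = written c1 \<union> written c2"
| "written (Cond e c1 c2) = written c1 \<union> written c2"
| "written (For b k e c) = insert k (written c)"

lemma exe_frame: "k \<notin> written c \<Longrightarrow> exe w c s k = s k"
proof (induction c arbitrary: s)
  case (For b j e c)
  have "loop (\<lambda>i t. exe w c (upd t j 0 i)) m s k = s k" for m
    using For by (induction m) (auto simp: upd_apply)
  then show ?case by simp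
qed (auto simp: upd_apply)

text \<open>Invariant and loop bounds are proved in one induction, since the bounds of inner loops
  depend on the invariant. The premise on unwritten arrays provides the frame, so that
  \<open>I\<close> mentions only what the loop changes; \<open>stable\<close> covers the writing of
  the counter.\<close>

lemma For_rule:
  assumes m: "ev w s e = m" "m \<le> (if b then B else Q)"
    and init: "I 0 s"
    and stable: "\<And>i t v. I i t \<Longrightarrow> I i (upd t k 0 v)"
    and step: "\<And>i t. i < m \<Longrightarrow> (\<And>j. j \<notin> insert k (written c) \<Longrightarrow> t j = s j) \<Longrightarrow> t k 0 = i \<Longrightarrow> I i t
       \<Longrightarrow> I (Suc i) (exe w c t) \<and> bounded w B Q c t"
  shows "I m (exe w (For b k e c) s) \<and> bounded w B Q (For b k e c) s"
proof -
  define lp where "lp = (\<lambda>i. loop (\<lambda>i t. exe w c (upd t k 0 i)) i s)"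
  have fr: "lp i j = s j" if "j \<notin> insert k (written c)" for i j
    using that by (induction i) (auto simp: lp_def exe_frame upd_apply)
  have inv: "I i (lp i)" if "i \<le> m" for i
    using that
  proof (induction i)
    case 0
    then show ?case using init by (simp add: lp_def)
  next
    case (Suc i)
    have "I (Suc i) (exe w c (upd (lp i) k 0 i))"
      using Suc fr by (intro step[THEN conjunct1]) (auto simp: upd_apply intro: stable)
    then show ?case by (simp add: lp_def)
  qed
  have "bounded w B Q c (upd (lp i) k 0 i)" if "i < m" for i
    using that inv[of i] fr by (intro step[THEN conjunct2, of i]) (auto simp: upd_apply intro: stable)
  then show ?thesis using inv[of m] m by (simp add: lp_def)
qed

declare exe.simps(5) [simp del] bounded.simps(5) [simp del]

section \<open>The program\<close>

abbreviation (input) "V k \<equiv> Arr k (N 0)"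
abbreviation assign (infix "::=" 62) where "k ::= e \<equiv> Asg k (N 0) e"
notation Sq (infixr ";;" 61)

text \<open>Truth values come from truncated subtraction: \<open>1 - e\<close> tests
  \<open>e\<close> for zero, and both differences of \<open>a\<close> and \<open>b\<close> vanish
  just if they are equal.\<close>

definition "eqE a b = Minus (N 1) (Plus (Minus a b) (Minus b a))"
definition "ltE a b = Minus (N 1) (Minus (N 1) (Minus b a))"
definition "andE a b = Minus (N 1) (Plus (Minus (N 1) a) (Minus (N 1) b))"
definition "notE a = Minus (N 1) a"
definition "sucE a = Plus a (N 1)"

lemma ev_bool [simp]:
  "ev w s (eqE a b) = (if ev w s a = ev w s b then 1 else 0)"
  "ev w s (ltE a b) = (if ev w s a < ev w s b then 1 else 0)"
  "ev w s (andE a b) = (if ev w s a \<noteq> 0 \<and> ev w s b \<noteq> 0 then 1 else 0)"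
  "ev w s (notE a) = (if ev w s a = 0 then 1 else 0)"
  "ev w s (sucE a) = Suc (ev w s a)"
  by (auto simp: eqE_def ltE_def andE_def notE_def sucE_def)

lemma wf_exp_bool [simp]:
  "wf_exp (eqE a b) = (wf_exp a \<and> wf_exp b)" "wf_exp (ltE a b) = (wf_exp a \<and> wf_exp b)"
  "wf_exp (andE a b) = (wf_exp a \<and> wf_exp b)" "wf_exp (notE a) = wf_exp a" "wf_exp (sucE a) = wf_exp a"
  by (auto simp: eqE_def ltE_def andE_def notE_def sucE_def)

text \<open>
  The names of the arrays; a scalar variable is the cell 0 of its array. In the absence of
  multiplication, \<open>row\<close> and \<open>rN\<close> tabulate the multiples of the size of the poset and of the number of
  assignments.
\<close>

abbreviation (input) "nV \<equiv> 0::nat"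
abbreviation (input) "row \<equiv> 57::nat"
abbreviation (input) "fb \<equiv> 2::nat"
abbreviation (input) "lV \<equiv> 3::nat"
abbreviation (input) "acc \<equiv> 4::nat"
abbreviation (input) "it \<equiv> 5::nat"
abbreviation (input) "don \<equiv> 6::nat"
abbreviation (input) "x1 \<equiv> 7::nat"
abbreviation (input) "vis \<equiv> 8::nat"
abbreviation (input) "qu \<equiv> 9::nat"
abbreviation (input) "qn \<equiv> 10::nat"
abbreviation (input) "fin \<equiv> 11::nat"
abbreviation (input) "i1 \<equiv> 12::nat"
abbreviation (input) "y1 \<equiv> 13::nat"
abbreviation (input) "par \<equiv> 14::nat"
abbreviation (input) "nx \<equiv> 15::nat"
abbreviation (input) "pv \<equiv> 16::nat"
abbreviation (input) "cur \<equiv> 17::nat"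
abbreviation (input) "t1 \<equiv> 18::nat"
abbreviation (input) "xx \<equiv> 19::nat"
abbreviation (input) "nt \<equiv> 20::nat"
abbreviation (input) "rt \<equiv> 21::nat"
abbreviation (input) "ccl \<equiv> 22::nat"
abbreviation (input) "p1 \<equiv> 23::nat"
abbreviation (input) "lab \<equiv> 24::nat"
abbreviation (input) "TT \<equiv> 25::nat"
abbreviation (input) "TN \<equiv> 26::nat"
abbreviation (input) "kn \<equiv> 27::nat"
abbreviation (input) "fnd \<equiv> 28::nat"
abbreviation (input) "r1 \<equiv> 29::nat"
abbreviation (input) "okv \<equiv> 30::nat"
abbreviation (input) "rx \<equiv> 31::nat"
abbreviation (input) "ry \<equiv> 32::nat"
abbreviation (input) "z1 \<equiv> 33::nat"
abbreviation (input) "v1 \<equiv> 34::nat"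
abbreviation (input) "hit \<equiv> 35::nat"
abbreviation (input) "qr \<equiv> 36::nat"
abbreviation (input) "sn \<equiv> 37::nat"
abbreviation (input) "cn \<equiv> 38::nat"
abbreviation (input) "sel \<equiv> 39::nat"
abbreviation (input) "e1 \<equiv> 40::nat"
abbreviation (input) "a1 \<equiv> 41::nat"
abbreviation (input) "bs \<equiv> 42::nat"
abbreviation (input) "pw \<equiv> 43::nat"
abbreviation (input) "j1 \<equiv> 44::nat"
abbreviation (input) "nN \<equiv> 45::nat"
abbreviation (input) "rN \<equiv> 46::nat"
abbreviation (input) "dig \<equiv> 47::nat"
abbreviation (input) "cv \<equiv> 48::nat"
abbreviation (input) "vl \<equiv> 49::nat"
abbreviation (input) "as \<equiv> 50::nat"
abbreviation (input) "slot \<equiv> 51::nat"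
abbreviation (input) "pp \<equiv> 52::nat"
abbreviation (input) "opv \<equiv> 53::nat"
abbreviation (input) "en \<equiv> 54::nat"
abbreviation (input) "VT \<equiv> 55::nat"
abbreviation (input) "bv \<equiv> 56::nat"

text \<open>Address 0 holds the size, so the matrix starts at 1. Entry \<open>n\<close> of
  \<open>row\<close> is the size of the whole matrix and leads to the colours behind it.\<close>

definition "leE a b = Inp (Plus (N 1) (Plus (Arr row a) b))"
definition "slE a b = andE (leE a b) (notE (eqE a b))"
definition "colE a = Inp (Plus (N 1) (Plus (Arr row (V nV)) a))"
definition "tokE p = Inp (Plus (V fb) p)"

lemma wf_exp_input [simp]:
  "wf_exp (leE a b) = (wf_exp a \<and> wf_exp b)" "wf_exp (slE a b) = (wf_exp a \<and> wf_exp b)"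
  "wf_exp (colE a) = wf_exp a" "wf_exp (tokE p) = wf_exp p"
  by (auto simp: leE_def slE_def colE_def tokE_def)

section \<open>Code: input layout, chains and labels\<close>

definition "setup =
  nV ::= Inp (N 0);;
  For True it (sucE (V nV)) (Asg row (V it) (V acc);; acc ::= Plus (V acc) (V nV));;
  fb ::= Plus (sucE (Arr row (V nV))) (V nV);;
  lV ::= Minus Len (V fb)"

definition "visit =
  Cond (andE (slE (Arr qu (V i1)) (V y1)) (notE (Arr vis (V y1))))
    (Asg vis (V y1) (N 1);; Asg par (V y1) (V i1);;
     Cond (Arr pv (V y1)) (Asg qu (V qn) (Minus (Arr pv (V y1)) (N 1));; qn ::= sucE (V qn))
       (fin ::= sucE (V y1)))
    Skip"

text \<open>The queue grows while it is processed, so the loop over its positions makes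
  \<open>n\<close> rounds in any case. A position that is skipped as unfilled means that the queue
  is exhausted.\<close>

definition "search =
  For True x1 (V nV) (Asg vis (V x1) (N 0));;
  qn ::= N 0;; fin ::= N 0;;
  For True x1 (V nV) (Cond (Arr nx (V x1)) Skip (Asg qu (V qn) (V x1);; qn ::= sucE (V qn)));;
  For True i1 (V nV) (Cond (ltE (V i1) (V qn)) (For True y1 (V nV) visit) Skip)"

definition "flip1 =
  Cond (V cur)
    (xx ::= Arr qu (Arr par (Minus (V cur) (N 1)));; nt ::= Arr nx (V xx);;
     Asg nx (V xx) (V cur);; Asg pv (Minus (V cur) (N 1)) (sucE (V xx));; cur ::= V nt)
    Skip"

definition "partition_chains =
  For True it (V nV) (Cond (V don) Skip
    (search;; Cond (V fin) (cur ::= V fin;; For True t1 (V nV) flip1) (don ::= N 1)))"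

definition "roots =
  For True x1 (V nV) (Asg rt (V x1) (V x1);;
    For True t1 (V nV)
      (Cond (Arr pv (Arr rt (V x1))) (Asg rt (V x1) (Minus (Arr pv (Arr rt (V x1))) (N 1))) Skip))"

text \<open>A colour is represented by the last token equal to it, and by the number of tokens if
  there is none. A coincidence with a variable or an operation symbol only refines the
  partition.\<close>

definition "colours =
  For True x1 (V nV) (Asg ccl (V x1) (V lV);;
    For False p1 (V lV) (Cond (eqE (tokE (V p1)) (colE (V x1))) (Asg ccl (V x1) (V p1)) Skip))"

definition "labels =
  For True x1 (V nV) (Asg lab (V x1) (V x1);;
    For True y1 (V nV)
      (Cond (andE (eqE (Arr rt (V y1)) (Arr rt (V x1))) (eqE (Arr ccl (V y1)) (Arr ccl (V x1))))
        (Asg lab (V x1) (V y1)) Skip))"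

section \<open>Code: types of pairs and representatives\<close>

definition "pairE a b = Plus (Arr row a) b"

lemma wf_exp_pairE [simp]: "wf_exp (pairE a b) = (wf_exp a \<and> wf_exp b)"
  by (simp add: pairE_def)

definition "types0 =
  For True x1 (V nV) (For True y1 (V nV)
    (cv ::= pairE (Arr lab (V x1)) (Arr lab (V y1));;
     cv ::= Plus (Plus (V cv) (V cv)) (leE (V y1) (V x1));;
     Asg TT (pairE (V x1) (V y1)) (Plus (Plus (V cv) (V cv)) (leE (V x1) (V y1)))))"

text \<open>One half of the refinement clause for two pairs. Inside the two loops of
  \<open>refine\<close> over all pairs, these two loops account for the fourth power of the number
  of elements.\<close>

definition "incl a b c d =
  For True z1 (V nV) (hit ::= N 0;;
    For True v1 (V nV)
      (Cond (andE (eqE (Arr TT (pairE a (V z1))) (Arr TT (pairE c (V v1))))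
                  (eqE (Arr TT (pairE (V z1) b)) (Arr TT (pairE (V v1) d)))) (hit ::= N 1) Skip);;
    Cond (V hit) Skip (okv ::= N 0))"

definition "same_type =
  okv ::= N 1;;
  incl (V x1) (V y1) (Arr rx (V r1)) (Arr ry (V r1));;
  incl (Arr rx (V r1)) (Arr ry (V r1)) (V x1) (V y1)"

text \<open>Only one representative per class is compared with the new pair, so the number of
  comparisons is bounded in terms of the labels and the level.\<close>

definition "classify =
  fnd ::= N 0;;
  For False r1 (V kn) (Cond (V fnd) Skip
    (same_type;; Cond (V okv) (fnd ::= N 1;; Asg TN (pairE (V x1) (V y1)) (V r1)) Skip));;
  Cond (V fnd) Skip
    (Asg rx (V kn) (V x1);; Asg ry (V kn) (V y1);; Asg TN (pairE (V x1) (V y1)) (V kn);; kn ::= sucE (V kn))"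

text \<open>The number of tokens serves as the number of rounds, being at least the quantifier rank.
  New types go to \<open>TN\<close> first, because a round must read the old ones
  throughout.\<close>

definition "refine =
  For False qr (V lV)
    (kn ::= N 0;;
     For True x1 (V nV) (For True y1 (V nV) classify);;
     For True x1 (V nV) (For True y1 (V nV) (Asg TT (pairE (V x1) (V y1)) (Arr TN (pairE (V x1) (V y1))))))"

definition "compare_sel =
  okv ::= eqE (Arr TT (pairE (V x1) (V x1))) (Arr TT (pairE (Arr sel (V e1)) (Arr sel (V e1))));;
  For False a1 (Arr cn (V it))
    (Cond (eqE (Arr TT (pairE (Arr sel (V a1)) (V x1))) (Arr TT (pairE (Arr sel (V a1)) (Arr sel (V e1)))))
       Skip (okv ::= N 0));;
  Cond (V okv) (fnd ::= N 1) Skip"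

definition "select1 =
  fnd ::= N 0;;
  For False e1 (V sn) compare_sel;;
  Cond (V fnd) Skip (Asg sel (V sn) (V x1);; sn ::= sucE (V sn))"

text \<open>Round \<open>it\<close> adds one representative for each combination of types towards
  the \<open>cn it\<close> elements chosen before. Rounds are indexed by tokens because an inner
  quantifier has a later token than the outer ones, whose values are then among those
  elements.\<close>

definition "select =
  For False it (V lV) (For True x1 (V nV) select1;; Asg cn (sucE (V it)) (V sn))"

section \<open>Code: tables of assignments and evaluation\<close>

text \<open>The base exceeds the number of chosen elements by one, so that an assignment exists even
  over the empty poset. \<open>rN\<close> has two entries more than there are tokens, since
  evaluating token \<open>p\<close> may read row \<open>p + 2\<close>.\<close>

definition "powers =
  bs ::= sucE (V sn);; Asg pw (N 0) (N 1);;
  For False j1 (V lV)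
    (acc ::= N 0;; For False e1 (V bs) (acc ::= Plus (V acc) (Arr pw (V j1)));; Asg pw (sucE (V j1)) (V acc));;
  nN ::= Arr pw (V lV);;
  acc ::= N 0;;
  For False j1 (Plus (V lV) (N 2)) (Asg rN (V j1) (V acc);; acc ::= Plus (V acc) (V nN))"

text \<open>Over consecutive numbers, digit \<open>j\<close> stays constant for \<open>pw j\<close>
  steps and then advances cyclically, so two counters replace division.\<close>

definition "digits =
  For False j1 (V lV)
    (cv ::= N 0;; vl ::= N 0;;
     For False as (V nN)
      (Asg dig (Plus (Arr rN (V j1)) (V as)) (V vl);; cv ::= sucE (V cv);;
       Cond (eqE (V cv) (Arr pw (V j1)))
         (cv ::= N 0;; vl ::= sucE (V vl);; Cond (eqE (V vl) (V bs)) (vl ::= N 0) Skip) Skip))"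

text \<open>
  An assignment is coded by a number in base \<open>bs\<close>. The value of a variable is the element of \<open>sel\<close> whose
  index is the digit at the position \<open>slot\<close>, the last position at which the name of the variable occurs
  as a token of the sentence. The table \<open>VT\<close> is filled from the last token to the first, and a
  quantifier at token \<open>p\<close> ranges over the first \<open>cn (p + 1)\<close> elements of \<open>sel\<close>. Tokens at which no
  subformula starts are treated in the same way; their entries are meaningless and never used.
\<close>

definition "slots =
  For False j1 (V lV) (Asg slot (V j1) (V j1);;
    For False p1 (V lV) (Cond (eqE (tokE (V p1)) (tokE (V j1))) (Asg slot (V j1) (V p1)) Skip))"

definition "slotE i = Arr slot (Plus (V pp) (N i))"
definition "digE i = Arr dig (Plus (Arr rN (slotE i)) (V as))"
definition "eltE i = Arr sel (digE i)"
definition "subE i = Arr VT (Plus (Arr rN i) (V as))"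

text \<open>\<open>k = 1\<close> is the existential and \<open>k = 0\<close> the universal
  quantifier: the result is \<open>k\<close> once some entry is \<open>k\<close>. Repeated
  subtraction clears the digit of the variable, and each round of the second loop increases it by
  one.\<close>

definition "quant e k =
  bv ::= V as;;
  For False e1 (digE 1) (bv ::= Minus (V bv) (Arr pw (slotE 1)));;
  vl ::= notE (N k);;
  For False e1 (Arr cn (sucE (V pp)))
    (Cond (eqE (Arr VT (Plus (Arr rN e) (V bv))) (N k)) (vl ::= N k) Skip;;
     bv ::= Plus (V bv) (Arr pw (slotE 1)))"

definition "node_value =
  Cond (eqE (V opv) (N 0)) (vl ::= eqE (eltE 1) (eltE 2)) (
  Cond (eqE (V opv) (N 1)) (vl ::= leE (eltE 1) (eltE 2)) (
  Cond (eqE (V opv) (N 2))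
    (Cond (eqE (Arr lab (eltE 1)) (Arr lab (eltE 2))) (vl ::= slE (eltE 1) (eltE 2))
       (vl ::= ltE (Arr lab (eltE 1)) (Arr lab (eltE 2)))) (
  Cond (eqE (V opv) (N 3)) (vl ::= eqE (tokE (sucE (V pp))) (colE (eltE 2))) (
  Cond (eqE (V opv) (N 4)) (vl ::= notE (subE (sucE (V pp)))) (
  Cond (eqE (V opv) (N 5)) (vl ::= andE (subE (sucE (V pp))) (subE (Arr en (sucE (V pp))))) (
  Cond (eqE (V opv) (N 6))
    (vl ::= notE (andE (notE (subE (sucE (V pp)))) (notE (subE (Arr en (sucE (V pp))))))) (
  Cond (eqE (V opv) (N 7)) (quant (Plus (V pp) (N 2)) 1) (quant (Plus (V pp) (N 2)) 0))))))))"

definition "eval_node = node_value;; Asg VT (Plus (Arr rN (V pp)) (V as)) (V vl)"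

text \<open>Prefix notation has no brackets: the second argument of a connective starts where the
  first one ends, so ends are tabulated along with the values.\<close>

definition "node_end =
  Cond (ltE (V opv) (N 4)) (Asg en (V pp) (Plus (V pp) (N 3))) (
  Cond (eqE (V opv) (N 4)) (Asg en (V pp) (Arr en (sucE (V pp)))) (
  Cond (ltE (V opv) (N 7)) (Asg en (V pp) (Arr en (Arr en (sucE (V pp)))))
    (Asg en (V pp) (Arr en (Plus (V pp) (N 2))))))"

definition "eval =
  For False it (V lV)
    (pp ::= Minus (Minus (V lV) (N 1)) (V it);;
     opv ::= tokE (V pp);;
     node_end;;
     For False as (V nN) eval_node)"

definition "prog =
  setup;; partition_chains;; roots;; colours;; labels;; types0;; refine;; select;; powers;; digits;; slots;; eval"

lemma prog_wf: "wf_com prog"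
  by (simp add: prog_def setup_def partition_chains_def search_def visit_def flip1_def roots_def colours_def
    labels_def types0_def refine_def classify_def same_type_def incl_def select_def select1_def
    compare_sel_def powers_def digits_def slots_def eval_def node_end_def eval_node_def node_value_def quant_def
    slotE_def digE_def eltE_def subE_def)

text \<open>Attained by the four nested loops in \<open>refine\<close>; the search for augmenting
  paths has depth 3.\<close>

lemma prog_big_depth: "big_depth prog = 4"
  by (simp add: prog_def setup_def partition_chains_def search_def visit_def flip1_def roots_def colours_def
    labels_def types0_def refine_def classify_def same_type_def incl_def select_def select1_def
    compare_sel_def powers_def digits_def slots_def eval_def node_end_def eval_node_def node_value_def quant_def)

text \<open>Elements are identified with their positions in the input. \<open>B\<close> and
  \<open>Q\<close> bound the two kinds of loops: \<open>Suc n\<close> is the length of the table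
  \<open>row\<close>, and \<open>length ts + 2\<close> that of \<open>rN\<close>.\<close>

locale input =
  fixes w :: "nat list" and n :: nat and le :: "nat \<Rightarrow> nat \<Rightarrow> bool" and col :: "nat \<Rightarrow> nat"
    and ts :: "nat list" and B Q :: nat
  assumes w_length: "length w = 1 + n * n + n + length ts"
    and w_size: "w ! 0 = n"
    and w_le: "x < n \<Longrightarrow> y < n \<Longrightarrow> w ! (1 + n * x + y) = (if le x y then 1 else 0)"
    and w_col: "x < n \<Longrightarrow> w ! (1 + n * n + x) = col x"
    and w_ts: "p < length ts \<Longrightarrow> w ! (1 + n * n + n + p) = ts ! p"
    and le_refl: "x < n \<Longrightarrow> le x x"
    and le_antisym: "x < n \<Longrightarrow> y < n \<Longrightarrow> le x y \<Longrightarrow> le y x \<Longrightarrow> x = y"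
    and le_trans: "x < n \<Longrightarrow> y < n \<Longrightarrow> z < n \<Longrightarrow> le x y \<Longrightarrow> le y z \<Longrightarrow> le x z"
    and B: "Suc n \<le> B" and QL: "length ts + 2 \<le> Q"
begin

abbreviation (input) "L \<equiv> length ts"

definition "base s \<longleftrightarrow> s nV 0 = n \<and> (\<forall>x\<le>n. s row x = n * x) \<and> s fb 0 = Suc (n * n + n) \<and> s lV 0 = L"

lemma base_cong: "base s \<Longrightarrow> t nV = s nV \<Longrightarrow> t row = s row \<Longrightarrow> t fb = s fb \<Longrightarrow> t lV = s lV \<Longrightarrow> base t"
  by (simp add: base_def)

lemma base_n: "base s \<Longrightarrow> s nV 0 = n" and base_L: "base s \<Longrightarrow> s lV 0 = L"
  by (simp_all add: base_def)

lemma n_le_B: "n \<le> B" and L_le_Q: "L \<le> Q"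
  using B QL by auto

lemma base_upd: "k \<notin> {nV, row, fb, lV} \<Longrightarrow> base (upd s k i v) = base s"
  by (simp add: base_def upd_apply)

lemma base_exe: "written c \<inter> {nV, row, fb, lV} = {} \<Longrightarrow> base s \<Longrightarrow> base (exe w c s)"
  by (rule base_cong[of s]) (auto simp: exe_frame)

lemma pair_less: "x < n \<Longrightarrow> y < n \<Longrightarrow> n * x + y < n * n"
proof -
  assume "x < n" "y < n"
  then have "n * x + y < n * Suc x" by simp
  also have "\<dots> \<le> n * n" using \<open>x < n\<close> by (intro mult_le_mono) auto
  finally show ?thesis .
qed

lemma ev_leE:
  assumes "base s" "ev w s a < n" "ev w s b < n"
  shows "ev w s (leE a b) = (if le (ev w s a) (ev w s b) then 1 else 0)"
  using assms w_le[of "ev w s a" "ev w s b"] pair_less[of "ev w s a" "ev w s b"] w_length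
  by (simp add: leE_def base_def mem_def)

lemma ev_slE:
  assumes "base s" "ev w s a < n" "ev w s b < n"
  shows "ev w s (slE a b) = (if le (ev w s a) (ev w s b) \<and> ev w s a \<noteq> ev w s b then 1 else 0)"
  using ev_leE[OF assms] by (simp add: slE_def)

lemma ev_colE: "base s \<Longrightarrow> ev w s a < n \<Longrightarrow> ev w s (colE a) = col (ev w s a)"
  using w_col[of "ev w s a"] w_length by (simp add: colE_def base_def mem_def)

lemma ev_tokE: "base s \<Longrightarrow> ev w s p < L \<Longrightarrow> ev w s (tokE p) = ts ! ev w s p"
  using w_ts[of "ev w s p"] w_length by (simp add: tokE_def base_def mem_def)

lemma ev_pairE: "base s \<Longrightarrow> ev w s a \<le> n \<Longrightarrow> ev w s (pairE a b) = n * ev w s a + ev w s b"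
  by (simp add: pairE_def base_def)

lemma setup_correct:
  assumes s: "\<And>k i. s k i = 0"
  shows "base (exe w setup s) \<and> bounded w B Q setup s \<and> (\<forall>k. k \<notin> {nV, row, fb, lV, acc, it} \<longrightarrow> exe w setup s k = (\<lambda>_. 0))"
proof -
  define s1 where "s1 = exe w (nV ::= Inp (N 0)) s"
  have s1: "s1 nV 0 = n" "s1 acc 0 = 0" using w_size w_length s by (simp_all add: s1_def mem_def upd_apply)
  let ?loop = "For True it (sucE (V nV)) (Asg row (V it) (V acc);; acc ::= Plus (V acc) (V nV))"
  have l: "((\<forall>x<Suc n. exe w ?loop s1 row x = n * x) \<and> exe w ?loop s1 acc 0 = n * Suc n) \<and> bounded w B Q ?loop s1"
  proof (rule For_rule[where I = "\<lambda>i t. (\<forall>x<i. t row x = n * x) \<and> t acc 0 = n * i"])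
    show "Suc n \<le> (if True then B else Q)" using B by simp
  qed (use s1 in \<open>auto simp: upd_apply less_Suc_eq\<close>)
  define s2 where "s2 = exe w ?loop s1"
  have s2: "s2 nV = s1 nV" unfolding s2_def by (rule exe_frame) simp
  have e: "exe w setup s = exe w (fb ::= Plus (sucE (Arr row (V nV))) (V nV);; lV ::= Minus Len (V fb)) s2"
    unfolding setup_def s2_def s1_def by simp
  have "base (exe w setup s)"
    unfolding e using s1 s2 l w_length by (simp add: base_def upd_apply s2_def less_Suc_eq_le)
  moreover have "bounded w B Q setup s"
    using l unfolding setup_def s1_def by simp
  moreover have "exe w setup s k = (\<lambda>_. 0)" if "k \<notin> {nV, row, fb, lV, acc, it}" for k
  proof -
    have "exe w setup s k = s k" by (rule exe_frame) (use that in \<open>auto simp: setup_def\<close>)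
    then show ?thesis using s by (simp add: fun_eq_iff)
  qed
  ultimately show ?thesis by blast
qed

end

section \<open>Correctness of the program\<close>

context input
begin

abbreviation "lt x y \<equiv> le x y \<and> x \<noteq> y"

sublocale sp: strict_poset n lt
  using le_trans le_antisym by unfold_locales blast+

abbreviation "sinv t \<equiv> sp.search_inv (t nx) (t pv) (t qu) (t qn 0) (t vis) (t par) (t fin 0)"

lemma visit_correct:
  assumes "base t" "t y1 0 < n" "t i1 0 < t qn 0" "sinv t" "sp.matching 0 (t nx) (t pv)"
  shows "sinv (exe w visit t) \<and> (\<forall>y. t vis y \<noteq> 0 \<longrightarrow> exe w visit t vis y \<noteq> 0) \<and>
    (lt (t qu (t i1 0)) (t y1 0) \<longrightarrow> exe w visit t vis (t y1 0) \<noteq> 0) \<and>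
    (\<forall>j<t qn 0. exe w visit t qu j = t qu j) \<and> t qn 0 \<le> exe w visit t qn 0 \<and> bounded w B Q visit t"
proof -
  let ?x = "t qu (t i1 0)" and ?y = "t y1 0"
  have x: "?x < n" using assms(3,4) unfolding sp.search_inv_def by blast
  have c: "ev w t (andE (slE (Arr qu (V i1)) (V y1)) (notE (Arr vis (V y1)))) \<noteq> 0 \<longleftrightarrow> lt ?x ?y \<and> t vis ?y = 0"
    using x assms(1,2) by (simp add: ev_slE)
  show ?thesis
  proof (cases "lt ?x ?y \<and> t vis ?y = 0")
    case False
    then show ?thesis using assms c by (auto simp: visit_def)
  next
    case True
    show ?thesis
    proof (cases "t pv ?y = 0")
      case z: True
      have "sp.search_inv (t nx) (t pv) (t qu) (t qn 0) ((t vis)(?y := 1)) ((t par)(?y := t i1 0)) (Suc ?y)"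
        by (rule sp.search_inv_free[OF assms(4,5,3,2)]) (use True z in auto)
      then show ?thesis using True z c by (simp add: visit_def upd_apply)
    next
      case nz: False
      have "sp.search_inv (t nx) (t pv) ((t qu)(t qn 0 := t pv ?y - 1)) (Suc (t qn 0))
          ((t vis)(?y := 1)) ((t par)(?y := t i1 0)) (t fin 0)"
        by (rule sp.search_inv_push[OF assms(4,5,3,2)]) (use True nz in auto)
      then show ?thesis using True nz c by (simp add: visit_def upd_apply)
    qed
  qed
qed

text \<open>Marks are never removed and filled queue positions never change, so a processed position
  stays processed while the queue grows.\<close>

lemma search_correct:
  assumes b: "base s" and M: "sp.matching 0 (s nx) (s pv)"
  defines "s' \<equiv> exe w search s"
  shows "sinv s' \<and> (\<forall>j<s' qn 0. \<forall>y<n. lt (s' qu j) y \<longrightarrow> s' vis y \<noteq> 0) \<and> bounded w B Q search s"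
proof -
  let ?c1 = "For True x1 (V nV) (Asg vis (V x1) (N 0))"
  let ?c2 = "For True x1 (V nV) (Cond (Arr nx (V x1)) Skip (Asg qu (V qn) (V x1);; qn ::= sucE (V qn)))"
  let ?b3 = "Cond (ltE (V i1) (V qn)) (For True y1 (V nV) visit) Skip"
  let ?c3 = "For True i1 (V nV) ?b3"
  have n: "s nV 0 = n" using b by (rule base_n)
  define s1 where "s1 = exe w ?c1 s"
  have s1: "(\<forall>x<n. s1 vis x = 0) \<and> bounded w B Q ?c1 s"
    unfolding s1_def
  proof (rule For_rule[where I = "\<lambda>i t. \<forall>x<i. t vis x = 0"])
    show "n \<le> (if True then B else Q)" using n_le_B by simp
  qed (use n in \<open>auto simp: upd_apply less_Suc_eq\<close>)
  define s2 where "s2 = exe w (qn ::= N 0;; fin ::= N 0) s1"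
  have fr2: "s2 k = s k" if "k \<notin> {vis, x1, qn, fin}" for k
    unfolding s2_def s1_def using that by (simp add: exe_frame upd_apply)
  \<comment> \<open>All queued elements are below \<open>i\<close>, so appending \<open>i\<close>
    keeps the queue injective.\<close>
  define I2 where "I2 = (\<lambda>i (t::st). (\<forall>j<t qn 0. t qu j < n \<and> t qu j < i \<and> s nx (t qu j) = 0) \<and>
     inj_on (t qu) {..<t qn 0} \<and> (\<forall>x<i. s nx x = 0 \<longrightarrow> x \<in> t qu ` {..<t qn 0}))"
  have "I2 n (exe w ?c2 s2) \<and> bounded w B Q ?c2 s2"
  proof (rule For_rule)
    show "ev w s2 (V nV) = n" using n fr2 by simp
    show "n \<le> (if True then B else Q)" using n_le_B by simp
    show "I2 0 s2" by (simp add: I2_def s2_def upd_apply)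
    show "I2 i (upd t x1 0 v)" if "I2 i t" for i t v using that by (simp add: I2_def upd_apply)
    fix i t
    assume i: "i < n" and fr: "\<And>j. j \<notin> insert x1 (written (Cond (Arr nx (V x1)) Skip (Asg qu (V qn) (V x1);; qn ::= sucE (V qn)))) \<Longrightarrow> t j = s2 j"
      and ti: "t x1 0 = i" and I: "I2 i t"
    have tn: "t nx = s nx" using fr fr2 by simp
    let ?body = "Cond (Arr nx (V x1)) Skip (Asg qu (V qn) (V x1);; qn ::= sucE (V qn))"
    have "I2 (Suc i) (exe w ?body t)"
    proof (cases "s nx i = 0")
      case False
      then show ?thesis using I ti tn by (auto simp: I2_def less_Suc_eq)
    next
      case True
      let ?q = "(t qu)(t qn 0 := i)"
      have new: "i \<notin> t qu ` {..<t qn 0}" using I by (auto simp: I2_def)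
      have inj: "inj_on ?q {..<Suc (t qn 0)}"
        using I new by (simp add: I2_def lessThan_Suc inj_on_fun_updI)
      have "x \<in> ?q ` {..<Suc (t qn 0)}" if x: "x < Suc i" "s nx x = 0" for x
      proof (cases "x = i")
        case True
        then show ?thesis by (intro image_eqI[of _ _ "t qn 0"]) auto
      next
        case False
        then obtain j where "j < t qn 0" "x = t qu j" using I x by (auto simp: I2_def less_Suc_eq)
        then show ?thesis by (intro image_eqI[of _ _ j]) auto
      qed
      then show ?thesis using I ti tn i True inj by (auto simp: I2_def upd_apply less_Suc_eq)
    qed
    then show "I2 (Suc i) (exe w ?body t) \<and> bounded w B Q ?body t" by simp
  qed
  define s3 where "s3 = exe w ?c2 s2"
  have s3: "I2 n s3" "bounded w B Q ?c2 s2"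
    using \<open>I2 n (exe w ?c2 s2) \<and> bounded w B Q ?c2 s2\<close> by (simp_all add: s3_def)
  have fr3: "s3 k = s2 k" if "k \<notin> {x1, qu, qn}" for k
    unfolding s3_def by (rule exe_frame) (use that in simp)
  have "sinv s3"
  proof -
    have "s3 vis x = 0" if "x < n" for x using s1 fr3 that by (simp add: s2_def upd_apply)
    moreover have "s3 fin 0 = 0" using fr3 by (simp add: s2_def upd_apply)
    moreover have "s3 nx = s nx" "s3 pv = s pv" using fr3 fr2 by auto
    ultimately show ?thesis using s3(1) unfolding sp.search_inv_def I2_def by auto
  qed
  have b3: "base s3" "s3 nx = s nx" "s3 pv = s pv" using b fr2 fr3 by (auto intro: base_cong)
  define I3 where "I3 = (\<lambda>i t. sinv t \<and> (\<forall>j<i. j < t qn 0 \<longrightarrow> (\<forall>y<n. lt (t qu j) y \<longrightarrow> t vis y \<noteq> 0)))"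
  have r3: "I3 n (exe w ?c3 s3) \<and> bounded w B Q ?c3 s3"
  proof (rule For_rule)
    show "ev w s3 (V nV) = n" using b3 base_n by simp
    show "n \<le> (if True then B else Q)" using n_le_B by simp
    show "I3 0 s3" using \<open>sinv s3\<close> by (simp add: I3_def)
    show "I3 i (upd t i1 0 v)" if "I3 i t" for i t v using that by (simp add: I3_def upd_apply)
    fix i t
    assume i: "i < n" and fr: "\<And>j. j \<notin> insert i1 (written ?b3) \<Longrightarrow> t j = s3 j" and ti: "t i1 0 = i" and I: "I3 i t"
    have fr': "t j = s3 j" if "j \<notin> {i1, y1, vis, par, qu, qn, fin}" for j
      by (rule fr) (use that in \<open>simp add: visit_def\<close>)
    have bt: "base t" "t nx = s nx" "t pv = s pv" using b3 fr' by (auto intro: base_cong)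
    show "I3 (Suc i) (exe w ?b3 t) \<and> bounded w B Q ?b3 t"
    proof (cases "i < t qn 0")
      case False
      then show ?thesis using I ti by (auto simp: I3_def less_Suc_eq)
    next
      case True
      let ?lp = "For True y1 (V nV) visit"
      define J where "J = (\<lambda>m t'. sinv t' \<and> (\<forall>y. t vis y \<noteq> 0 \<longrightarrow> t' vis y \<noteq> 0) \<and> t qn 0 \<le> t' qn 0 \<and>
         (\<forall>j<t qn 0. t' qu j = t qu j) \<and> (\<forall>y<m. lt (t qu i) y \<longrightarrow> t' vis y \<noteq> 0))"
      have "J n (exe w ?lp t) \<and> bounded w B Q ?lp t"
      proof (rule For_rule)
        show "ev w t (V nV) = n" using bt base_n by simp
        show "n \<le> (if True then B else Q)" using n_le_B by simp
        show "J 0 t" using I by (simp add: I3_def J_def)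
        show "J m (upd t' y1 0 v)" if "J m t'" for m t' v using that by (simp add: J_def upd_apply)
        fix m t'
        assume m: "m < n" and fr2: "\<And>j. j \<notin> insert y1 (written visit) \<Longrightarrow> t' j = t j" and run_time: "t' y1 0 = m" and J: "J m t'"
        have fr2': "t' j = t j" if "j \<notin> {y1, vis, par, qu, qn, fin}" for j
          by (rule fr2) (use that in \<open>simp add: visit_def\<close>)
        have bt': "base t'" "t' nx = s nx" "t' pv = s pv" "t' i1 0 = i"
          using bt ti fr2' by (auto intro: base_cong[of t])
        have q: "t' qu i = t qu i" "i < t' qn 0" using J True unfolding J_def by auto
        have v: "sinv (exe w visit t') \<and> (\<forall>y. t' vis y \<noteq> 0 \<longrightarrow> exe w visit t' vis y \<noteq> 0) \<and>
            (lt (t' qu (t' i1 0)) (t' y1 0) \<longrightarrow> exe w visit t' vis (t' y1 0) \<noteq> 0) \<and>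
            (\<forall>j<t' qn 0. exe w visit t' qu j = t' qu j) \<and> t' qn 0 \<le> exe w visit t' qn 0 \<and> bounded w B Q visit t'"
          by (rule visit_correct) (use bt' run_time m q J M in \<open>auto simp: J_def\<close>)
        show "J (Suc m) (exe w visit t') \<and> bounded w B Q visit t'"
          using v J bt'(4) run_time q unfolding J_def by (auto simp: less_Suc_eq)
      qed
      then show ?thesis using I ti True unfolding I3_def J_def by (auto simp: less_Suc_eq)
    qed
  qed
  have s': "s' = exe w ?c3 s3" by (simp add: s'_def search_def s3_def s2_def s1_def)
  have inv: "I3 n s'" using r3 s' by simp
  \<comment> \<open>The queue is no longer than the number of rounds, so no position is left
    unprocessed.\<close>
  have "s' qn 0 \<le> n" using inv sp.search_inv_qn_le unfolding I3_def by blast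
  then have "\<forall>j<s' qn 0. \<forall>y<n. lt (s' qu j) y \<longrightarrow> s' vis y \<noteq> 0"
    using inv unfolding I3_def by (meson less_le_trans)
  moreover have "bounded w B Q search s"
    using s1 s3(2) r3 unfolding search_def by (simp add: s1_def s2_def s3_def)
  ultimately show ?thesis using inv unfolding I3_def by blast
qed

text \<open>Every round before \<open>don\<close> is set adds one matched element, so either some
  search fails or \<open>n\<close> elements are matched; both yield \<open>sp.stuck\<close>.\<close>

lemma partition_correct:
  assumes b: "base s" and z: "\<And>k i. k \<notin> {nV, row, fb, lV, acc, it} \<Longrightarrow> s k i = 0"
  defines "s' \<equiv> exe w partition_chains s"
  shows "sp.matching 0 (s' nx) (s' pv) \<and> sp.stuck (s' nx) (s' pv) \<and> bounded w B Q partition_chains s"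
proof -
  let ?fl = "For True t1 (V nV) flip1"
  let ?body = "search;; Cond (V fin) (cur ::= V fin;; ?fl) (don ::= N 1)"
  let ?I = "\<lambda>i t. sp.matching 0 (t nx) (t pv) \<and> (if t don 0 = 0 then i \<le> sp.matched (t nx) else sp.stuck (t nx) (t pv))"
  have "?I n s' \<and> bounded w B Q partition_chains s"
    unfolding s'_def partition_chains_def
  proof (rule For_rule[where I = "?I"])
    show "ev w s (V nV) = n" using b base_n by simp
    show "n \<le> (if True then B else Q)" using n_le_B by simp
    show "?I 0 s" using z by (simp add: sp.matching_def)
    show "?I i (upd t it 0 v)" if "?I i t" for i t v using that by (simp add: upd_apply)
    fix i t
    assume i: "i < n" and fr: "\<And>j. j \<notin> insert it (written (Cond (V don) Skip ?body)) \<Longrightarrow> t j = s j" and I: "?I i t"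
    have bt: "base t" using b by (rule base_cong) (auto intro!: fr simp: search_def visit_def flip1_def)
    show "?I (Suc i) (exe w (Cond (V don) Skip ?body) t) \<and> bounded w B Q (Cond (V don) Skip ?body) t"
    proof (cases "t don 0 = 0")
      case False
      then show ?thesis using I by simp
    next
      case True
      define t2 where "t2 = exe w search t"
      have f2: "t2 k = t k" if "k \<notin> {x1, vis, qn, fin, qu, i1, y1, par}" for k
        unfolding t2_def by (rule exe_frame) (use that in \<open>simp add: search_def visit_def\<close>)
      have M: "sp.matching 0 (t nx) (t pv)" and c: "i \<le> sp.matched (t nx)" using I True by auto
      have S: "sinv t2" "\<And>j y. j < t2 qn 0 \<Longrightarrow> y < n \<Longrightarrow> lt (t2 qu j) y \<Longrightarrow> t2 vis y \<noteq> 0" "bounded w B Q search t"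
        using search_correct[OF bt M] unfolding t2_def by blast+
      have nx2: "t2 nx = t nx" "t2 pv = t pv" "t2 don = t don" using f2 by auto
      show ?thesis
      proof (cases "t2 fin 0 = 0")
        case fin: True
        have "sp.search_inv (t2 nx) (t2 pv) (t2 qu) (t2 qn 0) (t2 vis) (t2 par) 0" using S(1) fin by simp
        from sp.search_stuck[OF this S(2)] have "sp.stuck (t nx) (t pv)" using nx2 by simp
        then show ?thesis using True S(3) fin M nx2 by (simp add: t2_def[symmetric] upd_apply)
      next
        case fin: False
        define t3 where "t3 = exe w (cur ::= V fin) t2"
        have f3: "t3 k = t2 k" if "k \<noteq> cur" for k using that by (simp add: t3_def upd_apply)
        let ?J = "\<lambda>m t'. sp.flip_inv (t nx) (t2 qu) (t2 vis) (t2 par) m (t' cur 0) (t' nx) (t' pv)"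
        have "?J n (exe w ?fl t3) \<and> bounded w B Q ?fl t3"
        proof (rule For_rule[where I = "?J"])
          have b3: "base t3" using bt by (rule base_cong) (simp_all add: f3 f2)
          then show "ev w t3 (V nV) = n" using base_n by simp
          show "n \<le> (if True then B else Q)" using n_le_B by simp
          show "?J 0 t3" using sp.flip_inv_start[OF S(1)] M fin nx2 by (simp add: t3_def upd_apply)
          show "?J m (upd t' t1 0 v)" if "?J m t'" for m t' v using that by (simp add: upd_apply)
          fix m t'
          assume m: "m < n" and fr': "\<And>j. j \<notin> insert t1 (written flip1) \<Longrightarrow> t' j = t3 j" and J: "?J m t'"
          have q: "t' qu = t2 qu" "t' par = t2 par" using fr' f3 by (auto simp: flip1_def)
          show "?J (Suc m) (exe w flip1 t') \<and> bounded w B Q flip1 t'"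
          proof (cases "t' cur 0 = 0")
            case True
            then show ?thesis using J by (simp add: flip1_def sp.flip_inv_def)
          next
            case False
            from sp.flip_inv_step[OF S(1) J[folded nx2(1)] False]
            show ?thesis using False q nx2 by (simp add: flip1_def upd_apply)
          qed
        qed
        then have F: "?J n (exe w ?fl t3)" "bounded w B Q ?fl t3" by auto
        have d: "exe w ?fl t3 don 0 = 0"
          using exe_frame[of don ?fl w t3] f3 nx2 True by (simp add: flip1_def)
        from sp.flip_inv_end[OF F(1)] show ?thesis
          using True S(3) fin F(2) c d by (simp add: t2_def[symmetric] t3_def)
      qed
    qed
  qed
  then show ?thesis using sp.perfect_stuck by (auto split: if_splits)
qed

end

section \<open>Roots, colour classes and labels\<close>

text \<open>The content of a cell that starts with \<open>d\<close> and is overwritten at every hit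
  of a search.\<close>

primrec last_index :: "(nat \<Rightarrow> bool) \<Rightarrow> nat \<Rightarrow> nat \<Rightarrow> nat" where
  "last_index P d 0 = d"
| "last_index P d (Suc m) = (if P m then m else last_index P d m)"

lemma last_index_ex: "j < m \<Longrightarrow> P j \<Longrightarrow> last_index P d m < m \<and> P (last_index P d m)"
proof (induction m)
  case (Suc m)
  then show ?case by (cases "P m") (auto simp: less_Suc_eq)
qed simp

lemma last_index_none: "\<not> (\<exists>j<m. P j) \<Longrightarrow> last_index P d m = d"
  by (induction m) auto

lemma last_index_cong: "j < m \<Longrightarrow> P j \<Longrightarrow> (\<And>j. P j = P' j) \<Longrightarrow> last_index P d m = last_index P' d' m"
proof (induction m)
  case (Suc m)
  then show ?case by (cases "P m") (auto simp: less_Suc_eq)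
qed simp

lemma all_ex_cong:
  "(\<And>z v. z < n \<Longrightarrow> v < n \<Longrightarrow> P z v = P' z v) \<Longrightarrow>
     (\<forall>z<n. \<exists>v<(n::nat). P z v) = (\<forall>z<n. \<exists>v<n. P' z v)"
  by blast

context input
begin

lemma roots_correct:
  assumes b: "base s" and M: "sp.matching 0 (s nx) (s pv)"
  shows "(\<forall>x<n. exe w roots s rt x = sp.root (s pv) x) \<and> bounded w B Q roots s"
  unfolding roots_def
proof (rule For_rule[where I = "\<lambda>i t. \<forall>x<i. t rt x = sp.root (s pv) x"])
  let ?in = "Cond (Arr pv (Arr rt (V x1))) (Asg rt (V x1) (Minus (Arr pv (Arr rt (V x1))) (N 1))) Skip"
  let ?lp = "For True t1 (V nV) ?in"
  show "ev w s (V nV) = n" using b base_n by simp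
  show "n \<le> (if True then B else Q)" using n_le_B by simp
  show "\<forall>x<i. upd t x1 0 v rt x = sp.root (s pv) x" if "\<forall>x<i. t rt x = sp.root (s pv) x" for i t v
    using that by (simp add: upd_apply)
  fix i t
  assume i: "i < n" and fr: "\<And>j. j \<notin> insert x1 (written (Asg rt (V x1) (V x1);; ?lp)) \<Longrightarrow> t j = s j"
    and ti: "t x1 0 = i" and I: "\<forall>x<i. t rt x = sp.root (s pv) x"
  define t2 where "t2 = exe w (Asg rt (V x1) (V x1)) t"
  have bt: "base t2" "t2 pv = s pv" "t2 x1 0 = i" using b fr ti by (auto intro: base_cong[of s] simp: t2_def upd_apply)
  let ?J = "\<lambda>m t'. (\<forall>x<i. t' rt x = sp.root (s pv) x) \<and> t' rt i = (sp.pred (s pv) ^^ m) i"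
  have "?J n (exe w ?lp t2) \<and> bounded w B Q ?lp t2"
  proof (rule For_rule[where I = ?J])
    show "ev w t2 (V nV) = n" using bt base_n by simp
    show "n \<le> (if True then B else Q)" using n_le_B by simp
    show "?J 0 t2" using I ti by (simp add: t2_def upd_apply)
    show "?J m (upd t' t1 0 v)" if "?J m t'" for m t' v using that by (simp add: upd_apply)
    fix m t'
    assume m: "m < n" and fr': "\<And>j. j \<notin> insert t1 (written ?in) \<Longrightarrow> t' j = t2 j" and J: "?J m t'"
    have "t' pv = s pv" "t' x1 0 = i" using fr' bt by auto
    then show "?J (Suc m) (exe w ?in t') \<and> bounded w B Q ?in t'"
      using J by (auto simp: upd_apply sp.pred_def)
  qed
  then show "(\<forall>x<Suc i. exe w (Asg rt (V x1) (V x1);; ?lp) t rt x = sp.root (s pv) x) \<and>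
      bounded w B Q (Asg rt (V x1) (V x1);; ?lp) t"
    by (auto simp: t2_def less_Suc_eq sp.root_def)
qed simp

abbreviation "colour_class x \<equiv> last_index (\<lambda>p. ts ! p = col x) L L"

lemma colours_correct:
  assumes b: "base s"
  shows "(\<forall>x<n. exe w colours s ccl x = colour_class x) \<and> bounded w B Q colours s"
  unfolding colours_def
proof (rule For_rule[where I = "\<lambda>i t. \<forall>x<i. t ccl x = colour_class x"])
  let ?in = "Cond (eqE (tokE (V p1)) (colE (V x1))) (Asg ccl (V x1) (V p1)) Skip"
  let ?lp = "For False p1 (V lV) ?in"
  show "ev w s (V nV) = n" using b base_n by simp
  show "n \<le> (if True then B else Q)" using n_le_B by simp
  show "\<forall>x<i. upd t x1 0 v ccl x = colour_class x" if "\<forall>x<i. t ccl x = colour_class x" for i t v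
    using that by (simp add: upd_apply)
  fix i t
  assume i: "i < n" and fr: "\<And>j. j \<notin> insert x1 (written (Asg ccl (V x1) (V lV);; ?lp)) \<Longrightarrow> t j = s j"
    and ti: "t x1 0 = i" and I: "\<forall>x<i. t ccl x = colour_class x"
  have bt': "base t" using b fr by (auto intro: base_cong[of s])
  define t2 where "t2 = exe w (Asg ccl (V x1) (V lV)) t"
  have bt: "base t2" "t2 x1 0 = i" using bt' ti by (auto simp: t2_def upd_apply base_upd)
  let ?J = "\<lambda>m t'. (\<forall>x<i. t' ccl x = colour_class x) \<and> t' ccl i = last_index (\<lambda>p. ts ! p = col i) L m"
  have "?J L (exe w ?lp t2) \<and> bounded w B Q ?lp t2"
  proof (rule For_rule[where I = ?J])
    show "ev w t2 (V lV) = L" using bt base_L by simp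
    show "L \<le> (if False then B else Q)" using L_le_Q by simp
    show "?J 0 t2" using I ti bt' base_L by (simp add: t2_def upd_apply)
    show "?J m (upd t' p1 0 v)" if "?J m t'" for m t' v using that by (simp add: upd_apply)
    fix m t'
    assume m: "m < L" and fr': "\<And>j. j \<notin> insert p1 (written ?in) \<Longrightarrow> t' j = t2 j" and run_time: "t' p1 0 = m" and J: "?J m t'"
    have b': "base t'" using bt fr' by (auto intro: base_cong[of t2])
    have x: "t' x1 0 = i" using fr' bt by auto
    have "ev w t' (tokE (V p1)) = ts ! m" "ev w t' (colE (V x1)) = col i"
      using ev_tokE[OF b', of "V p1"] ev_colE[OF b', of "V x1"] m run_time x i by auto
    then show "?J (Suc m) (exe w ?in t') \<and> bounded w B Q ?in t'"
      using J x run_time by (auto simp: upd_apply)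
  qed
  then show "(\<forall>x<Suc i. exe w (Asg ccl (V x1) (V lV);; ?lp) t ccl x = colour_class x) \<and>
      bounded w B Q (Asg ccl (V x1) (V lV);; ?lp) t"
    by (auto simp: t2_def less_Suc_eq)
qed simp

lemma labels_correct:
  assumes b: "base s"
  defines "same y x \<equiv> s rt y = s rt x \<and> s ccl y = s ccl x"
  shows "(\<forall>x<n. exe w labels s lab x = last_index (\<lambda>y. same y x) x n) \<and> bounded w B Q labels s"
  unfolding labels_def
proof (rule For_rule[where I = "\<lambda>i t. \<forall>x<i. t lab x = last_index (\<lambda>y. same y x) x n"])
  let ?in = "Cond (andE (eqE (Arr rt (V y1)) (Arr rt (V x1))) (eqE (Arr ccl (V y1)) (Arr ccl (V x1))))
        (Asg lab (V x1) (V y1)) Skip"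
  let ?lp = "For True y1 (V nV) ?in"
  show "ev w s (V nV) = n" using b base_n by simp
  show "n \<le> (if True then B else Q)" using n_le_B by simp
  show "\<forall>x<i. upd t x1 0 v lab x = last_index (\<lambda>y. same y x) x n"
    if "\<forall>x<i. t lab x = last_index (\<lambda>y. same y x) x n" for i t v
    using that by (simp add: upd_apply)
  fix i t
  assume i: "i < n" and fr: "\<And>j. j \<notin> insert x1 (written (Asg lab (V x1) (V x1);; ?lp)) \<Longrightarrow> t j = s j"
    and ti: "t x1 0 = i" and I: "\<forall>x<i. t lab x = last_index (\<lambda>y. same y x) x n"
  define t2 where "t2 = exe w (Asg lab (V x1) (V x1)) t"
  have bt: "base t2" "t2 rt = s rt" "t2 ccl = s ccl" "t2 x1 0 = i"
    using b fr ti by (auto intro: base_cong[of s] simp: t2_def upd_apply)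
  let ?J = "\<lambda>m t'. (\<forall>x<i. t' lab x = last_index (\<lambda>y. same y x) x n) \<and> t' lab i = last_index (\<lambda>y. same y i) i m"
  have "?J n (exe w ?lp t2) \<and> bounded w B Q ?lp t2"
  proof (rule For_rule[where I = ?J])
    show "ev w t2 (V nV) = n" using bt base_n by simp
    show "n \<le> (if True then B else Q)" using n_le_B by simp
    show "?J 0 t2" using I ti by (simp add: t2_def upd_apply)
    show "?J m (upd t' y1 0 v)" if "?J m t'" for m t' v using that by (simp add: upd_apply)
    fix m t'
    assume m: "m < n" and fr': "\<And>j. j \<notin> insert y1 (written ?in) \<Longrightarrow> t' j = t2 j" and run_time: "t' y1 0 = m" and J: "?J m t'"
    have "t' rt = s rt" "t' ccl = s ccl" "t' x1 0 = i" using fr' bt by auto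
    then show "?J (Suc m) (exe w ?in t') \<and> bounded w B Q ?in t'"
      using J run_time by (auto simp: upd_apply same_def)
  qed
  then show "(\<forall>x<Suc i. exe w (Asg lab (V x1) (V x1);; ?lp) t lab x = last_index (\<lambda>y. same y x) x n) \<and>
      bounded w B Q (Asg lab (V x1) (V x1);; ?lp) t"
    by (auto simp: t2_def less_Suc_eq)
qed simp

definition "good_labels c u \<longleftrightarrow> coloured_poset n le u col (set ts) \<and> card (u ` {..<n}) \<le> c \<and> (\<forall>x<n. u x < n)"

text \<open>A label is the last element with the same root and colour class. There are at most
  \<open>k\<close> roots and \<open>Suc L\<close> classes, one of them for the colours absent from
  the sentence.\<close>

lemma labelling_correct:
  assumes b: "base s" and M: "sp.matching 0 (s nx) (s pv)"
    and c: "card (sp.root (s pv) ` {..<n}) \<le> k"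
  defines "s' \<equiv> exe w (roots;; colours;; labels) s"
  shows "good_labels (k * Suc L) (s' lab) \<and> bounded w B Q (roots;; colours;; labels) s"
proof -
  define s1 where "s1 = exe w roots s"
  define s2 where "s2 = exe w colours s1"
  have s': "s' = exe w labels s2" by (simp add: s'_def s1_def s2_def)
  have r: "\<forall>x<n. s1 rt x = sp.root (s pv) x" "bounded w B Q roots s"
    using roots_correct[OF b M] by (auto simp: s1_def)
  have b1: "base s1" unfolding s1_def by (rule base_exe[OF _ b]) (simp add: roots_def)
  have cl: "\<forall>x<n. s2 ccl x = colour_class x" "bounded w B Q colours s1"
    using colours_correct[OF b1] by (auto simp: s2_def)
  have b2: "base s2" unfolding s2_def by (rule base_exe[OF _ b1]) (simp add: colours_def)
  have "s2 rt = s1 rt" unfolding s2_def by (rule exe_frame) (simp add: colours_def)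
  then have r2: "\<forall>x<n. s2 rt x = sp.root (s pv) x" using r by simp
  define same where "same = (\<lambda>y x. s2 rt y = s2 rt x \<and> s2 ccl y = s2 ccl x)"
  have l: "\<forall>x<n. s' lab x = last_index (\<lambda>y. same y x) x n" "bounded w B Q labels s2"
    using labels_correct[OF b2] by (auto simp: s' same_def)
  have u: "s' lab x < n \<and> same (s' lab x) x" if "x < n" for x
    using last_index_ex[of x n "\<lambda>y. same y x" x] that l by (simp add: same_def)
  have eq: "s' lab x = s' lab y \<longleftrightarrow> same x y" if "x < n" "y < n" for x y
  proof
    assume "s' lab x = s' lab y"
    then show "same x y" using u[OF that(1)] u[OF that(2)] by (simp add: same_def)
  next
    assume "same x y"
    then show "s' lab x = s' lab y"
      using l(1) that last_index_cong[of x n "\<lambda>z. same z x" "\<lambda>z. same z y" x y] by (simp add: same_def)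
  qed
  have "coloured_poset n le (s' lab) col (set ts)"
  proof unfold_locales
    fix x y assume "x < n" "y < n" "s' lab x = s' lab y"
    then show "le x y \<or> le y x"
      using eq[of x y] r2 sp.root_chain[OF M, of x y] le_refl by (auto simp: same_def)
  next
    fix x y k assume *: "x < n" "y < n" "s' lab x = s' lab y" "k \<in> set ts"
    then have e: "colour_class x = colour_class y" using eq[of x y] cl by (simp add: same_def)
    from \<open>k \<in> set ts\<close> obtain j where j: "j < L" "ts ! j = k" by (auto simp: in_set_conv_nth)
    \<comment> \<open>A colour among the tokens has a class below \<open>L\<close>, and the token
      there is the colour itself; the default class \<open>L\<close> is left to colours that are not
      tokens.\<close>
    have "col y = k" if "col x = k" and e: "colour_class x = colour_class y" for x y
    proof -
      have "ts ! colour_class x = col x" "colour_class x < L"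
        using last_index_ex[of j L "\<lambda>p. ts ! p = col x" L] j that by auto
      moreover have "ts ! colour_class y = col y \<or> colour_class y = L"
        using last_index_ex[of _ L "\<lambda>p. ts ! p = col y" L] last_index_none[of L "\<lambda>p. ts ! p = col y" L] by blast
      ultimately show ?thesis using that by auto
    qed
    from this[of x y] this[of y x] e show "col x = k \<longleftrightarrow> col y = k" by auto
  qed (use le_refl le_antisym le_trans in blast)+
  moreover have "card (s' lab ` {..<n}) \<le> k * Suc L"
  proof -
    have comp_com: "colour_class x \<le> L" for x
      using last_index_ex[of _ L "\<lambda>p. ts ! p = col x" L] last_index_none[of L "\<lambda>p. ts ! p = col x" L]
      by (metis less_or_eq_imp_le)
    let ?f = "\<lambda>v. (s2 rt v, s2 ccl v)"
    \<comment> \<open>A label is itself a member of its class, so its own root and colour class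
      identify it.\<close>
    have "inj_on ?f (s' lab ` {..<n})"
    proof (rule inj_onI)
      fix v v' assume "v \<in> s' lab ` {..<n}" "v' \<in> s' lab ` {..<n}" "?f v = ?f v'"
      then obtain x x' where "x < n" "x' < n" "v = s' lab x" "v' = s' lab x'" by auto
      then show "v = v'" using u[of x] u[of x'] eq[of x x'] \<open>?f v = ?f v'\<close> by (simp add: same_def)
    qed
    moreover have "?f ` (s' lab ` {..<n}) \<subseteq> sp.root (s pv) ` {..<n} \<times> {..L}"
    proof
      fix v assume "v \<in> ?f ` (s' lab ` {..<n})"
      then obtain x where "x < n" "v = ?f (s' lab x)" by auto
      then show "v \<in> sp.root (s pv) ` {..<n} \<times> {..L}" using u[of x] r2 cl(1) comp_com by auto
    qed
    ultimately have "card (s' lab ` {..<n}) \<le> card (sp.root (s pv) ` {..<n} \<times> {..L})"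
      by (rule card_inj_on_le) simp
    then show ?thesis using c by (simp add: card_cartesian_product) (metis mult_le_mono1 mult_Suc_right order_trans)
  qed
  ultimately show ?thesis using u r(2) cl(2) l(2) unfolding good_labels_def by (simp add: s1_def s2_def)
qed

section \<open>Tables of pair types\<close>

lemma index_inj:
  assumes "y < n" "y' < n" "n * x + y = n * x' + y'"
  shows "x = x' \<and> y = y'"
proof -
  have "(n * x + y) div n = x" "(n * x' + y') div n = x'" using assms(1,2) by simp_all
  then have "x = x'" using assms(3) by simp
  then show ?thesis using assms(3) by simp
qed

lemma index_less_Suc:
  assumes "x < n" "y < n" "x' < n" "y' < n"
  shows "n * x' + y' < Suc (n * x + y) \<longleftrightarrow> n * x' + y' < n * x + y \<or> (x' = x \<and> y' = y)"
proof -
  have "x = x' \<and> y = y'" if "n * x' + y' = n * x + y"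
    using that assms index_inj by metis
  then show ?thesis by (auto simp: less_Suc_eq)
qed

definition "typed u q T \<longleftrightarrow> (\<forall>x<n. \<forall>y<n. \<forall>x'<n. \<forall>y'<n.
   (T (n * x + y) = (T (n * x' + y') :: nat)) = labelled_poset.eqv n le u q x y x' y')"

lemma typed_eq:
  "typed u q T \<Longrightarrow> x < n \<Longrightarrow> y < n \<Longrightarrow> x' < n \<Longrightarrow> y' < n \<Longrightarrow>
     T (n * x + y) = T (n * x' + y') \<longleftrightarrow> labelled_poset.eqv n le u q x y x' y'"
  by (simp add: typed_def)

lemma good_labels_poset: "good_labels c u \<Longrightarrow> labelled_poset n le u"
  by (simp add: good_labels_def coloured_poset_def)

text \<open>A loop nest over all pairs \<open>(x, y)\<close> visits the indices \<open>n * x + y\<close> in increasing order.\<close>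

lemma pairs_rule:
  assumes b: "base s" and init: "I 0 s"
    and written: "written c \<inter> {nV, row, fb, lV, x1, y1} = {}"
    and stable: "\<And>i t v. I i t \<Longrightarrow> I i (upd t x1 0 v)" "\<And>i t v. I i t \<Longrightarrow> I i (upd t y1 0 v)"
    and step: "\<And>x y t. x < n \<Longrightarrow> y < n \<Longrightarrow> base t \<Longrightarrow> t x1 0 = x \<Longrightarrow> t y1 0 = y \<Longrightarrow>
      (\<And>j. j \<notin> {x1, y1} \<union> written c \<Longrightarrow> t j = s j) \<Longrightarrow> I (n * x + y) t \<Longrightarrow>
      I (Suc (n * x + y)) (exe w c t) \<and> bounded w B Q c t"
  shows "I (n * n) (exe w (For True x1 (V nV) (For True y1 (V nV) c)) s) \<and>
    bounded w B Q (For True x1 (V nV) (For True y1 (V nV) c)) s"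
proof (rule For_rule[where I = "\<lambda>x. I (n * x)"])
  show "ev w s (V nV) = n" using b base_n by simp
  show "n \<le> (if True then B else Q)" using n_le_B by simp
  show "I (n * 0) s" using init by simp
  show "I (n * i) (upd t x1 0 v)" if "I (n * i) t" for i t v using stable(1)[OF that] .
  fix x t
  assume x: "x < n" and fr: "\<And>j. j \<notin> insert x1 (written (For True y1 (V nV) c)) \<Longrightarrow> t j = s j"
    and tx: "t x1 0 = x" and I: "I (n * x) t"
  have bt: "base t" using b by (rule base_cong) (use written in \<open>auto intro!: fr\<close>)
  have "I (n * x + n) (exe w (For True y1 (V nV) c) t) \<and> bounded w B Q (For True y1 (V nV) c) t"
  proof (rule For_rule[where I = "\<lambda>y. I (n * x + y)"])
    show "ev w t (V nV) = n" using bt base_n by simp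
    show "n \<le> (if True then B else Q)" using n_le_B by simp
    show "I (n * x + 0) t" using I by simp
    show "I (n * x + i) (upd t y1 0 v)" if "I (n * x + i) t" for i t v using stable(2)[OF that] .
    fix y t'
    assume y: "y < n" and fr': "\<And>j. j \<notin> insert y1 (written c) \<Longrightarrow> t' j = t j" and ty: "t' y1 0 = y"
      and I': "I (n * x + y) t'"
    have "base t'" using bt by (rule base_cong) (use written in \<open>auto intro!: fr'\<close>)
    moreover have "t' x1 0 = x" using fr'[of x1] written tx by auto
    ultimately show "I (n * x + Suc y) (exe w c t') \<and> bounded w B Q c t'"
      using step[of x y t'] x y ty I' fr fr' by auto
  qed
  then show "I (n * Suc x) (exe w (For True y1 (V nV) c) t) \<and> bounded w B Q (For True y1 (V nV) c) t"
    by (simp add: add.commute)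
qed

lemma types0_correct:
  assumes b: "base s" and u: "good_labels c (s lab)"
  shows "typed (s lab) 0 (exe w types0 s TT) \<and> bounded w B Q types0 s"
proof -
  let ?u = "s lab"
  interpret lp: labelled_poset n le ?u using good_labels_poset[OF u] .
  have un: "?u x < n" if "x < n" for x using u that by (simp add: good_labels_def)
  let ?code = "\<lambda>x y. 4 * (n * ?u x + ?u y) + 2 * (if le y x then 1 else 0) + (if le x y then 1 else 0 :: nat)"
  let ?I = "\<lambda>m t. \<forall>x<n. \<forall>y<n. n * x + y < m \<longrightarrow> t TT (n * x + y) = ?code x y"
  have "?I (n * n) (exe w types0 s) \<and> bounded w B Q types0 s"
    unfolding types0_def
  proof (rule pairs_rule[where I = ?I])
    show "?I i (upd t x1 0 v)" if "?I i t" for i t v using that by (simp add: upd_apply)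
    show "?I i (upd t y1 0 v)" if "?I i t" for i t v using that by (simp add: upd_apply)
    let ?c1 = "cv ::= pairE (Arr lab (V x1)) (Arr lab (V y1))"
    let ?c2 = "cv ::= Plus (Plus (V cv) (V cv)) (leE (V y1) (V x1))"
    let ?c3 = "Asg TT (pairE (V x1) (V y1)) (Plus (Plus (V cv) (V cv)) (leE (V x1) (V y1)))"
    fix x y t
    assume x: "x < n" "y < n" and bt: "base t" and tx: "t x1 0 = x" "t y1 0 = y"
      and fr: "\<And>j. j \<notin> {x1, y1} \<union> written (?c1;; ?c2;; ?c3) \<Longrightarrow> t j = s j" and I: "?I (n * x + y) t"
    have lab: "t lab = ?u" by (rule fr) simp
    define t2 where "t2 = exe w ?c1 t"
    have t2: "t2 = upd t cv 0 (n * ?u x + ?u y)"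
      using ev_pairE[OF bt, of "Arr lab (V x1)" "Arr lab (V y1)"] tx x un[OF x(1)] lab by (simp add: t2_def)
    have b2: "base t2" using bt t2 by (simp add: base_upd)
    define t3 where "t3 = exe w ?c2 t2"
    have t3: "t3 = upd t2 cv 0 (n * ?u x + ?u y + (n * ?u x + ?u y) + (if le y x then 1 else 0))"
      using ev_leE[OF b2, of "V y1" "V x1"] tx x by (simp add: t3_def t2 upd_apply)
    have b3: "base t3" using b2 t3 by (simp add: base_upd)
    let ?v = "ev w t3 (Plus (Plus (V cv) (V cv)) (leE (V x1) (V y1)))"
    have "?v = ?code x y"
      using ev_leE[OF b3, of "V x1" "V y1"] tx x by (simp add: t3 t2 upd_apply)
    moreover have "exe w ?c3 t3 = upd t3 TT (n * x + y) ?v"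
      using ev_pairE[OF b3, of "V x1" "V y1"] tx x by (simp add: t3 t2 upd_apply)
    ultimately have t4: "exe w ?c3 t3 = upd t3 TT (n * x + y) (?code x y)" by metis
    have "exe w (?c1;; ?c2;; ?c3) t = upd t3 TT (n * x + y) (?code x y)"
      using t4 unfolding exe.simps(3) t3_def t2_def .
    moreover have "?I (Suc (n * x + y)) (upd t3 TT (n * x + y) (?code x y))"
      using I index_less_Suc[OF x] by (simp add: t3 t2 upd_apply)
    ultimately show "?I (Suc (n * x + y)) (exe w (?c1;; ?c2;; ?c3) t) \<and> bounded w B Q (?c1;; ?c2;; ?c3) t"
      by simp
  qed (use b in auto)
  then have T: "exe w types0 s TT (n * x + y) = ?code x y" if "x < n" "y < n" for x y
    using that pair_less by blast
  have inj: "?code x y = ?code x' y' \<longleftrightarrow> lp.eqv 0 x y x' y'" if "x < n" "y < n" "x' < n" "y' < n" for x y x' y'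
  proof
    assume e: "?code x y = ?code x' y'"
    \<comment> \<open>The two truth values contribute less than 4, so division recovers the pair of
      labels.\<close>
    have "?code x y div 4 = n * ?u x + ?u y" "?code x' y' div 4 = n * ?u x' + ?u y'" by auto
    then have "n * ?u x + ?u y = n * ?u x' + ?u y'" by (simp only: e)
    then have "?u x = ?u x' \<and> ?u y = ?u y'" using index_inj un that by blast
    moreover from this have "2 * (if le y x then 1 else 0) + (if le x y then 1 else 0 :: nat) =
        2 * (if le y' x' then 1 else 0) + (if le x' y' then 1 else 0)" using e by simp
    then have "le x y = le x' y' \<and> le y x = le y' x'" by (simp split: if_splits)
    ultimately show "lp.eqv 0 x y x' y'" by simp
  qed auto
  show ?thesis
    using \<open>?I (n * n) (exe w types0 s) \<and> bounded w B Q types0 s\<close> T inj unfolding typed_def by simp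
qed

text \<open>\<open>ab\<close> asks that the arguments do not depend on the arrays overwritten by the
  loops, so that one lemma covers both calls in \<open>same_type\<close>.\<close>

lemma incl_correct:
  assumes b: "base t"
    and ab: "\<And>t'. (\<And>k. k \<notin> {z1, v1, hit, okv} \<Longrightarrow> t' k = t k) \<Longrightarrow>
      ev w t' a = a' \<and> ev w t' b = b' \<and> ev w t' c = c' \<and> ev w t' d = d'"
    and less: "a' < n" "c' < n"
  shows "exe w (incl a b c d) t okv 0 =
     (if \<forall>z<n. \<exists>v<n. t TT (n * a' + z) = t TT (n * c' + v) \<and> t TT (n * z + b') = t TT (n * v + d')
      then t okv 0 else 0) \<and> bounded w B Q (incl a b c d) t"
proof -
  define P where "P = (\<lambda>z v. t TT (n * a' + z) = t TT (n * c' + v) \<and> t TT (n * z + b') = t TT (n * v + d'))"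
  let ?test = "andE (eqE (Arr TT (pairE a (V z1))) (Arr TT (pairE c (V v1))))
                  (eqE (Arr TT (pairE (V z1) b)) (Arr TT (pairE (V v1) d)))"
  let ?in = "Cond ?test (hit ::= N 1) Skip"
  let ?lp = "For True v1 (V nV) ?in"
  let ?body = "hit ::= N 0;; ?lp;; Cond (V hit) Skip (okv ::= N 0)"
  let ?I = "\<lambda>m t'. t' okv 0 = (if \<forall>z<m. \<exists>v<n. P z v then t okv 0 else 0)"
  have "?I n (exe w (incl a b c d) t) \<and> bounded w B Q (incl a b c d) t"
    unfolding incl_def
  proof (rule For_rule[where I = ?I])
    show "ev w t (V nV) = n" using b base_n by simp
    show "n \<le> (if True then B else Q)" using n_le_B by simp
    show "?I i (upd t' z1 0 v)" if "?I i t'" for i t' v using that by (simp add: upd_apply)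
    show "?I 0 t" by simp
    fix z t'
    assume z: "z < n" and fr: "\<And>j. j \<notin> insert z1 (written ?body) \<Longrightarrow> t' j = t j" and tz: "t' z1 0 = z" and I: "?I z t'"
    define t2 where "t2 = exe w (hit ::= N 0) t'"
    have f2: "t2 k = t k" if "k \<notin> {z1, v1, hit, okv}" for k using fr that by (simp add: t2_def upd_apply)
    let ?J = "\<lambda>m t'. t' hit 0 \<noteq> 0 \<longleftrightarrow> (\<exists>v<m. P z v)"
    have "?J n (exe w ?lp t2) \<and> bounded w B Q ?lp t2"
    proof (rule For_rule[where I = ?J])
      show "ev w t2 (V nV) = n" using b base_n f2 by simp
      show "n \<le> (if True then B else Q)" using n_le_B by simp
      show "?J i (upd t' v1 0 v)" if "?J i t'" for i t' v using that by (simp add: upd_apply)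
      show "?J 0 t2" by (simp add: t2_def upd_apply)
      fix v t''
      assume v: "v < n" and fr'': "\<And>j. j \<notin> insert v1 (written ?in) \<Longrightarrow> t'' j = t2 j" and tv: "t'' v1 0 = v" and J: "?J v t''"
      have f3: "t'' k = t k" if "k \<notin> {z1, v1, hit, okv}" for k using fr'' f2 that by simp
      have b3: "base t''" using b by (rule base_cong) (simp_all add: f3)
      have "t'' z1 0 = z" using fr''[of z1] tz by (simp add: t2_def upd_apply)
      then have "ev w t'' ?test \<noteq> 0 \<longleftrightarrow> P z v"
        using ab[of t'', OF f3] ev_pairE[OF b3, of a "V z1"] ev_pairE[OF b3, of c "V v1"]
          ev_pairE[OF b3, of "V z1" b] ev_pairE[OF b3, of "V v1" d] f3[of TT] less tv z v
        by (simp add: P_def)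
      then show "?J (Suc v) (exe w ?in t'') \<and> bounded w B Q ?in t''"
        using J by (auto simp: upd_apply less_Suc_eq)
    qed
    moreover have "exe w ?lp t2 okv = t' okv" using exe_frame[of okv ?lp w t2] by (simp add: t2_def upd_apply)
    moreover define t3 where "t3 = exe w ?lp t2"
    moreover have "exe w ?body t' = (if t3 hit 0 \<noteq> 0 then t3 else upd t3 okv 0 0)" "bounded w B Q ?body t' = bounded w B Q ?lp t2"
      by (simp_all add: t3_def t2_def)
    ultimately show "?I (Suc z) (exe w ?body t') \<and> bounded w B Q ?body t'"
      using I by (auto simp: upd_apply less_Suc_eq)
  qed
  then show ?thesis by (simp add: P_def)
qed

lemma same_type_correct:
  assumes b: "base t" and u: "labelled_poset n le u" and T: "typed u q (t TT)"
    and x: "t x1 0 < n" "t y1 0 < n" and r: "t rx (t r1 0) < n" "t ry (t r1 0) < n"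
  shows "(exe w same_type t okv 0 \<noteq> 0 \<longleftrightarrow>
      labelled_poset.eqv n le u (Suc q) (t x1 0) (t y1 0) (t rx (t r1 0)) (t ry (t r1 0)))
    \<and> bounded w B Q same_type t"
proof -
  interpret lp: labelled_poset n le u using u .
  let ?x = "t x1 0" and ?y = "t y1 0" and ?x' = "t rx (t r1 0)" and ?y' = "t ry (t r1 0)"
  let ?i1 = "incl (V x1) (V y1) (Arr rx (V r1)) (Arr ry (V r1))"
  let ?i2 = "incl (Arr rx (V r1)) (Arr ry (V r1)) (V x1) (V y1)"
  define t2 where "t2 = exe w (okv ::= N 1) t"
  define t3 where "t3 = exe w ?i1 t2"
  have f2: "t2 k = t k" if "k \<noteq> okv" for k using that by (simp add: t2_def upd_apply)
  have f3: "t3 k = t k" if "k \<notin> {z1, v1, hit, okv}" for k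
    using exe_frame[of k ?i1 w t2] that f2 by (simp add: t3_def incl_def)
  have b2: "base t2" "base t3" using b by (auto intro: base_cong[of t] simp: f2 f3)
  have 1: "t3 okv 0 = (if \<forall>z<n. \<exists>v<n. t2 TT (n * ?x + z) = t2 TT (n * ?x' + v) \<and> t2 TT (n * z + ?y) = t2 TT (n * v + ?y')
      then t2 okv 0 else 0) \<and> bounded w B Q ?i1 t2"
    unfolding t3_def by (rule incl_correct[OF b2(1)]) (use x r f2 in auto)
  have 2: "exe w ?i2 t3 okv 0 = (if \<forall>z<n. \<exists>v<n. t3 TT (n * ?x' + z) = t3 TT (n * ?x + v) \<and> t3 TT (n * z + ?y') = t3 TT (n * v + ?y)
      then t3 okv 0 else 0) \<and> bounded w B Q ?i2 t3"
    by (rule incl_correct[OF b2(2)]) (use x r f3 in auto)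
  have E: "t TT (n * a + b) = t TT (n * c + d) \<longleftrightarrow> lp.eqv q a b c d"
    if "a < n" "b < n" "c < n" "d < n" for a b c d using typed_eq[OF T that] .
  have "lp.eqv (Suc q) ?x ?y ?x' ?y' \<longleftrightarrow>
     (\<forall>z<n. \<exists>v<n. t TT (n * ?x + z) = t TT (n * ?x' + v) \<and> t TT (n * z + ?y) = t TT (n * v + ?y')) \<and>
     (\<forall>z<n. \<exists>v<n. t TT (n * ?x' + z) = t TT (n * ?x + v) \<and> t TT (n * z + ?y') = t TT (n * v + ?y))"
  proof -
    have a: "lp.eqv q ?x z ?x' v \<and> lp.eqv q z ?y v ?y' \<longleftrightarrow>
        t TT (n * ?x + z) = t TT (n * ?x' + v) \<and> t TT (n * z + ?y) = t TT (n * v + ?y')"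
      if "z < n" "v < n" for z v using E x r that by simp
    have b: "lp.eqv q ?x v ?x' z \<and> lp.eqv q v ?y z ?y' \<longleftrightarrow>
        t TT (n * ?x' + z) = t TT (n * ?x + v) \<and> t TT (n * z + ?y') = t TT (n * v + ?y)"
      if "z < n" "v < n" for z v using E[symmetric] x r that by auto
    show ?thesis unfolding lp.eqv.simps(2)
      by (rule arg_cong2[where f = "(\<and>)"]; rule all_ex_cong) (simp_all only: a b, auto)
  qed
  moreover have "exe w same_type t = exe w ?i2 t3" "bounded w B Q same_type t \<longleftrightarrow> bounded w B Q ?i1 t2 \<and> bounded w B Q ?i2 t3"
    by (simp_all add: same_type_def t2_def t3_def)
  moreover have "t2 okv 0 = 1" by (simp add: t2_def upd_apply)
  ultimately show ?thesis using 1 2 f2[of TT] f3[of TT] by auto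
qed

text \<open>State of a round after the first \<open>m\<close> pairs. Inequivalence of the
  representatives bounds \<open>k\<close>, and with it the loop over them.\<close>

definition "reps u q T k RX RY m \<longleftrightarrow>
  (\<forall>r<(k::nat). RX r < n \<and> RY r < n) \<and>
  (\<forall>r<k. \<forall>r'<k. r < r' \<longrightarrow> \<not> labelled_poset.eqv n le u q (RX r) (RY r) (RX r') (RY r')) \<and>
  (\<forall>x<n. \<forall>y<n. n * x + y < m \<longrightarrow> T (n * x + y) < k \<and>
     labelled_poset.eqv n le u q x y (RX (T (n * x + y))) (RY (T (n * x + y))))"

lemma reps_bound:
  assumes "good_labels c u" "reps u q T k RX RY m"
  shows "k \<le> class_bound c q"
proof -
  interpret lp: labelled_poset n le u using good_labels_poset[OF assms(1)] .
  show ?thesis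
    by (rule lp.inequivalent_pairs_bound[of c k RX RY q])
      (use assms in \<open>auto simp: good_labels_def reps_def\<close>)
qed

lemma reps_typed:
  assumes u: "labelled_poset n le u" and R: "reps u q T k RX RY (n * n)"
    and T': "\<And>x y. x < n \<Longrightarrow> y < n \<Longrightarrow> T' (n * x + y) = T (n * x + y)"
  shows "typed u q T'"
proof -
  interpret lp: labelled_poset n le u using u .
  show ?thesis unfolding typed_def
  proof (intro allI impI)
    fix x y x' y' assume xy: "x < n" "y < n" "x' < n" "y' < n"
    let ?r = "T (n * x + y)" and ?r' = "T (n * x' + y')"
    have r: "?r < k" "lp.eqv q x y (RX ?r) (RY ?r)" "?r' < k" "lp.eqv q x' y' (RX ?r') (RY ?r')"
      using R xy pair_less unfolding reps_def by blast+
    have "?r = ?r'" if "lp.eqv q x y x' y'"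
    proof -
      have "lp.eqv q (RX ?r) (RY ?r) (RX ?r') (RY ?r')"
        using lp.eqv_trans[OF lp.eqv_trans[OF lp.eqv_sym[OF r(2)] that] r(4)] .
      then show ?thesis using R r lp.eqv_sym unfolding reps_def by (meson linorder_neqE_nat)
    qed
    moreover have "lp.eqv q x y x' y'" if "?r = ?r'"
      using lp.eqv_trans[OF r(2)] lp.eqv_sym[OF r(4)] that by simp
    ultimately show "(T' (n * x + y) = T' (n * x' + y')) = lp.eqv q x y x' y'" using T' xy by auto
  qed
qed

lemma reps_empty: "reps u q T 0 RX RY 0"
  by (simp add: reps_def)

lemma reps_old:
  assumes R: "reps u q T k RX RY (n * x + y)" and x: "x < n" "y < n" and r: "r < k"
    and e: "labelled_poset.eqv n le u q x y (RX r) (RY r)"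
  shows "reps u q (T(n * x + y := r)) k RX RY (Suc (n * x + y))"
  unfolding reps_def
proof (intro conjI allI impI)
  fix x' y' assume "x' < n" "y' < n" "n * x' + y' < Suc (n * x + y)"
  then have "n * x' + y' < n * x + y \<or> (x' = x \<and> y' = y)" using index_less_Suc[OF x] by blast
  then show "(T(n * x + y := r)) (n * x' + y') < k"
    "labelled_poset.eqv n le u q x' y' (RX ((T(n * x + y := r)) (n * x' + y'))) (RY ((T(n * x + y := r)) (n * x' + y')))"
    using R \<open>x' < n\<close> \<open>y' < n\<close> r e unfolding reps_def by auto
qed (use R in \<open>auto simp: reps_def\<close>)

lemma reps_new:
  assumes u: "labelled_poset n le u" and R: "reps u q T k RX RY (n * x + y)" and x: "x < n" "y < n"
    and e: "\<And>r. r < k \<Longrightarrow> \<not> labelled_poset.eqv n le u q x y (RX r) (RY r)"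
  shows "reps u q (T(n * x + y := k)) (Suc k) (RX(k := x)) (RY(k := y)) (Suc (n * x + y))"
proof -
  interpret lp: labelled_poset n le u using u .
  show ?thesis unfolding reps_def
  proof (intro conjI allI impI)
    fix x' y' assume "x' < n" "y' < n" "n * x' + y' < Suc (n * x + y)"
    then have "n * x' + y' < n * x + y \<or> (x' = x \<and> y' = y)" using index_less_Suc[OF x] by blast
    then consider "n * x' + y' < n * x + y" | "x' = x" "y' = y" by blast
    then have "(T(n * x + y := k)) (n * x' + y') < Suc k \<and>
      lp.eqv q x' y' ((RX(k := x)) ((T(n * x + y := k)) (n * x' + y'))) ((RY(k := y)) ((T(n * x + y := k)) (n * x' + y')))"
    proof cases
      case 1
      then have "T (n * x' + y') < k \<and> lp.eqv q x' y' (RX (T (n * x' + y'))) (RY (T (n * x' + y')))"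
        using R \<open>x' < n\<close> \<open>y' < n\<close> unfolding reps_def by blast
      then show ?thesis using 1 by auto
    next
      case 2
      then show ?thesis using lp.eqv_refl by simp
    qed
    then show "(T(n * x + y := k)) (n * x' + y') < Suc k"
      "lp.eqv q x' y' ((RX(k := x)) ((T(n * x + y := k)) (n * x' + y'))) ((RY(k := y)) ((T(n * x + y := k)) (n * x' + y')))"
      by blast+
  next
    fix r r' assume *: "r < Suc k" "r' < Suc k" "r < r'"
    show "\<not> lp.eqv q ((RX(k := x)) r) ((RY(k := y)) r) ((RX(k := x)) r') ((RY(k := y)) r')"
      using * R e[of r] lp.eqv_sym unfolding reps_def by (cases "r' = k") auto
  qed (use R x in \<open>auto simp: reps_def less_Suc_eq\<close>)
qed

lemma classify_correct:
  assumes b: "base t" and u: "good_labels c u" and T: "typed u q (t TT)" and Q: "class_bound c (Suc q) \<le> Q"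
    and x: "t x1 0 < n" "t y1 0 < n"
  defines "m \<equiv> n * t x1 0 + t y1 0"
  assumes R: "reps u (Suc q) (t TN) (t kn 0) (t rx) (t ry) m"
  defines "t' \<equiv> exe w classify t"
  shows "reps u (Suc q) (t' TN) (t' kn 0) (t' rx) (t' ry) (Suc m) \<and> bounded w B Q classify t"
proof -
  note u' = good_labels_poset[OF u]
  interpret lp: labelled_poset n le u using u' .
  let ?x = "t x1 0" and ?y = "t y1 0"
  let ?in = "Cond (V fnd) Skip
    (same_type;; Cond (V okv) (fnd ::= N 1;; Asg TN (pairE (V x1) (V y1)) (V r1)) Skip)"
  let ?lp = "For False r1 (V kn) ?in"
  define t2 where "t2 = exe w (fnd ::= N 0) t"
  define t3 where "t3 = exe w ?lp t2"
  let ?E = "\<lambda>r. lp.eqv (Suc q) ?x ?y (t rx r) (t ry r)"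
  have f3: "t3 k = t k" if "k \<notin> {fnd, r1, okv, z1, v1, hit, TN}" for k
    using exe_frame[of k ?lp w t2] that by (simp add: t3_def same_type_def incl_def t2_def upd_apply)
  let ?I = "\<lambda>r t'. (t' fnd 0 = 0 \<and> t' TN = t TN \<and> (\<forall>i<r. \<not> ?E i)) \<or>
      (t' fnd 0 \<noteq> 0 \<and> (\<exists>i<r. ?E i \<and> t' TN = (t TN)(m := i)))"
  have I: "?I (t kn 0) t3 \<and> bounded w B Q ?lp t2" unfolding t3_def
  proof (rule For_rule[where I = ?I])
    show "ev w t2 (V kn) = t kn 0" by (simp add: t2_def upd_apply)
    show "t kn 0 \<le> (if False then B else Q)" using reps_bound[OF u R] Q by simp
    show "?I 0 t2" by (simp add: t2_def upd_apply)
    show "?I i (upd t' r1 0 v)" if "?I i t'" for i t' v using that by (simp add: upd_apply)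
    fix r t'
    assume r: "r < t kn 0" and fr: "\<And>j. j \<notin> insert r1 (written ?in) \<Longrightarrow> t' j = t2 j" and tr: "t' r1 0 = r" and I: "?I r t'"
    have f: "t' k = t k" if "k \<notin> {fnd, r1, okv, z1, v1, hit, TN}" for k
      using fr[of k] that by (simp add: same_type_def incl_def t2_def upd_apply)
    show "?I (Suc r) (exe w ?in t') \<and> bounded w B Q ?in t'"
    proof (cases "t' fnd 0 = 0")
      case False
      then show ?thesis using I by (auto simp: less_Suc_eq)
    next
      case True
      have b': "base t'" using b by (rule base_cong) (simp_all add: f)
      have rr: "t rx r < n" "t ry r < n" using R r unfolding reps_def by blast+
      define t4 where "t4 = exe w same_type t'"
      have f4: "t4 k = t' k" if "k \<notin> {okv, z1, v1, hit}" for k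
        unfolding t4_def by (rule exe_frame) (use that in \<open>simp add: same_type_def incl_def\<close>)
      have b4: "base t4" using b' by (rule base_cong) (simp_all add: f4)
      have S: "(t4 okv 0 \<noteq> 0 \<longleftrightarrow> ?E r) \<and> bounded w B Q same_type t'"
        using same_type_correct[OF b' u', of q] T x rr f tr unfolding t4_def by simp
      have p: "exe w ?in t' = (if t4 okv 0 \<noteq> 0 then upd (upd t4 fnd 0 1) TN m r else t4)"
        using True ev_pairE[of "upd t4 fnd 0 1" "V x1" "V y1"] b4 x tr f f4
        by (simp add: t4_def[symmetric] base_upd upd_apply m_def)
      show ?thesis
        unfolding p using S I True f4 by (auto simp: upd_apply less_Suc_eq t4_def[symmetric])
    qed
  qed
  have e: "t' = exe w (Cond (V fnd) Skip
    (Asg rx (V kn) (V x1);; Asg ry (V kn) (V y1);; Asg TN (pairE (V x1) (V y1)) (V kn);; kn ::= sucE (V kn))) t3"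
    "bounded w B Q classify t = bounded w B Q ?lp t2"
    by (simp_all add: t'_def classify_def t3_def t2_def)
  show ?thesis
  proof (cases "t3 fnd 0 = 0")
    case False
    then have t': "t' = t3" using e by simp
    obtain i where i: "i < t kn 0" "?E i" "t3 TN = (t TN)(m := i)" using I False by auto
    show ?thesis using reps_old[OF R[unfolded m_def] x i(1,2)] e(2) I f3 i(3) unfolding t' m_def by simp
  next
    case True
    have b3: "base t3" using b by (rule base_cong) (simp_all add: f3)
    let ?k = "t kn 0"
    have N: "t3 TN = t TN" "\<And>i. i < ?k \<Longrightarrow> \<not> ?E i" using I True by auto
    have "ev w (upd (upd t3 rx ?k ?x) ry ?k ?y) (pairE (V x1) (V y1)) = m"
      using ev_pairE[of "upd (upd t3 rx ?k ?x) ry ?k ?y" "V x1" "V y1"] b3 x f3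
      by (simp add: base_upd upd_apply m_def)
    then have "t' = upd (upd (upd (upd t3 rx ?k ?x) ry ?k ?y) TN m ?k) kn 0 (Suc ?k)"
      using e(1) True f3 by (simp add: upd_apply)
    then show ?thesis
      using reps_new[OF u' R[unfolded m_def] x N(2)] e(2) I f3 N(1) by (simp add: upd_apply m_def)
  qed
qed

lemma refine_correct:
  assumes b: "base s" and u: "good_labels c (s lab)" and T: "typed (s lab) 0 (s TT)"
    and Q: "\<And>q. q \<le> L \<Longrightarrow> class_bound c q \<le> Q"
  defines "s' \<equiv> exe w refine s"
  shows "typed (s lab) L (s' TT) \<and> (0 < L \<longrightarrow> (\<forall>x<n. \<forall>y<n. s' TT (n * x + y) < class_bound c L)) \<and> bounded w B Q refine s"
proof -
  let ?u = "s lab"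
  note u' = good_labels_poset[OF u]
  let ?c1 = "kn ::= N 0"
  let ?c2 = "For True x1 (V nV) (For True y1 (V nV) classify)"
  let ?d = "Asg TT (pairE (V x1) (V y1)) (Arr TN (pairE (V x1) (V y1)))"
  let ?c3 = "For True x1 (V nV) (For True y1 (V nV) ?d)"
  \<comment> \<open>The initial codes contain element numbers; only after the first round are the
    entries bounded in terms of \<open>c\<close>, hence the condition \<open>0 < q\<close>.\<close>
  let ?I = "\<lambda>q t. typed ?u q (t TT) \<and> (0 < q \<longrightarrow> (\<forall>x<n. \<forall>y<n. t TT (n * x + y) < class_bound c q))"
  have "?I L s' \<and> bounded w B Q refine s"
    unfolding s'_def refine_def
  proof (rule For_rule[where I = ?I])
    show "ev w s (V lV) = L" using b base_L by simp
    show "L \<le> (if False then B else Q)" using L_le_Q by simp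
    show "?I 0 s" using T by simp
    show "?I i (upd t qr 0 v)" if "?I i t" for i t v using that by (simp add: upd_apply)
    fix q t
    assume q: "q < L" and fr: "\<And>j. j \<notin> insert qr (written (?c1;; ?c2;; ?c3)) \<Longrightarrow> t j = s j" and I: "?I q t"
    have wrc: "written classify = {fnd, r1, okv, z1, v1, hit, TN, rx, ry, kn}"
      by (auto simp: classify_def same_type_def incl_def)
    have bt: "base t" using b by (rule base_cong) (auto intro!: fr simp: wrc)
    have lab: "t lab = ?u" by (rule fr) (simp add: wrc)
    define t1 where "t1 = exe w ?c1 t"
    have t1: "t1 = upd t kn 0 0" by (simp add: t1_def)
    define t2 where "t2 = exe w ?c2 t1"
    let ?J = "\<lambda>m t'. reps ?u (Suc q) (t' TN) (t' kn 0) (t' rx) (t' ry) m"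
    have 2: "?J (n * n) t2 \<and> bounded w B Q ?c2 t1"
      unfolding t2_def
    proof (rule pairs_rule[where I = ?J])
      show "base t1" using bt by (simp add: t1 base_upd)
      show "?J 0 t1" using reps_empty by (simp add: t1 upd_apply)
      show "written classify \<inter> {nV, row, fb, lV, x1, y1} = {}" by (simp add: wrc)
      show "?J i (upd t' x1 0 v)" if "?J i t'" for i t' v using that by (simp add: upd_apply)
      show "?J i (upd t' y1 0 v)" if "?J i t'" for i t' v using that by (simp add: upd_apply)
      fix x y t'
      assume x: "x < n" "y < n" and b': "base t'" and tx: "t' x1 0 = x" "t' y1 0 = y"
        and fr': "\<And>j. j \<notin> {x1, y1} \<union> written classify \<Longrightarrow> t' j = t1 j" and J: "?J (n * x + y) t'"
      have "t' TT = t TT" using fr'[of TT] by (simp add: wrc t1 upd_apply)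
      then show "?J (Suc (n * x + y)) (exe w classify t') \<and> bounded w B Q classify t'"
        using classify_correct[OF b' u, of q] I Q[of "Suc q"] q tx x J by simp
    qed
    have f2: "t2 k = t k" if "k \<notin> {x1, y1} \<union> written classify" for k
      using exe_frame[of k ?c2 w t1] that by (simp add: t2_def t1 upd_apply wrc)
    have b2: "base t2" using bt by (rule base_cong) (simp_all add: f2 wrc)
    let ?K = "\<lambda>m t'. \<forall>x<n. \<forall>y<n. n * x + y < m \<longrightarrow> t' TT (n * x + y) = t2 TN (n * x + y)"
    define t3 where "t3 = exe w ?c3 t2"
    have 3: "?K (n * n) t3 \<and> bounded w B Q ?c3 t2"
      unfolding t3_def
    proof (rule pairs_rule[where I = ?K])
      show "base t2" by (rule b2)
      show "?K i (upd t' x1 0 v)" if "?K i t'" for i t' v using that by (simp add: upd_apply)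
      show "?K i (upd t' y1 0 v)" if "?K i t'" for i t' v using that by (simp add: upd_apply)
      fix x y t'
      assume x: "x < n" "y < n" and b': "base t'" and tx: "t' x1 0 = x" "t' y1 0 = y"
        and fr': "\<And>j. j \<notin> {x1, y1} \<union> written ?d \<Longrightarrow> t' j = t2 j" and K: "?K (n * x + y) t'"
      have e: "ev w t' (pairE (V x1) (V y1)) = n * x + y" using ev_pairE[OF b'] x tx by simp
      have "t' TN = t2 TN" by (rule fr') simp
      then show "?K (Suc (n * x + y)) (exe w ?d t') \<and> bounded w B Q ?d t'"
        using K e index_less_Suc[OF x] by (auto simp: upd_apply)
    qed auto
    have T3: "t3 TT (n * x + y) = t2 TN (n * x + y)" if "x < n" "y < n" for x y
      using 3 that pair_less by blast
    have R: "reps ?u (Suc q) (t2 TN) (t2 kn 0) (t2 rx) (t2 ry) (n * n)" using 2 by blast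
    have "typed ?u (Suc q) (t3 TT)" by (rule reps_typed[OF u' R T3])
    moreover have "t3 TT (n * x + y) < class_bound c (Suc q)" if "x < n" "y < n" for x y
    proof -
      have "t2 TN (n * x + y) < t2 kn 0" using R that pair_less unfolding reps_def by blast
      then show ?thesis using T3[OF that] reps_bound[OF u R] by linarith
    qed
    ultimately show "?I (Suc q) (exe w (?c1;; ?c2;; ?c3) t) \<and> bounded w B Q (?c1;; ?c2;; ?c3) t"
      using 2 3 unfolding t1_def t2_def t3_def by (simp del: class_bound.simps)
  qed
  then show ?thesis by blast
qed

end

section \<open>Selection of representatives\<close>

text \<open>With \<open>S\<close> elements chosen, an element is described by its diagonal type and
  \<open>S\<close> types towards them, so a round adds at most \<open>K ^ Suc S\<close>
  representatives.\<close>

primrec sel_bound :: "nat \<Rightarrow> nat \<Rightarrow> nat" where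
  "sel_bound K 0 = 0"
| "sel_bound K (Suc i) = sel_bound K i + K ^ Suc (sel_bound K i)"

lemma sel_bound_mono: "i \<le> j \<Longrightarrow> sel_bound K i \<le> sel_bound K j"
  by (rule lift_Suc_mono_le) auto

lemma power_Suc_mono: "a \<le> b \<Longrightarrow> (K::nat) ^ Suc a \<le> K ^ Suc b"
  by (cases "K = 0") (auto intro!: mult_le_mono power_increasing)

context input
begin

definition "match T sl m z e \<longleftrightarrow> (T (n * z + z) :: nat) = T (n * sl e + sl e) \<and>
   (\<forall>a<m. T (n * sl a + z) = T (n * sl a + sl e))"

definition "sel_inv K T sl cs i \<longleftrightarrow> cs 0 = (0::nat) \<and>
  (\<forall>j<i. cs j \<le> cs (Suc j) \<and> cs (Suc j) \<le> cs j + K ^ Suc (cs j)) \<and> (\<forall>e<cs i. sl e < n) \<and>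
  (\<forall>j<i. \<forall>z<n. \<exists>e<cs (Suc j). match T sl (cs j) z e)"

lemma sel_inv_mono: "sel_inv K T sl cs i \<Longrightarrow> j \<le> j' \<Longrightarrow> j' \<le> i \<Longrightarrow> cs j \<le> cs j'"
proof (induction j')
  case (Suc k)
  then have "cs k \<le> cs (Suc k)" unfolding sel_inv_def by auto
  then show ?case using Suc by (cases "j = Suc k") auto
qed auto

lemma sel_inv_bound: "sel_inv K T sl cs i \<Longrightarrow> j \<le> i \<Longrightarrow> cs j \<le> sel_bound K j"
proof (induction j)
  case (Suc j)
  then have "cs (Suc j) \<le> cs j + K ^ Suc (cs j)" "cs j \<le> sel_bound K j" unfolding sel_inv_def by auto
  moreover from this have "K ^ Suc (cs j) \<le> K ^ Suc (sel_bound K j)" using power_Suc_mono by blast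
  ultimately show ?case unfolding sel_bound.simps by linarith
qed (simp add: sel_inv_def)

lemma compare_sel_correct:
  assumes b: "base t" and x: "t x1 0 < n" and e: "t sel (t e1 0) < n"
    and c: "\<And>a. a < t cn (t it 0) \<Longrightarrow> t sel a < n" and Q: "t cn (t it 0) \<le> Q"
  shows "(exe w compare_sel t fnd 0 \<noteq> 0 \<longleftrightarrow> t fnd 0 \<noteq> 0 \<or> match (t TT) (t sel) (t cn (t it 0)) (t x1 0) (t e1 0))
    \<and> bounded w B Q compare_sel t"
proof -
  let ?m = "t cn (t it 0)"
  let ?c1 = "okv ::= eqE (Arr TT (pairE (V x1) (V x1))) (Arr TT (pairE (Arr sel (V e1)) (Arr sel (V e1))))"
  let ?in = "Cond (eqE (Arr TT (pairE (Arr sel (V a1)) (V x1))) (Arr TT (pairE (Arr sel (V a1)) (Arr sel (V e1)))))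
       Skip (okv ::= N 0)"
  let ?lp = "For False a1 (Arr cn (V it)) ?in"
  define t2 where "t2 = exe w ?c1 t"
  have f2: "t2 k = t k" if "k \<noteq> okv" for k using that by (simp add: t2_def upd_apply)
  have ok2: "t2 okv 0 \<noteq> 0 \<longleftrightarrow> t TT (n * t x1 0 + t x1 0) = t TT (n * t sel (t e1 0) + t sel (t e1 0))"
    using ev_pairE[OF b, of "V x1" "V x1"] ev_pairE[OF b, of "Arr sel (V e1)" "Arr sel (V e1)"] x e
    by (simp add: t2_def upd_apply)
  let ?I = "\<lambda>a t'. t' okv 0 \<noteq> 0 \<longleftrightarrow> t2 okv 0 \<noteq> 0 \<and>
    (\<forall>i<a. t TT (n * t sel i + t x1 0) = t TT (n * t sel i + t sel (t e1 0)))"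
  define t3 where "t3 = exe w ?lp t2"
  have 3: "?I ?m t3 \<and> bounded w B Q ?lp t2"
    unfolding t3_def
  proof (rule For_rule[where I = ?I])
    show "ev w t2 (Arr cn (V it)) = ?m" by (simp add: f2)
    show "?m \<le> (if False then B else Q)" using Q by simp
    show "?I 0 t2" by simp
    show "?I i (upd t' a1 0 v)" if "?I i t'" for i t' v using that by (simp add: upd_apply)
    fix a t'
    assume a: "a < ?m" and fr: "\<And>j. j \<notin> insert a1 (written ?in) \<Longrightarrow> t' j = t2 j" and ta: "t' a1 0 = a" and I: "?I a t'"
    have f: "t' k = t k" if "k \<notin> {okv, a1}" for k using fr[of k] f2 that by simp
    have b': "base t'" using b by (rule base_cong) (simp_all add: f)
    have p: "ev w t' (pairE (Arr sel (V a1)) (V x1)) = n * t sel a + t x1 0"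
      "ev w t' (pairE (Arr sel (V a1)) (Arr sel (V e1))) = n * t sel a + t sel (t e1 0)"
      using ev_pairE[OF b', of "Arr sel (V a1)"] c[OF a] ta f by simp_all
    show "?I (Suc a) (exe w ?in t') \<and> bounded w B Q ?in t'"
      using I p f[of TT] by (auto simp: upd_apply less_Suc_eq)
  qed
  have fnd3: "t3 fnd = t fnd" using exe_frame[of fnd ?lp w t2] f2 by (simp add: t3_def)
  have "exe w compare_sel t = (if t3 okv 0 \<noteq> 0 then upd t3 fnd 0 1 else t3)"
    "bounded w B Q compare_sel t = bounded w B Q ?lp t2"
    by (simp_all add: compare_sel_def t2_def t3_def)
  then show ?thesis using 3 ok2 fnd3 by (auto simp: upd_apply match_def)
qed

text \<open>State of a round after the first \<open>x\<close> elements. The newly added ones are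
  told apart by their diagonal types and their types towards the \<open>c\<close> old ones, which
  bounds their number.\<close>

definition "sel1_inv K T sl0 c k sl x \<longleftrightarrow> c \<le> k \<and> (\<forall>e<c. sl e = sl0 e) \<and> (\<forall>e<k. sl e < n) \<and>
  (\<forall>z<x. \<exists>e<k. match T sl c z e) \<and> (\<forall>e e'. c \<le> e \<longrightarrow> e < e' \<longrightarrow> e' < k \<longrightarrow> \<not> match T sl c (sl e') e)"

lemma sel1_inv_bound:
  assumes "sel1_inv K T sl0 c k sl x" "\<And>x y. x < n \<Longrightarrow> y < n \<Longrightarrow> T (n * x + y) < K"
  shows "k \<le> c + K ^ Suc c"
proof -
  have I: "c \<le> k" "\<And>e. e < k \<Longrightarrow> sl e < n"
    "\<And>e e'. c \<le> e \<Longrightarrow> e < e' \<Longrightarrow> e' < k \<Longrightarrow> \<not> match T sl c (sl e') e"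
    using assms(1) unfolding sel1_inv_def by blast+
  have "k - c \<le> K ^ Suc c"
  proof (rule distinct_vectors_bound[of c k "\<lambda>e. T (n * sl e + sl e)" K c "\<lambda>a e. T (n * sl a + sl e)"])
    fix e e' assume "c \<le> e" "e < e'" "e' < k"
    from I(3)[OF this] show "\<not> (T (n * sl e + sl e) = T (n * sl e' + sl e') \<and>
        (\<forall>a<c. T (n * sl a + sl e) = T (n * sl a + sl e')))"
      by (auto simp: match_def)
  qed (use I assms(2) in auto)
  then show ?thesis by simp
qed

lemma match_upd: "e \<noteq> k \<Longrightarrow> (\<And>a. a < c \<Longrightarrow> a \<noteq> k) \<Longrightarrow> match T (sl(k := y)) c z e = match T sl c z e"
  by (auto simp: match_def)

lemma sel1_inv_skip: "sel1_inv K T sl0 c k sl x \<Longrightarrow> e < k \<Longrightarrow> match T sl c x e \<Longrightarrow> sel1_inv K T sl0 c k sl (Suc x)"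
  unfolding sel1_inv_def by (auto simp: less_Suc_eq)

lemma sel1_inv_add:
  assumes I: "sel1_inv K T sl0 c k sl x" and new: "\<And>e. e < k \<Longrightarrow> \<not> match T sl c x e" and "x < n"
  shows "sel1_inv K T sl0 c (Suc k) (sl(k := x)) (Suc x)"
proof -
  have ck: "c \<le> k" using I by (simp add: sel1_inv_def)
  have m: "match T (sl(k := x)) c z e = match T sl c z e" if "e < k" for z e
    using that ck by (intro match_upd) auto
  have self: "match T (sl(k := x)) c x k" using ck by (auto simp: match_def)
  show ?thesis unfolding sel1_inv_def
  proof (intro conjI allI impI)
    fix z assume "z < Suc x"
    then consider "z < x" | "z = x" by linarith
    then show "\<exists>e<Suc k. match T (sl(k := x)) c z e"
    proof cases
      case 1
      then obtain e where "e < k" "match T sl c z e" using I unfolding sel1_inv_def by blast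
      then show ?thesis using m less_SucI by blast
    next
      case 2
      then show ?thesis using self by blast
    qed
  next
    fix e e' assume *: "c \<le> e" "e < e'" "e' < Suc k"
    show "\<not> match T (sl(k := x)) c ((sl(k := x)) e') e"
    proof (cases "e' = k")
      case True
      then show ?thesis using m[of e x] new[of e] * by simp
    next
      case False
      then show ?thesis using m[of e "sl e'"] I * unfolding sel1_inv_def by auto
    qed
  qed (use I \<open>x < n\<close> in \<open>auto simp: sel1_inv_def less_Suc_eq\<close>)
qed

lemma select1_correct:
  assumes b: "base t" and x: "t x1 0 < n" and TK: "\<And>x y. x < n \<Longrightarrow> y < n \<Longrightarrow> t TT (n * x + y) < K"
    and I: "sel1_inv K (t TT) sl0 (t cn (t it 0)) (t sn 0) (t sel) (t x1 0)"
    and Q: "t cn (t it 0) + K ^ Suc (t cn (t it 0)) \<le> Q"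
  defines "t' \<equiv> exe w select1 t"
  shows "sel1_inv K (t TT) sl0 (t cn (t it 0)) (t' sn 0) (t' sel) (Suc (t x1 0)) \<and> bounded w B Q select1 t"
proof -
  let ?c = "t cn (t it 0)"
  let ?k = "t sn 0"
  let ?x = "t x1 0"
  have k: "?k \<le> Q" "?c \<le> ?k" and sl: "\<And>e. e < ?k \<Longrightarrow> t sel e < n"
    using sel1_inv_bound[OF I TK] Q I unfolding sel1_inv_def by auto
  define t2 where "t2 = exe w (fnd ::= N 0) t"
  let ?lp = "For False e1 (V sn) compare_sel"
  define t3 where "t3 = exe w ?lp t2"
  have wrc: "written compare_sel = {okv, a1, fnd}" by (auto simp: compare_sel_def)
  let ?I = "\<lambda>m t'. t' fnd 0 \<noteq> 0 \<longleftrightarrow> (\<exists>e<m. match (t TT) (t sel) ?c ?x e)"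
  have 3: "?I ?k t3 \<and> bounded w B Q ?lp t2"
    unfolding t3_def
  proof (rule For_rule[where I = ?I])
    show "ev w t2 (V sn) = ?k" by (simp add: t2_def upd_apply)
    show "?k \<le> (if False then B else Q)" using k by simp
    show "?I 0 t2" by (simp add: t2_def upd_apply)
    show "?I i (upd t' e1 0 v)" if "?I i t'" for i t' v using that by (simp add: upd_apply)
    fix e t'
    assume e: "e < ?k" and fr: "\<And>j. j \<notin> insert e1 (written compare_sel) \<Longrightarrow> t' j = t2 j" and te: "t' e1 0 = e" and J: "?I e t'"
    have f: "t' k = t k" if "k \<notin> {okv, a1, fnd, e1}" for k using fr[of k] that by (simp add: wrc t2_def upd_apply)
    have b': "base t'" using b by (rule base_cong) (simp_all add: f)
    have "(exe w compare_sel t' fnd 0 \<noteq> 0 \<longleftrightarrow> t' fnd 0 \<noteq> 0 \<or> match (t' TT) (t' sel) (t' cn (t' it 0)) (t' x1 0) (t' e1 0))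
      \<and> bounded w B Q compare_sel t'"
      by (rule compare_sel_correct[OF b']) (use f x te e sl k in auto)
    then show "?I (Suc e) (exe w compare_sel t') \<and> bounded w B Q compare_sel t'"
      using J f te by (auto simp: less_Suc_eq)
  qed
  have f3: "t3 k = t k" if "k \<notin> {okv, a1, fnd, e1}" for k
    using exe_frame[of k ?lp w t2] that by (simp add: t3_def t2_def upd_apply wrc)
  have t': "t' = (if t3 fnd 0 \<noteq> 0 then t3 else upd (upd t3 sel ?k ?x) sn 0 (Suc ?k))"
    "bounded w B Q select1 t = bounded w B Q ?lp t2"
    using f3 by (simp_all add: t'_def select1_def t2_def[symmetric] t3_def[symmetric] upd_apply
      del: exe.simps(2)) (simp_all add: t2_def t3_def upd_apply)
  show ?thesis
  proof (cases "t3 fnd 0 = 0")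
    case True
    then show ?thesis using sel1_inv_add[OF I _ x] 3 t' f3 by (simp add: upd_apply)
  next
    case False
    then obtain e where "e < ?k" "match (t TT) (t sel) ?c ?x e" using 3 by blast
    then show ?thesis using sel1_inv_skip[OF I] False 3 t' f3 by simp
  qed
qed

lemma select_correct:
  assumes b: "base s" and z: "s sn 0 = 0" "s cn 0 = 0"
    and TK: "\<And>x y. x < n \<Longrightarrow> y < n \<Longrightarrow> s TT (n * x + y) < K"
    and Q: "sel_bound K (Suc L) \<le> Q"
  defines "s' \<equiv> exe w select s"
  shows "sel_inv K (s TT) (s' sel) (s' cn) L \<and> s' sn 0 = s' cn L \<and> bounded w B Q select s"
proof -
  let ?lp = "For True x1 (V nV) select1"
  let ?set = "Asg cn (sucE (V it)) (V sn)"
  let ?I = "\<lambda>i t. sel_inv K (s TT) (t sel) (t cn) i \<and> t sn 0 = t cn i"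
  have wr1: "written select1 = {okv, a1, fnd, e1, sel, sn}" by (auto simp: select1_def compare_sel_def)
  have "?I L s' \<and> bounded w B Q select s"
    unfolding s'_def select_def
  proof (rule For_rule[where I = ?I])
    show "ev w s (V lV) = L" using b base_L by simp
    show "L \<le> (if False then B else Q)" using L_le_Q by simp
    show "?I 0 s" using z by (simp add: sel_inv_def)
    show "?I i (upd t it 0 v)" if "?I i t" for i t v using that by (simp add: upd_apply)
    fix i t
    assume i: "i < L" and fr: "\<And>j. j \<notin> insert it (written (?lp;; ?set)) \<Longrightarrow> t j = s j" and ti: "t it 0 = i" and I: "?I i t"
    have bt: "base t" using b by (rule base_cong) (simp_all add: fr wr1)
    let ?c = "t cn i"
    have cQ: "?c + K ^ Suc ?c \<le> Q"
    proof -
      have "?c \<le> sel_bound K i" using sel_inv_bound I by blast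
      then have "?c + K ^ Suc ?c \<le> sel_bound K (Suc i)"
        unfolding sel_bound.simps by (intro add_mono power_Suc_mono)
      also have "\<dots> \<le> sel_bound K (Suc L)" using i by (intro sel_bound_mono) simp
      finally show ?thesis using Q by simp
    qed
    define t2 where "t2 = exe w ?lp t"
    let ?J = "\<lambda>x t'. sel1_inv K (s TT) (t sel) ?c (t' sn 0) (t' sel) x"
    have 2: "?J n t2 \<and> bounded w B Q ?lp t"
      unfolding t2_def
    proof (rule For_rule[where I = ?J])
      show "ev w t (V nV) = n" using bt base_n by simp
      show "n \<le> (if True then B else Q)" using n_le_B by simp
      show "?J 0 t" using I by (simp add: sel1_inv_def sel_inv_def)
      show "?J i (upd t' x1 0 v)" if "?J i t'" for i t' v using that by (simp add: upd_apply)
      fix x t'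
      assume x: "x < n" and fr': "\<And>j. j \<notin> insert x1 (written select1) \<Longrightarrow> t' j = t j" and tx: "t' x1 0 = x" and J: "?J x t'"
      have f: "t' TT = s TT" "t' cn = t cn" "t' it 0 = i" using fr' fr ti by (simp_all add: wr1)
      have b': "base t'" using bt by (rule base_cong) (simp_all add: fr' wr1)
      show "?J (Suc x) (exe w select1 t') \<and> bounded w B Q select1 t'"
        using select1_correct[OF b', of K "t sel"] x tx TK J cQ f by simp
    qed
    have f2: "t2 k = t k" if "k \<notin> insert x1 (written select1)" for k
      unfolding t2_def by (rule exe_frame) (use that in simp)
    have e: "exe w (?lp;; ?set) t = upd t2 cn (Suc i) (t2 sn 0)" "bounded w B Q (?lp;; ?set) t = bounded w B Q ?lp t"
      using f2[of it] ti by (simp_all add: t2_def[symmetric] wr1)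
    let ?cs = "(t cn)(Suc i := t2 sn 0)"
    have J: "?c \<le> t2 sn 0" "\<And>e. e < ?c \<Longrightarrow> t2 sel e = t sel e" "\<And>e. e < t2 sn 0 \<Longrightarrow> t2 sel e < n"
      "\<And>z. z < n \<Longrightarrow> \<exists>e<t2 sn 0. match (s TT) (t2 sel) ?c z e"
      using 2 unfolding sel1_inv_def by blast+
    \<comment> \<open>Later choices lie at positions from \<open>?c\<close> on and leave the matches
      of earlier rounds unchanged.\<close>
    have m: "match (s TT) (t2 sel) c z e = match (s TT) (t sel) c z e" if "e < ?c" "c \<le> ?c" for z e c
      using J(2) that by (auto simp: match_def)
    have le: "t cn j \<le> ?c" if "j \<le> i" for j using sel_inv_mono I that by blast
    have "sel_inv K (s TT) (t2 sel) ?cs (Suc i)"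
      unfolding sel_inv_def
    proof (intro conjI allI impI)
      fix j assume j: "j < Suc i"
      show "?cs j \<le> ?cs (Suc j)" using I j J(1) by (auto simp: sel_inv_def less_Suc_eq)
      show "?cs (Suc j) \<le> ?cs j + K ^ Suc (?cs j)"
        using I j sel1_inv_bound[OF conjunct1[OF 2] TK] by (auto simp: sel_inv_def less_Suc_eq)
      fix z assume zn: "z < n"
      show "\<exists>e<?cs (Suc j). match (s TT) (t2 sel) (?cs j) z e"
      proof (cases "j = i")
        case True
        then show ?thesis using J(4)[OF zn] by simp
      next
        case False
        then have ji: "j < i" using j by simp
        then obtain e where e: "e < t cn (Suc j)" "match (s TT) (t sel) (t cn j) z e"
          using I zn unfolding sel_inv_def by blast
        then show ?thesis using m[of e "t cn j" z] le[of "Suc j"] le[of j] ji by auto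
      qed
    qed (use I J(3) in \<open>auto simp: sel_inv_def\<close>)
    then show "?I (Suc i) (exe w (?lp;; ?set) t) \<and> bounded w B Q (?lp;; ?set) t"
      using 2 f2[of cn] unfolding e by (simp add: upd_apply wr1)
  qed
  then show ?thesis by blast
qed

section \<open>Powers, digits and slots\<close>

lemma powers_correct:
  assumes b: "base s" and bQ: "Suc (s sn 0) \<le> Q"
  defines "s' \<equiv> exe w powers s" and "b' \<equiv> Suc (s sn 0)"
  shows "s' bs 0 = b' \<and> (\<forall>j\<le>L. s' pw j = b' ^ j) \<and> s' nN 0 = b' ^ L \<and> (\<forall>j<L + 2. s' rN j = j * b' ^ L)
    \<and> bounded w B Q powers s"
proof -
  define s1 where "s1 = exe w (bs ::= sucE (V sn);; Asg pw (N 0) (N 1)) s"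
  have f1: "s1 k = s k" if "k \<notin> {bs, pw}" for k using that by (simp add: s1_def upd_apply)
  have s1: "s1 bs 0 = b'" "s1 pw 0 = 1" by (simp_all add: s1_def b'_def upd_apply)
  let ?in = "acc ::= Plus (V acc) (Arr pw (V j1))"
  let ?l1 = "For False e1 (V bs) ?in"
  let ?b1 = "acc ::= N 0;; ?l1;; Asg pw (sucE (V j1)) (V acc)"
  let ?c1 = "For False j1 (V lV) ?b1"
  let ?I = "\<lambda>i t. \<forall>j\<le>i. t pw j = b' ^ j"
  define s2 where "s2 = exe w ?c1 s1"
  have 2: "?I L s2 \<and> bounded w B Q ?c1 s1"
    unfolding s2_def
  proof (rule For_rule[where I = ?I])
    show "ev w s1 (V lV) = L" using b base_L f1 by simp
    show "L \<le> (if False then B else Q)" using L_le_Q by simp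
    show "?I 0 s1" using s1 by simp
    show "?I i (upd t j1 0 v)" if "?I i t" for i t v using that by (simp add: upd_apply)
    fix i t
    assume i: "i < L" and fr: "\<And>j. j \<notin> insert j1 (written ?b1) \<Longrightarrow> t j = s1 j" and ti: "t j1 0 = i" and I: "?I i t"
    define t2 where "t2 = exe w (acc ::= N 0) t"
    define t3 where "t3 = exe w ?l1 t2"
    have 3: "t3 acc 0 = b' * b' ^ i \<and> bounded w B Q ?l1 t2"
      unfolding t3_def
    proof (rule For_rule[where I = "\<lambda>m t'. t' acc 0 = m * b' ^ i"])
      show "ev w t2 (V bs) = b'" using fr s1 by (simp add: t2_def upd_apply)
      show "b' \<le> (if False then B else Q)" using bQ by (simp add: b'_def)
      show "t2 acc 0 = 0 * b' ^ i" by (simp add: t2_def upd_apply)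
      show "upd t' e1 0 v acc 0 = m * b' ^ i" if "t' acc 0 = m * b' ^ i" for m t' v using that by (simp add: upd_apply)
      fix m t'
      assume "\<And>j. j \<notin> insert e1 (written ?in) \<Longrightarrow> t' j = t2 j" and J: "t' acc 0 = m * b' ^ i"
      then have "t' pw i = b' ^ i" "t' j1 0 = i" using I ti by (simp_all add: t2_def upd_apply)
      then show "exe w ?in t' acc 0 = Suc m * b' ^ i \<and> bounded w B Q ?in t'" using J by (simp add: upd_apply)
    qed
    have "t3 pw = t pw" "t3 j1 0 = i"
      using exe_frame[of pw ?l1 w t2] exe_frame[of j1 ?l1 w t2] ti by (simp_all add: t3_def t2_def upd_apply)
    then show "?I (Suc i) (exe w ?b1 t) \<and> bounded w B Q ?b1 t"
      using 3 I by (simp add: t2_def[symmetric] t3_def[symmetric] upd_apply le_Suc_eq del: exe.simps(2))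
        (simp add: upd_apply)
  qed
  have f2: "s2 k = s1 k" if "k \<notin> {j1, e1, acc, pw}" for k
    unfolding s2_def by (rule exe_frame) (use that in simp)
  define s3 where "s3 = exe w (nN ::= Arr pw (V lV);; acc ::= N 0) s2"
  have lV: "s2 lV 0 = L" using b base_L f1 f2 by simp
  have s3: "s3 nN 0 = b' ^ L" "s3 acc 0 = 0" using 2 lV by (simp_all add: s3_def upd_apply)
  have f3: "s3 k = s2 k" if "k \<notin> {nN, acc}" for k using that by (simp add: s3_def upd_apply)
  let ?b4 = "Asg rN (V j1) (V acc);; acc ::= Plus (V acc) (V nN)"
  let ?c4 = "For False j1 (Plus (V lV) (N 2)) ?b4"
  have 4: "((\<forall>j<L + 2. exe w ?c4 s3 rN j = j * b' ^ L) \<and> exe w ?c4 s3 acc 0 = (L + 2) * b' ^ L) \<and> bounded w B Q ?c4 s3"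
  proof (rule For_rule[where I = "\<lambda>i t. (\<forall>j<i. t rN j = j * b' ^ L) \<and> t acc 0 = i * b' ^ L"])
    show "ev w s3 (Plus (V lV) (N 2)) = L + 2" using lV f3 by simp
    show "L + 2 \<le> (if False then B else Q)" using QL by simp
  qed (use s3 in \<open>auto simp: upd_apply less_Suc_eq\<close>)
  have s': "s' = exe w ?c4 s3" "bounded w B Q powers s \<longleftrightarrow> bounded w B Q ?c1 s1 \<and> bounded w B Q ?c4 s3"
    by (simp_all add: s'_def powers_def s1_def s2_def s3_def)
  have f4: "s' k = s3 k" if "k \<notin> {j1, rN, acc}" for k
    unfolding s' by (rule exe_frame) (use that in simp)
  show ?thesis using 2 4 s1 s3 f2 f3 f4 unfolding s'(2) by (auto simp: s'(1)[symmetric])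
qed

lemma digits_correct:
  assumes b: "base s" and b': "0 < b'" "s bs 0 = b'" "\<And>j. j \<le> L \<Longrightarrow> s pw j = b' ^ j" "s nN 0 = b' ^ L"
    and rN: "\<And>j. j < L \<Longrightarrow> s rN j = j * b' ^ L" and Q: "b' ^ L \<le> Q"
  shows "(\<forall>j<L. \<forall>a<b' ^ L. exe w digits s dig (j * b' ^ L + a) = a div b' ^ j mod b') \<and> bounded w B Q digits s"
  unfolding digits_def
proof (rule For_rule[where I = "\<lambda>i t. \<forall>j<i. \<forall>a<b' ^ L. t dig (j * b' ^ L + a) = a div b' ^ j mod b'"])
  let ?N = "b' ^ L"
  let ?in = "Asg dig (Plus (Arr rN (V j1)) (V as)) (V vl);; cv ::= sucE (V cv);;
       Cond (eqE (V cv) (Arr pw (V j1)))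
         (cv ::= N 0;; vl ::= sucE (V vl);; Cond (eqE (V vl) (V bs)) (vl ::= N 0) Skip) Skip"
  let ?lp = "For False as (V nN) ?in"
  let ?body = "cv ::= N 0;; vl ::= N 0;; ?lp"
  show "ev w s (V lV) = L" using b base_L by simp
  show "L \<le> (if False then B else Q)" using L_le_Q by simp
  show "\<forall>j<i. \<forall>a<?N. upd t j1 0 v dig (j * ?N + a) = a div b' ^ j mod b'"
    if "\<forall>j<i. \<forall>a<?N. t dig (j * ?N + a) = a div b' ^ j mod b'" for i t v using that by (simp add: upd_apply)
  fix i t
  assume i: "i < L" and fr: "\<And>j. j \<notin> insert j1 (written ?body) \<Longrightarrow> t j = s j" and ti: "t j1 0 = i"
    and I: "\<forall>j<i. \<forall>a<?N. t dig (j * ?N + a) = a div b' ^ j mod b'"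
  define t2 where "t2 = exe w (cv ::= N 0;; vl ::= N 0) t"
  let ?J = "\<lambda>m t'. (\<forall>j<i. \<forall>a<?N. t' dig (j * ?N + a) = a div b' ^ j mod b') \<and>
    (\<forall>a<m. t' dig (i * ?N + a) = a div b' ^ i mod b') \<and> t' cv 0 = m mod b' ^ i \<and> t' vl 0 = m div b' ^ i mod b'"
  have "?J ?N (exe w ?lp t2) \<and> bounded w B Q ?lp t2"
  proof (rule For_rule[where I = ?J])
    show "ev w t2 (V nN) = ?N" using fr b' by (simp add: t2_def upd_apply)
    show "?N \<le> (if False then B else Q)" using Q by simp
    show "?J 0 t2" using I by (simp add: t2_def upd_apply)
    show "?J m (upd t' as 0 v)" if "?J m t'" for m t' v using that by (simp add: upd_apply)
    fix m t'
    assume m: "m < ?N" and fr': "\<And>j. j \<notin> insert as (written ?in) \<Longrightarrow> t' j = t2 j" and run_time: "t' as 0 = m" and J: "?J m t'"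
    have f: "t' rN i = i * ?N" "t' pw i = b' ^ i" "t' bs 0 = b'" "t' j1 0 = i"
      using fr' fr b' rN i ti by (simp_all add: t2_def upd_apply)
    let ?cv = "if Suc (m mod b' ^ i) = b' ^ i then 0 else Suc (m mod b' ^ i)"
    let ?vl = "if Suc (m mod b' ^ i) = b' ^ i then (if Suc (m div b' ^ i mod b') = b' then 0 else Suc (m div b' ^ i mod b'))
       else m div b' ^ i mod b'"
    have e: "exe w ?in t' dig = (t' dig)(i * ?N + m := m div b' ^ i mod b')"
      "exe w ?in t' cv 0 = ?cv" "exe w ?in t' vl 0 = ?vl" "bounded w B Q ?in t'"
      using J f run_time by (auto simp: upd_apply)
    have p: "b' ^ i > 0" using b'(1) by simp
    have "Suc m mod b' ^ i = ?cv" by (simp add: mod_Suc)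
    moreover have "Suc m div b' ^ i mod b' = ?vl"
      by (auto simp: div_Suc mod_Suc)
    moreover have "j * ?N + a \<noteq> i * ?N + m" if "j < i" "a < ?N" for j a
    proof -
      have "j * ?N + a < Suc j * ?N" using that by simp
      also have "\<dots> \<le> i * ?N" using that by (intro mult_le_mono1) simp
      finally show ?thesis by simp
    qed
    ultimately show "?J (Suc m) (exe w ?in t') \<and> bounded w B Q ?in t'"
      using J e by (auto simp: less_Suc_eq)
  qed
  moreover have "exe w ?body t = exe w ?lp t2" "bounded w B Q ?body t = bounded w B Q ?lp t2" by (simp_all add: t2_def)
  ultimately show "(\<forall>j<Suc i. \<forall>a<?N. exe w ?body t dig (j * ?N + a) = a div b' ^ j mod b') \<and> bounded w B Q ?body t"
    by (auto simp: less_Suc_eq)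
qed simp

definition "slot_of v = last_index (\<lambda>p. ts ! p = v) 0 L"

lemma slot_of_less: "0 < L \<Longrightarrow> slot_of v < L"
  using last_index_ex[of _ L "\<lambda>p. ts ! p = v" 0] last_index_none[of L "\<lambda>p. ts ! p = v" 0]
  unfolding slot_of_def by metis

text \<open>Changing the digit of one variable of the sentence therefore leaves the values of the
  others alone.\<close>

lemma slot_of_inj: "v \<in> set ts \<Longrightarrow> v' \<in> set ts \<Longrightarrow> slot_of v = slot_of v' \<Longrightarrow> v = v'"
  using last_index_ex[of _ L "\<lambda>p. ts ! p = v" 0] last_index_ex[of _ L "\<lambda>p. ts ! p = v'" 0]
  unfolding slot_of_def by (metis in_set_conv_nth)

text \<open>The zeros from \<open>L\<close> on matter: at the last token the next slot is read
  beyond the table, and 0 is a valid slot.\<close>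

lemma slots_correct:
  assumes b: "base s" and z: "\<And>j. s slot j = 0"
  shows "((\<forall>j<L. exe w slots s slot j = slot_of (ts ! j)) \<and> (\<forall>j\<ge>L. exe w slots s slot j = 0)) \<and> bounded w B Q slots s"
  unfolding slots_def
proof (rule For_rule[where I = "\<lambda>i t. (\<forall>j<i. t slot j = slot_of (ts ! j)) \<and> (\<forall>j\<ge>L. t slot j = 0)"])
  let ?in = "Cond (eqE (tokE (V p1)) (tokE (V j1))) (Asg slot (V j1) (V p1)) Skip"
  let ?lp = "For False p1 (V lV) ?in"
  let ?body = "Asg slot (V j1) (V j1);; ?lp"
  show "ev w s (V lV) = L" using b base_L by simp
  show "L \<le> (if False then B else Q)" using L_le_Q by simp
  show "(\<forall>j<0. s slot j = slot_of (ts ! j)) \<and> (\<forall>j\<ge>L. s slot j = 0)" using z by simp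
  show "(\<forall>j<i. upd t j1 0 v slot j = slot_of (ts ! j)) \<and> (\<forall>j\<ge>L. upd t j1 0 v slot j = 0)"
    if "(\<forall>j<i. t slot j = slot_of (ts ! j)) \<and> (\<forall>j\<ge>L. t slot j = 0)" for i t v using that by (simp add: upd_apply)
  fix i t
  assume i: "i < L" and fr: "\<And>j. j \<notin> insert j1 (written ?body) \<Longrightarrow> t j = s j" and ti: "t j1 0 = i"
    and I: "(\<forall>j<i. t slot j = slot_of (ts ! j)) \<and> (\<forall>j\<ge>L. t slot j = 0)"
  have bt': "base t" using b by (rule base_cong) (simp_all add: fr)
  define t2 where "t2 = exe w (Asg slot (V j1) (V j1)) t"
  have bt: "base t2" "t2 j1 0 = i" using bt' ti by (auto simp: t2_def upd_apply base_upd)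
  let ?J = "\<lambda>m t'. (\<forall>j<i. t' slot j = slot_of (ts ! j)) \<and> (\<forall>j\<ge>L. t' slot j = 0) \<and>
    t' slot i = last_index (\<lambda>p. ts ! p = ts ! i) i m"
  have "?J L (exe w ?lp t2) \<and> bounded w B Q ?lp t2"
  proof (rule For_rule[where I = ?J])
    show "ev w t2 (V lV) = L" using bt base_L by simp
    show "L \<le> (if False then B else Q)" using L_le_Q by simp
    show "?J 0 t2" using I ti i by (simp add: t2_def upd_apply)
    show "?J m (upd t' p1 0 v)" if "?J m t'" for m t' v using that by (simp add: upd_apply)
    fix m t'
    assume m: "m < L" and fr': "\<And>j. j \<notin> insert p1 (written ?in) \<Longrightarrow> t' j = t2 j" and run_time: "t' p1 0 = m" and J: "?J m t'"
    have b': "base t'" using bt(1) by (rule base_cong) (simp_all add: fr')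
    have x: "t' j1 0 = i" using fr' bt by auto
    have "ev w t' (tokE (V p1)) = ts ! m" "ev w t' (tokE (V j1)) = ts ! i"
      using ev_tokE[OF b', of "V p1"] ev_tokE[OF b', of "V j1"] m run_time x i by auto
    then show "?J (Suc m) (exe w ?in t') \<and> bounded w B Q ?in t'"
      using J x run_time i by (auto simp: upd_apply)
  qed
  moreover have "last_index (\<lambda>p. ts ! p = ts ! i) i L = slot_of (ts ! i)"
    unfolding slot_of_def by (rule last_index_cong[of i]) (use i in auto)
  moreover have "exe w ?body t = exe w ?lp t2" "bounded w B Q ?body t = bounded w B Q ?lp t2" by (simp_all add: t2_def)
  ultimately show "((\<forall>j<Suc i. exe w ?body t slot j = slot_of (ts ! j)) \<and> (\<forall>j\<ge>L. exe w ?body t slot j = 0)) \<and>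
      bounded w B Q ?body t"
    by (auto simp: less_Suc_eq)
qed

end

section \<open>Formulas as token strings, and the change of a digit\<close>

lemma sat_cong: "(\<And>v. v \<in> free_vars \<phi> \<Longrightarrow> \<sigma> v = \<tau> v) \<Longrightarrow> sat P r c o' \<sigma> \<phi> = sat P r c o' \<tau> \<phi>"
proof (induction \<phi> arbitrary: \<sigma> \<tau>)
  case (Exists x \<phi>)
  have "sat P r c o' (\<sigma>(x := a)) \<phi> = sat P r c o' (\<tau>(x := a)) \<phi>" for a
    by (rule Exists.IH) (use Exists.prems in auto)
  then show ?case by simp
next
  case (Forall x \<phi>)
  have "sat P r c o' (\<sigma>(x := a)) \<phi> = sat P r c o' (\<tau>(x := a)) \<phi>" for a
    by (rule Forall.IH) (use Forall.prems in auto)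
  then show ?case by simp
next
  case (Conj \<phi> \<psi>)
  have "sat P r c o' \<sigma> \<phi> = sat P r c o' \<tau> \<phi>"
    by (rule Conj.IH(1)) (use Conj.prems in auto)
  moreover have "sat P r c o' \<sigma> \<psi> = sat P r c o' \<tau> \<psi>"
    by (rule Conj.IH(2)) (use Conj.prems in auto)
  ultimately show ?case by simp
next
  case (Disj \<phi> \<psi>)
  have "sat P r c o' \<sigma> \<phi> = sat P r c o' \<tau> \<phi>"
    by (rule Disj.IH(1)) (use Disj.prems in auto)
  moreover have "sat P r c o' \<sigma> \<psi> = sat P r c o' \<tau> \<psi>"
    by (rule Disj.IH(2)) (use Disj.prems in auto)
  ultimately show ?case by simp
next
  case (Neg \<phi>)
  have "sat P r c o' \<sigma> \<phi> = sat P r c o' \<tau> \<phi>"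
    by (rule Neg.IH) (use Neg.prems in auto)
  then show ?case by simp
next
  case (Equal x y)
  show ?case using Equal[of x] Equal[of y] by auto
next
  case (Leq x y)
  show ?case using Leq[of x] Leq[of y] by auto
next
  case (Less x y)
  show ?case using Less[of x] Less[of y] by auto
next
  case (HasCol k x)
  show ?case using HasCol[of x] by auto
qed

abbreviation "len \<phi> \<equiv> length (encode_fo \<phi>)"

lemma len_pos: "0 < len \<phi>" by (cases \<phi>) auto

lemma rank_le_len: "rank \<phi> \<le> len \<phi>"
  by (induction \<phi>) auto

lemma vars_in_encoding: "free_vars \<phi> \<subseteq> set (encode_fo \<phi>)" "set_fo \<phi> \<subseteq> set (encode_fo \<phi>)"
  by (induction \<phi>) auto

lemma div_power_split:
  fixes b hi lo e j :: nat
  assumes "0 < b" "lo < b ^ j" "e < b"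
  defines "a \<equiv> hi * b ^ Suc j + e * b ^ j + lo"
  shows "a div b ^ j = hi * b + (e::nat)" "a div b ^ Suc j = hi" "a mod b ^ j = lo"
proof -
  have a: "a = (hi * b + e) * b ^ j + lo" by (simp add: a_def algebra_simps)
  show d: "a div b ^ j = hi * b + e" unfolding a using assms(1,2) by simp
  show "a mod b ^ j = lo" unfolding a using assms(2) by simp
  have "a div b ^ Suc j = a div b ^ j div b" by (simp only: power_Suc2 div_mult2_eq)
  then show "a div b ^ Suc j = hi" using d assms(1,3) by simp
qed

text \<open>Split \<open>a\<close> into the part above position \<open>j\<close>, the digit there
  and the part below; only the digit is exchanged.\<close>

lemma digit_update:
  fixes b :: nat
  assumes b: "0 < b" and j: "j < m" and e: "e < b" and a: "a < b ^ m"
  defines "a' \<equiv> a - (a div b ^ j mod b) * b ^ j + e * b ^ j"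
  shows "a' < b ^ m" "a' div b ^ i mod b = (if i = j then e else a div b ^ i mod b)"
proof -
  define hi where "hi = a div b ^ Suc j"
  define d where "d = a div b ^ j mod b"
  define lo where "lo = a mod b ^ j"
  have lo: "lo < b ^ j" and d: "d < b" using b by (simp_all add: lo_def d_def)
  have "a = a div b ^ j * b ^ j + lo" by (simp only: lo_def div_mult_mod_eq)
  also have "a div b ^ j = hi * b + d"
    by (simp only: hi_def d_def power_Suc2 div_mult2_eq div_mult_mod_eq)
  finally have aeq: "a = hi * b ^ Suc j + d * b ^ j + lo" by (simp add: algebra_simps)
  have a'eq: "a' = hi * b ^ Suc j + e * b ^ j + lo"
    unfolding a'_def d_def[symmetric] using aeq by simp
  note A = div_power_split[OF b lo d, of hi, folded aeq] and A' = div_power_split[OF b lo e, of hi, folded a'eq]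
  have high: "a' div b ^ k = a div b ^ k" if "j < k" for k
  proof -
    have k: "k = Suc j + (k - Suc j)" using that by simp
    show ?thesis by (subst (1 2) k) (simp only: power_add div_mult2_eq A(2) A'(2))
  qed
  have "a' div b ^ m = 0" using high[OF j] a by simp
  then show "a' < b ^ m" using b by (simp add: div_eq_0_iff)
  show "a' div b ^ i mod b = (if i = j then e else a div b ^ i mod b)"
  proof (cases i j rule: linorder_cases)
    case less
    \<comment> \<open>Digits below \<open>j\<close> depend only on the remainder modulo
      \<open>b ^ j\<close>, which the update keeps.\<close>
    have "x div b ^ i mod b = x mod b ^ j div b ^ i mod b" for x
    proof -
      have "b ^ Suc i dvd b ^ j" using less by (intro le_imp_power_dvd) simp
      then have "x mod b ^ j mod b ^ Suc i = x mod b ^ Suc i" by (rule mod_mod_cancel)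
      moreover have "y div b ^ i mod b = y mod b ^ Suc i div b ^ i" for y
        by (simp add: mod_mult2_eq mult.commute[of b] b)
      ultimately show ?thesis by metis
    qed
    from this[of a] this[of a'] show ?thesis using A(3) A'(3) less by simp
  next
    case equal
    then show ?thesis using A'(1) e by simp
  next
    case greater
    then show ?thesis using high by simp
  qed
qed

context input
begin

definition "subformula_at p \<psi> \<longleftrightarrow> (\<exists>us vs. ts = us @ encode_fo \<psi> @ vs \<and> length us = p)"

lemma subformula_at_len: "subformula_at p \<psi> \<Longrightarrow> p + len \<psi> \<le> L"
  by (auto simp: subformula_at_def)

lemma subformula_at_less: "subformula_at p \<psi> \<Longrightarrow> p < L"
  using subformula_at_len len_pos by (metis add_leE less_add_same_cancel1 order_less_le_trans)

lemma subformula_at_set: "subformula_at p \<psi> \<Longrightarrow> free_vars \<psi> \<subseteq> set ts \<and> set_fo \<psi> \<subseteq> set ts"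
  using vars_in_encoding[of \<psi>] by (auto simp: subformula_at_def)

lemma subformula_at_prefix: "subformula_at p \<psi> \<Longrightarrow> i < len \<psi> \<Longrightarrow> ts ! (p + i) = encode_fo \<psi> ! i"
  by (auto simp: subformula_at_def nth_append)

lemma subformula_at_part:
  assumes "subformula_at p \<psi>" "encode_fo \<psi> = us @ encode_fo \<chi> @ vs"
  shows "subformula_at (p + length us) \<chi>"
proof -
  obtain us' vs' where "ts = us' @ encode_fo \<psi> @ vs'" "length us' = p" using assms(1) by (auto simp: subformula_at_def)
  then show ?thesis unfolding subformula_at_def using assms(2)
    by (intro exI[of _ "us' @ us"] exI[of _ "vs @ vs'"]) simp
qed

definition "digit b a j = a div b ^ j mod b"

end

section \<open>Evaluation over the representatives\<close>

locale evaluation = input + coloured_poset n le u col "set ts"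
  for u +
  fixes T sl cs :: "nat \<Rightarrow> nat" and K :: nat
  assumes L_pos: "0 < L"
    and typed: "typed u L T" and sel: "sel_inv K T sl cs L"
    and power_le_Q: "Suc (cs L) ^ L \<le> Q"
begin

abbreviation "b \<equiv> Suc (cs L)"
abbreviation "NN \<equiv> b ^ L"

definition "env a v = sl (digit b a (slot_of v))"

definition "ready s \<longleftrightarrow> base s \<and> (\<forall>x<n. s lab x = u x) \<and> s sel = sl \<and> s cn = cs \<and> (\<forall>j\<le>L. s pw j = b ^ j) \<and>
  s nN 0 = NN \<and> (\<forall>j<L + 2. s rN j = j * NN) \<and>
  (\<forall>j<L. \<forall>a<NN. s dig (j * NN + a) = digit b a j) \<and>
  (\<forall>j<L. s slot j = slot_of (ts ! j)) \<and> (\<forall>j\<ge>L. s slot j = 0)"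

lemma ready_cong:
  "ready s \<Longrightarrow> (\<And>k. k \<in> {nV, row, fb, lV, lab, sel, cn, pw, nN, rN, dig, slot} \<Longrightarrow> t k = s k) \<Longrightarrow> ready t"
  by (simp add: ready_def base_def)

lemma cs_mono: "i \<le> j \<Longrightarrow> j \<le> L \<Longrightarrow> cs i \<le> cs j"
  using sel_inv_mono[OF sel] by blast

lemma sl_less: "e < cs L \<Longrightarrow> sl e < n"
  using sel by (simp add: sel_inv_def)

text \<open>Holds for the assignments produced by the enclosing quantifiers: these stand at earlier
  tokens \<open>p'\<close> and choose among the first \<open>cs (Suc p')\<close> elements.\<close>

definition "closed_at p a \<psi> \<longleftrightarrow> (\<forall>v\<in>free_vars \<psi>. digit b a (slot_of v) < cs p)"

lemma env_less: "closed_at p a \<psi> \<Longrightarrow> p \<le> L \<Longrightarrow> v \<in> free_vars \<psi> \<Longrightarrow> env a v < n"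
  unfolding closed_at_def env_def using cs_mono[of p L] by (intro sl_less) fastforce

text \<open>The values of the other free variables are among the first \<open>cs p\<close> elements,
  and round \<open>p\<close> of the selection provided for every \<open>z\<close> an element with
  the same types towards all of these.\<close>

lemma quantifier_range:
  assumes at: "subformula_at (p + 2) \<psi>" and c: "\<forall>v\<in>free_vars \<psi> - {x}. digit b a (slot_of v) < cs p"
    and z: "z < n"
  shows "\<exists>e<cs (Suc p). holds ((env a)(x := z)) \<psi> \<longleftrightarrow> holds ((env a)(x := sl e)) \<psi>"
proof -
  have p: "p < L" using subformula_at_less[OF at] by simp
  obtain e where e: "e < cs (Suc p)" "match T sl (cs p) z e"
    using sel p z unfolding sel_inv_def by blast
  have en: "sl e < n" using e cs_mono[of "Suc p" L] p by (intro sl_less) simp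
  have small: "sl i < n" if "i < cs p" for i using that cs_mono[of p L] p by (intro sl_less) simp
  have "holds ((env a)(x := z)) \<psi> \<longleftrightarrow> holds ((env a)(x := sl e)) \<psi>"
  proof (rule candidates[of \<psi> L])
    show "set_fo \<psi> \<subseteq> set ts" using subformula_at_set[OF at] by blast
    show "rank \<psi> \<le> L" using rank_le_len[of \<psi>] subformula_at_len[OF at] by simp
    show "eqv L z z (sl e) (sl e)" using e(2) typed_eq[OF typed] z en unfolding match_def by blast
    fix v assume "v \<in> free_vars \<psi> - {x}"
    then have d: "digit b a (slot_of v) < cs p" using c by blast
    then have "T (n * env a v + z) = T (n * env a v + sl e)" using e(2) unfolding match_def env_def by blast
    then show "env a v < n \<and> eqv L (env a v) z (env a v) (sl e)"
      using typed_eq[OF typed] z en small[OF d] unfolding env_def by blast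
  qed (use z en in auto)
  then show ?thesis using e(1) by blast
qed

definition "claim t p \<longleftrightarrow> (\<forall>\<psi>. subformula_at p \<psi> \<longrightarrow> t en p = p + len \<psi> \<and>
  (\<forall>a<NN. closed_at p a \<psi> \<longrightarrow> t VT (p * NN + a) = (if holds (env a) \<psi> then 1 else 0)))"

lemma claim_value: "claim t p \<Longrightarrow> subformula_at p \<psi> \<Longrightarrow> a < NN \<Longrightarrow> closed_at p a \<psi> \<Longrightarrow>
    t VT (p * NN + a) = (if holds (env a) \<psi> then 1 else 0)"
  and claim_end: "claim t p \<Longrightarrow> subformula_at p \<psi> \<Longrightarrow> t en p = p + len \<psi>"
  by (simp_all add: claim_def)

lemma slot_less: "ready t \<Longrightarrow> t slot j < L"
  using slot_of_less[OF L_pos] L_pos unfolding ready_def by (cases "j < L") auto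

lemma digit_less: "digit b a j < b" by (simp add: digit_def)

lemma b_le_Q: "b \<le> Q"
  using self_le_power[of b L] power_le_Q L_pos by simp

lemma ev_digE: "ready t \<Longrightarrow> t as 0 < NN \<Longrightarrow> ev w t (digE i) = digit b (t as 0) (t slot (t pp 0 + i))"
  using slot_less[of t "t pp 0 + i"] by (simp add: digE_def slotE_def ready_def)

lemma ev_eltE: "ready t \<Longrightarrow> t as 0 < NN \<Longrightarrow> t pp 0 + i < L \<Longrightarrow> ev w t (eltE i) = env (t as 0) (ts ! (t pp 0 + i))"
  using ev_digE[of t i] by (simp add: eltE_def env_def ready_def)

lemma ev_subE: "ready t \<Longrightarrow> ev w t i < L + 2 \<Longrightarrow> ev w t (subE i) = t VT (ev w t i * NN + t as 0)"
  by (simp add: subE_def ready_def)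

text \<open>Speaks of table entries and not of a formula at the token, so it also bounds the loops
  at tokens where no subformula starts.\<close>

lemma quant_correct:
  assumes r: "ready t" and a: "t as 0 < NN" and p: "t pp 0 < L" and k: "k \<le> 1"
  defines "a0 \<equiv> t as 0 - digit b (t as 0) (t slot (Suc (t pp 0))) * b ^ t slot (Suc (t pp 0))"
    and "pj \<equiv> b ^ t slot (Suc (t pp 0))"
  shows "exe w (quant (Plus (V pp) (N 2)) k) t vl 0 =
     (if \<exists>e<cs (Suc (t pp 0)). t VT ((t pp 0 + 2) * NN + (a0 + e * pj)) = k then k else 1 - k)
     \<and> bounded w B Q (quant (Plus (V pp) (N 2)) k) t"
proof -
  let ?a = "t as 0" and ?p = "t pp 0" and ?j = "t slot (Suc (t pp 0))"
  let ?e = "Plus (V pp) (N 2)"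
  have j: "?j < L" using slot_less[OF r] .
  have pj: "t pw ?j = pj" using r j by (simp add: ready_def pj_def)
  let ?in1 = "bv ::= Minus (V bv) (Arr pw (slotE 1))"
  let ?l1 = "For False e1 (digE 1) ?in1"
  define t1 where "t1 = exe w (bv ::= V as) t"
  define t2 where "t2 = exe w ?l1 t1"
  have f1: "t1 k = t k" if "k \<noteq> bv" for k using that by (simp add: t1_def upd_apply)
  have r1: "ready t1" using r by (rule ready_cong) (auto simp: f1)
  have 2: "t2 bv 0 = ?a - digit b ?a ?j * pj \<and> bounded w B Q ?l1 t1"
    unfolding t2_def
  proof (rule For_rule[where I = "\<lambda>m t'. t' bv 0 = ?a - m * pj"])
    show "ev w t1 (digE 1) = digit b ?a ?j" using ev_digE[OF r1] a by (simp add: f1)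
    show "digit b ?a ?j \<le> (if False then B else Q)" using digit_less[of ?a ?j] b_le_Q by simp
    show "t1 bv 0 = ?a - 0 * pj" by (simp add: t1_def upd_apply)
    show "upd t' e1 0 v bv 0 = ?a - m * pj" if "t' bv 0 = ?a - m * pj" for m t' v using that by (simp add: upd_apply)
    fix m t'
    assume "\<And>j. j \<notin> insert e1 (written ?in1) \<Longrightarrow> t' j = t1 j" and J: "t' bv 0 = ?a - m * pj"
    then have "ev w t' (Arr pw (slotE 1)) = pj" using pj by (simp add: slotE_def f1)
    then show "exe w ?in1 t' bv 0 = ?a - Suc m * pj \<and> bounded w B Q ?in1 t'" using J by (simp add: upd_apply)
  qed
  define t3 where "t3 = exe w (vl ::= notE (N k)) t2"
  have f2: "t2 i = t i" if "i \<notin> {bv, e1}" for i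
    using exe_frame[of i ?l1 w t1] that by (simp add: t2_def f1)
  have f3: "t3 i = t i" if "i \<notin> {bv, e1, vl}" for i using f2 that by (simp add: t3_def upd_apply)
  let ?in2 = "Cond (eqE (Arr VT (Plus (Arr rN ?e) (V bv))) (N k)) (vl ::= N k) Skip;;
     bv ::= Plus (V bv) (Arr pw (slotE 1))"
  let ?l2 = "For False e1 (Arr cn (sucE (V pp))) ?in2"
  define t4 where "t4 = exe w ?l2 t3"
  let ?hit = "\<lambda>e. t VT ((?p + 2) * NN + (a0 + e * pj)) = k"
  let ?I = "\<lambda>m t'. t' bv 0 = a0 + m * pj \<and> t' vl 0 = (if \<exists>e<m. ?hit e then k else 1 - k)"
  have 4: "?I (cs (Suc ?p)) t4 \<and> bounded w B Q ?l2 t3"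
    unfolding t4_def
  proof (rule For_rule[where I = ?I])
    show "ev w t3 (Arr cn (sucE (V pp))) = cs (Suc ?p)" using r by (simp add: f3 ready_def)
    show "cs (Suc ?p) \<le> (if False then B else Q)" using cs_mono[of "Suc ?p" L] p b_le_Q by simp
    show "?I 0 t3" using 2 k by (simp add: t3_def upd_apply a0_def pj_def)
    show "?I m (upd t' e1 0 v)" if "?I m t'" for m t' v using that by (simp add: upd_apply)
    fix m t'
    assume fr: "\<And>j. j \<notin> insert e1 (written ?in2) \<Longrightarrow> t' j = t3 j" and J: "?I m t'"
    have f: "t' i = t i" if "i \<notin> {bv, e1, vl}" for i using fr[of i] f3[of i] that by simp
    have 1: "ev w t' (Arr VT (Plus (Arr rN ?e) (V bv))) = t VT ((?p + 2) * NN + (a0 + m * pj))"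
      using f J r p by (simp add: ready_def)
    have 2: "t' slot (Suc (t' pp 0)) = ?j" "t' pw ?j = pj" using f pj by simp_all
    show "?I (Suc m) (exe w ?in2 t') \<and> bounded w B Q ?in2 t'"
    proof (cases "?hit m")
      case True
      have "exe w ?in2 t' = upd (upd t' vl 0 k) bv 0 (a0 + m * pj + pj)"
        using 1 True J 2 by (simp add: upd_apply slotE_def)
      then show ?thesis using True 1 by (auto simp: upd_apply add.commute)
    next
      case False
      have "exe w ?in2 t' = upd t' bv 0 (a0 + m * pj + pj)"
        using 1 False J 2 by (simp add: upd_apply slotE_def)
      then show ?thesis using False J 1 by (auto simp: upd_apply less_Suc_eq add.commute)
    qed
  qed
  have "exe w (quant ?e k) t = t4" "bounded w B Q (quant ?e k) t \<longleftrightarrow> bounded w B Q ?l1 t1 \<and> bounded w B Q ?l2 t3"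
    by (simp_all add: quant_def t1_def t2_def t3_def t4_def)
  then show ?thesis using 2 4 by simp
qed

lemma quantified_entry:
  assumes cl: "claim t (p + 2)" and at: "subformula_at (p + 2) \<psi>" and p: "p < L" and x: "ts ! Suc p = x"
    and a: "a < NN" and c: "\<forall>v\<in>free_vars \<psi> - {x}. digit b a (slot_of v) < cs p" and e: "e < cs (Suc p)"
  defines "j \<equiv> slot_of x"
  shows "t VT ((p + 2) * NN + (a - digit b a j * b ^ j + e * b ^ j)) =
    (if holds ((env a)(x := sl e)) \<psi> then 1 else 0)"
proof -
  let ?a = "a - digit b a j * b ^ j + e * b ^ j"
  have p2: "p + 2 < L" using subformula_at_less[OF at] .
  have eb: "e < b" using e cs_mono[of "Suc p" L] p by simp
  have j: "j < L" using slot_of_less[OF L_pos] by (simp add: j_def)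
  note D = digit_update[OF _ j eb a, folded digit_def, simplified]
  have xs: "x \<in> set ts" using x p2 by auto
  \<comment> \<open>Distinct variables have distinct slots, so only the value of \<open>x\<close>
    changes.\<close>
  have dig: "digit b ?a (slot_of v) = (if v = x then e else digit b a (slot_of v))" if "v \<in> free_vars \<psi>" for v
    using D(2)[of "slot_of v"] slot_of_inj[OF _ xs, of v] subformula_at_set[OF at] that by (auto simp: j_def)
  have "closed_at (p + 2) ?a \<psi>" unfolding closed_at_def
  proof
    fix v assume v: "v \<in> free_vars \<psi>"
    show "digit b ?a (slot_of v) < cs (p + 2)"
    proof (cases "v = x")
      case True
      then show ?thesis using dig[OF v] e cs_mono[of "Suc p" "p + 2"] p2 by simp
    next
      case False
      then have "digit b a (slot_of v) < cs p" using c v by blast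
      then show ?thesis using False dig[OF v] cs_mono[of p "p + 2"] p2 by simp
    qed
  qed
  from claim_value[OF cl at D(1) this]
  have "t VT ((p + 2) * NN + ?a) = (if holds (env ?a) \<psi> then 1 else 0)" .
  moreover have "holds (env ?a) \<psi> = holds ((env a)(x := sl e)) \<psi>"
    by (rule sat_cong) (use dig in \<open>auto simp: env_def\<close>)
  ultimately show ?thesis by simp
qed

lemma quantifier_correct:
  assumes at: "subformula_at (p + 2) \<psi>" and p: "p < L"
    and c: "\<forall>v\<in>free_vars \<psi> - {x}. digit b a (slot_of v) < cs p"
  shows "(\<exists>z<n. holds ((env a)(x := z)) \<psi>) \<longleftrightarrow> (\<exists>e<cs (Suc p). holds ((env a)(x := sl e)) \<psi>)"
    and "(\<exists>z<n. \<not> holds ((env a)(x := z)) \<psi>) \<longleftrightarrow> (\<exists>e<cs (Suc p). \<not> holds ((env a)(x := sl e)) \<psi>)"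
proof -
  have s: "sl e < n" if "e < cs (Suc p)" for e using sl_less cs_mono[of "Suc p" L] p that by simp
  note R = quantifier_range[OF at c]
  show "(\<exists>z<n. holds ((env a)(x := z)) \<psi>) \<longleftrightarrow> (\<exists>e<cs (Suc p). holds ((env a)(x := sl e)) \<psi>)"
    using R s by meson
  show "(\<exists>z<n. \<not> holds ((env a)(x := z)) \<psi>) \<longleftrightarrow> (\<exists>e<cs (Suc p). \<not> holds ((env a)(x := sl e)) \<psi>)"
    using R s by meson
qed

text \<open>Arguments start at later tokens, where \<open>cs\<close> is at least as large, so
  \<open>closed_at\<close> passes from a formula to the arguments of a connective; for quantifiers
  \<open>quantified_entry\<close> takes care of the new value.\<close>

lemma node_value_correct:
  assumes r: "ready t" and a: "t as 0 < NN" and p: "t pp 0 < L" and op: "t opv 0 = ts ! t pp 0"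
    and claims: "\<And>p'. t pp 0 < p' \<Longrightarrow> p' < L \<Longrightarrow> claim t p'"
    and at: "subformula_at (t pp 0) \<psi>" and c: "closed_at (t pp 0) (t as 0) \<psi>"
  shows "exe w node_value t vl 0 = (if holds (env (t as 0)) \<psi> then 1 else 0)"
proof -
  let ?p = "t pp 0" and ?a = "t as 0"
  have bt: "base t" using r by (simp add: ready_def)
  have tok: "\<And>i. i < len \<psi> \<Longrightarrow> ts ! (?p + i) = encode_fo \<psi> ! i" using subformula_at_prefix[OF at] .
  have op0: "t opv 0 = encode_fo \<psi> ! 0" using tok[of 0] op len_pos by simp
  have pl: "?p + len \<psi> \<le> L" using subformula_at_len[OF at] .
  have env: "env ?a v < n" if "v \<in> free_vars \<psi>" for v using env_less[OF c _ that] p by simp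
  have lab: "t lab x = u x" if "x < n" for x using r that by (simp add: ready_def)
  show ?thesis
  proof (cases \<psi>)
    case (Equal x y)
    then have "ts ! (?p + 1) = x" "ts ! (?p + 2) = y" using tok[of 1] tok[of 2] by simp_all
    then show ?thesis using op0 Equal pl ev_eltE[OF r a, of 1] ev_eltE[OF r a, of 2]
      by (simp add: node_value_def upd_apply)
  next
    case (Leq x y)
    then have "ts ! (?p + 1) = x" "ts ! (?p + 2) = y" using tok[of 1] tok[of 2] by simp_all
    then have "ev w t (eltE 1) = env ?a x" "ev w t (eltE 2) = env ?a y"
      using ev_eltE[OF r a, of 1] ev_eltE[OF r a, of 2] Leq pl by simp_all
    then show ?thesis using op0 Leq ev_leE[OF bt, of "eltE 1" "eltE 2"] env
      by (simp add: node_value_def upd_apply le_rel_def)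
  next
    case (Less x y)
    then have "ts ! (?p + 1) = x" "ts ! (?p + 2) = y" using tok[of 1] tok[of 2] by simp_all
    then have "ev w t (eltE 1) = env ?a x" "ev w t (eltE 2) = env ?a y"
      using ev_eltE[OF r a, of 1] ev_eltE[OF r a, of 2] Less pl by simp_all
    then show ?thesis using op0 Less ev_slE[OF bt, of "eltE 1" "eltE 2"] env lab
      by (simp add: node_value_def upd_apply lt_rel_def)
  next
    case (HasCol k x)
    then have "ts ! (?p + 1) = k" "ts ! (?p + 2) = x" using tok[of 1] tok[of 2] by simp_all
    then have "ev w t (eltE 2) = env ?a x" "ev w t (tokE (sucE (V pp))) = k"
      using ev_eltE[OF r a, of 2] ev_tokE[OF bt, of "sucE (V pp)"] HasCol pl by simp_all
    then show ?thesis using op0 HasCol ev_colE[OF bt, of "eltE 2"] env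
      by (simp add: node_value_def upd_apply)
  next
    case (Neg \<chi>)
    have at1: "subformula_at (Suc ?p) \<chi>" using subformula_at_part[OF at, of "[4]" \<chi> "[]"] Neg by simp
    then have l: "Suc ?p < L" using subformula_at_less by blast
    have "closed_at (Suc ?p) ?a \<chi>" using c cs_mono[of ?p "Suc ?p"] l Neg
      unfolding closed_at_def by (auto intro: less_le_trans)
    from claim_value[OF claims[OF _ l] at1 a this] show ?thesis
      using op0 Neg ev_subE[OF r, of "sucE (V pp)"] l by (simp add: node_value_def upd_apply)
  next
    case (Conj \<chi> \<chi>')
    have at1: "subformula_at (Suc ?p) \<chi>" "subformula_at (Suc ?p + len \<chi>) \<chi>'"
      using subformula_at_part[OF at, of "[5]" \<chi> "encode_fo \<chi>'"]
        subformula_at_part[OF at, of "5 # encode_fo \<chi>" \<chi>' "[]"] Conj by simp_all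
    then have l: "Suc ?p < L" "Suc ?p + len \<chi> < L" using subformula_at_less by blast+
    have "closed_at (Suc ?p) ?a \<chi>" "closed_at (Suc ?p + len \<chi>) ?a \<chi>'"
      using c cs_mono[of ?p "Suc ?p"] cs_mono[of ?p "Suc ?p + len \<chi>"] l Conj
      unfolding closed_at_def by (auto intro: less_le_trans)
    note V = claim_value[OF claims[OF _ l(1)] at1(1) a this(1)] claim_value[OF claims[OF _ l(2)] at1(2) a this(2)]
      claim_end[OF claims[OF _ l(1)] at1(1)]
    show ?thesis
      using op0 Conj V ev_subE[OF r, of "sucE (V pp)"] ev_subE[OF r, of "Arr en (sucE (V pp))"] l
      by (simp add: node_value_def upd_apply)
  next
    case (Disj \<chi> \<chi>')
    have at1: "subformula_at (Suc ?p) \<chi>" "subformula_at (Suc ?p + len \<chi>) \<chi>'"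
      using subformula_at_part[OF at, of "[6]" \<chi> "encode_fo \<chi>'"]
        subformula_at_part[OF at, of "6 # encode_fo \<chi>" \<chi>' "[]"] Disj by simp_all
    then have l: "Suc ?p < L" "Suc ?p + len \<chi> < L" using subformula_at_less by blast+
    have "closed_at (Suc ?p) ?a \<chi>" "closed_at (Suc ?p + len \<chi>) ?a \<chi>'"
      using c cs_mono[of ?p "Suc ?p"] cs_mono[of ?p "Suc ?p + len \<chi>"] l Disj
      unfolding closed_at_def by (auto intro: less_le_trans)
    note V = claim_value[OF claims[OF _ l(1)] at1(1) a this(1)] claim_value[OF claims[OF _ l(2)] at1(2) a this(2)]
      claim_end[OF claims[OF _ l(1)] at1(1)]
    show ?thesis
      using op0 Disj V ev_subE[OF r, of "sucE (V pp)"] ev_subE[OF r, of "Arr en (sucE (V pp))"] l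
      by (simp add: node_value_def upd_apply)
  next
    case (Exists x \<chi>)
    have at1: "subformula_at (?p + 2) \<chi>" using subformula_at_part[OF at, of "[7, x]" \<chi> "[]"] Exists by simp
    then have l: "?p + 2 < L" using subformula_at_less by blast
    have x: "ts ! Suc ?p = x" using tok[of 1] Exists by simp
    have sx: "t slot (Suc ?p) = slot_of x" using r x l by (simp add: ready_def)
    have c': "\<forall>v\<in>free_vars \<chi> - {x}. digit b ?a (slot_of v) < cs ?p" using c Exists by (simp add: closed_at_def)
    note entry = quantified_entry[OF claims[OF _ l] at1 p x a c']
    have "(\<exists>e<cs (Suc ?p). t VT ((?p + 2) * NN + (?a - digit b ?a (slot_of x) * b ^ slot_of x + e * b ^ slot_of x)) = 1)
       \<longleftrightarrow> (\<exists>e<cs (Suc ?p). holds ((env ?a)(x := sl e)) \<chi>)"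
      using entry by (metis (no_types, lifting) less_add_same_cancel1 one_neq_zero zero_less_numeral)
    then show ?thesis
      using quant_correct[OF r a p, of 1] quantifier_correct(1)[OF at1 p c'] op0 Exists
      unfolding sx by (simp add: node_value_def Bex_def)
  next
    case (Forall x \<chi>)
    have at1: "subformula_at (?p + 2) \<chi>" using subformula_at_part[OF at, of "[8, x]" \<chi> "[]"] Forall by simp
    then have l: "?p + 2 < L" using subformula_at_less by blast
    have x: "ts ! Suc ?p = x" using tok[of 1] Forall by simp
    have sx: "t slot (Suc ?p) = slot_of x" using r x l by (simp add: ready_def)
    have c': "\<forall>v\<in>free_vars \<chi> - {x}. digit b ?a (slot_of v) < cs ?p" using c Forall by (simp add: closed_at_def)
    note entry = quantified_entry[OF claims[OF _ l] at1 p x a c']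
    have "(\<exists>e<cs (Suc ?p). t VT ((?p + 2) * NN + (?a - digit b ?a (slot_of x) * b ^ slot_of x + e * b ^ slot_of x)) = 0)
       \<longleftrightarrow> (\<exists>e<cs (Suc ?p). \<not> holds ((env ?a)(x := sl e)) \<chi>)"
      using entry by (metis (no_types, lifting) less_add_same_cancel1 one_neq_zero zero_less_numeral)
    then show ?thesis
      using quant_correct[OF r a p, of 0] quantifier_correct(2)[OF at1 p c'] op0 Forall
      unfolding sx by (auto simp: node_value_def Ball_def)
  qed
qed

lemma node_value_bnd: "ready t \<Longrightarrow> t as 0 < NN \<Longrightarrow> t pp 0 < L \<Longrightarrow> bounded w B Q node_value t"
  using quant_correct[of t 0] quant_correct[of t 1] by (simp add: node_value_def)

lemma eval_correct:
  assumes r: "ready s" and at: "subformula_at 0 \<psi>" and f: "free_vars \<psi> = {}"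
  shows "exe w eval s VT 0 = (if holds (env 0) \<psi> then 1 else 0) \<and> bounded w B Q eval s"
proof -
  let ?c1 = "pp ::= Minus (Minus (V lV) (N 1)) (V it)"
  let ?c2 = "opv ::= tokE (V pp)"
  let ?lp = "For False as (V nN) eval_node"
  let ?body = "?c1;; ?c2;; node_end;; ?lp"
  have written: "written eval_node = {vl, bv, e1, VT}" "written node_end = {en}"
    by (auto simp: eval_node_def node_value_def quant_def node_end_def)
  have wrv: "written node_value = {vl, bv, e1}" by (auto simp: node_value_def quant_def)
  let ?I = "\<lambda>i t. \<forall>p<L. L - i \<le> p \<longrightarrow> claim t p"
  have "?I L (exe w eval s) \<and> bounded w B Q eval s"
    unfolding eval_def
  proof (rule For_rule[where I = ?I])
    have b: "base s" using r by (simp add: ready_def)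
    show "ev w s (V lV) = L" using b base_L by simp
    show "L \<le> (if False then B else Q)" using L_le_Q by simp
    show "?I 0 s" by simp
    show "?I i (upd t it 0 v)" if "?I i t" for i t v using that by (simp add: claim_def upd_apply)
    fix i t
    assume i: "i < L" and fr: "\<And>j. j \<notin> insert it (written ?body) \<Longrightarrow> t j = s j" and ti: "t it 0 = i" and I: "?I i t"
    define p where "p = L - 1 - i"
    have p: "p < L" using i by (simp add: p_def)
    have rt: "ready t" using r by (rule ready_cong) (auto intro!: fr simp: written)
    have bt: "base t" using rt by (simp add: ready_def)
    define t2 where "t2 = exe w (?c1;; ?c2) t"
    have t2: "t2 = upd (upd t pp 0 p) opv 0 (ts ! p)"
      using ev_tokE[of "upd t pp 0 p" "V pp"] bt ti p base_L[OF bt] by (simp add: t2_def p_def upd_apply base_upd)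
    define t3 where "t3 = exe w node_end t2"
    have f3: "t3 k = t k" if "k \<notin> {pp, opv, en}" for k
      using exe_frame[of k node_end w t2] that by (simp add: t3_def written t2 upd_apply)
    have p3: "t3 pp 0 = p" "t3 opv 0 = ts ! p"
      using exe_frame[of pp node_end w t2] exe_frame[of opv node_end w t2] by (simp_all add: t3_def written t2 upd_apply)
    have en3: "t3 en p' = t en p'" if "p' \<noteq> p" for p'
      using that by (simp add: t3_def node_end_def t2 upd_apply)
    have r3: "ready t3" using rt by (rule ready_cong) (auto simp: f3)
    have cl3: "claim t3 p'" if "p < p'" "p' < L" for p'
    proof -
      have "claim t p'" using I that i by (simp add: p_def)
      then show ?thesis using en3[of p'] f3[of VT] that by (simp add: claim_def)
    qed
    have end3: "t3 en p = p + len \<chi>" if at: "subformula_at p \<chi>" for \<chi>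
    proof -
      have op: "ts ! p = encode_fo \<chi> ! 0" using subformula_at_prefix[OF at, of 0] len_pos by simp
      have cl: "t en p' = p' + len \<chi>'" if "p < p'" "subformula_at p' \<chi>'" for p' \<chi>'
        using claim_end[OF cl3[OF that(1) subformula_at_less[OF that(2)]] that(2)] en3[of p'] that(1) by simp
      show ?thesis
      proof (cases \<chi>)
        case (Neg \<chi>')
        have "subformula_at (Suc p) \<chi>'" using subformula_at_part[OF at, of "[4]" \<chi>' "[]"] Neg by simp
        from cl[OF _ this] show ?thesis using op Neg by (simp add: t3_def node_end_def t2 upd_apply)
      next
        case (Conj \<chi>1 \<chi>2)
        have at1: "subformula_at (Suc p) \<chi>1" "subformula_at (Suc p + len \<chi>1) \<chi>2"
          using subformula_at_part[OF at, of "[5]" \<chi>1 "encode_fo \<chi>2"]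
            subformula_at_part[OF at, of "5 # encode_fo \<chi>1" \<chi>2 "[]"] Conj by simp_all
        from cl[OF _ this(1)] cl[OF _ this(2)] show ?thesis using op Conj by (simp add: t3_def node_end_def t2 upd_apply)
      next
        case (Disj \<chi>1 \<chi>2)
        have at1: "subformula_at (Suc p) \<chi>1" "subformula_at (Suc p + len \<chi>1) \<chi>2"
          using subformula_at_part[OF at, of "[6]" \<chi>1 "encode_fo \<chi>2"]
            subformula_at_part[OF at, of "6 # encode_fo \<chi>1" \<chi>2 "[]"] Disj by simp_all
        from cl[OF _ this(1)] cl[OF _ this(2)] show ?thesis using op Disj by (simp add: t3_def node_end_def t2 upd_apply)
      next
        case (Exists x \<chi>')
        have "subformula_at (p + 2) \<chi>'" using subformula_at_part[OF at, of "[7, x]" \<chi>' "[]"] Exists by simp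
        from cl[OF _ this] show ?thesis using op Exists by (simp add: t3_def node_end_def t2 upd_apply)
      next
        case (Forall x \<chi>')
        have "subformula_at (p + 2) \<chi>'" using subformula_at_part[OF at, of "[8, x]" \<chi>' "[]"] Forall by simp
        from cl[OF _ this] show ?thesis using op Forall by (simp add: t3_def node_end_def t2 upd_apply)
      qed (use op in \<open>simp_all add: t3_def node_end_def t2 upd_apply\<close>)
    qed
    let ?J = "\<lambda>m t'. (\<forall>p'>p. \<forall>a<NN. t' VT (p' * NN + a) = t3 VT (p' * NN + a)) \<and>
      (\<forall>a<m. \<forall>\<chi>. subformula_at p \<chi> \<longrightarrow> closed_at p a \<chi> \<longrightarrow> t' VT (p * NN + a) = (if holds (env a) \<chi> then 1 else 0))"
    define t4 where "t4 = exe w ?lp t3"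
    have 4: "?J NN t4 \<and> bounded w B Q ?lp t3"
      unfolding t4_def
    proof (rule For_rule[where I = ?J])
      show "ev w t3 (V nN) = NN" using r3 by (simp add: ready_def)
      show "NN \<le> (if False then B else Q)" using power_le_Q by simp
      show "?J 0 t3" by simp
      show "?J m (upd t' as 0 v)" if "?J m t'" for m t' v using that by (simp add: upd_apply)
      fix a t'
      assume a: "a < NN" and fr': "\<And>j. j \<notin> insert as (written eval_node) \<Longrightarrow> t' j = t3 j" and ta: "t' as 0 = a" and J: "?J a t'"
      have f': "t' k = t3 k" if "k \<notin> {as, vl, bv, e1, VT}" for k using fr'[of k] that by (simp add: written)
      have r': "ready t'" using r3 by (rule ready_cong) (auto simp: f')
      have p': "t' pp 0 = p" "t' opv 0 = ts ! p" using f' p3 by simp_all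
      have cl': "claim t' p'" if "p < p'" "p' < L" for p'
        using cl3[OF that] J that f'[of en] by (simp add: claim_def)
      define t5 where "t5 = exe w node_value t'"
      have f5: "t5 k = t' k" if "k \<notin> {vl, bv, e1}" for k
        unfolding t5_def by (rule exe_frame) (use that in \<open>simp add: wrv\<close>)
      have v: "t5 vl 0 = (if holds (env a) \<chi> then 1 else 0)" if "subformula_at p \<chi>" "closed_at p a \<chi>" for \<chi>
        using node_value_correct[OF r', of \<chi>] a ta p p' cl' that unfolding t5_def by simp
      have "t' rN p = p * NN" using r' p by (simp add: ready_def)
      then have e: "exe w eval_node t' = upd t5 VT (p * NN + a) (t5 vl 0)"
        using f5 p' ta by (simp add: eval_node_def t5_def[symmetric])
      \<comment> \<open>As \<open>a\<close> is below the row length, writing in row \<open>p\<close>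
        touches no later row.\<close>
      have "p' * NN + a' \<noteq> p * NN + a" if "p < p'" for p' a'
      proof -
        have "p * NN + a < Suc p * NN" using a by simp
        also have "\<dots> \<le> p' * NN" using that by (intro mult_le_mono1) simp
        finally show ?thesis by simp
      qed
      moreover have "bounded w B Q eval_node t'" using node_value_bnd[OF r'] a ta p p' by (simp add: eval_node_def)
      ultimately show "?J (Suc a) (exe w eval_node t') \<and> bounded w B Q eval_node t'"
        unfolding e using J v f5[of VT] by (auto simp: upd_apply less_Suc_eq)
    qed
    have f4: "t4 en = t3 en" using exe_frame[of en ?lp w t3] by (simp add: t4_def written)
    have b: "exe w ?body t = t4" "bounded w B Q ?body t = bounded w B Q ?lp t3"
      by (simp_all add: t4_def t3_def t2_def node_end_def)
    have "claim t4 p'" if "p' < L" "L - Suc i \<le> p'" for p'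
    proof (cases "p' = p")
      case True
      then show ?thesis using 4 end3 f4 by (simp add: claim_def)
    next
      case False
      then have "p < p'" using that by (simp add: p_def)
      then show ?thesis using cl3[of p'] that 4 f4 by (simp add: claim_def)
    qed
    then show "?I (Suc i) (exe w ?body t) \<and> bounded w B Q ?body t" unfolding b using 4 by blast
  qed
  then have "claim (exe w eval s) 0" "bounded w B Q eval s" using L_pos by auto
  moreover have "closed_at 0 0 \<psi>" using f by (simp add: closed_at_def)
  ultimately show ?thesis using claim_value[of "exe w eval s" 0 \<psi> 0] at by simp
qed

end

section \<open>Loop bounds and the whole program\<close>

text \<open>The summands stand for the kinds of loops flagged \<open>False\<close>: over tokens and
  the table \<open>rN\<close>, over classes of pairs, over chosen elements and over
  assignments.\<close>

definition loop_bound :: "nat \<Rightarrow> nat \<Rightarrow> nat" where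
  "loop_bound k l = (let c = k * Suc l; K = class_bound c l in
     l + 2 + (\<Sum>q\<le>l. class_bound c q) + sel_bound K (Suc l) + Suc (sel_bound K l) ^ l)"

lemma loop_bound_ge:
  fixes k l :: nat
  defines "c \<equiv> k * Suc l"
  shows "l + 2 \<le> loop_bound k l" "q \<le> l \<Longrightarrow> class_bound c q \<le> loop_bound k l"
    "sel_bound (class_bound c l) (Suc l) \<le> loop_bound k l"
    "Suc (sel_bound (class_bound c l) l) ^ l \<le> loop_bound k l"
proof -
  have "class_bound c q \<le> (\<Sum>q\<le>l. class_bound c q)" if "q \<le> l" for q
    using that by (intro member_le_sum) auto
  then show "q \<le> l \<Longrightarrow> class_bound c q \<le> loop_bound k l"
    unfolding loop_bound_def Let_def c_def[symmetric] by (metis (no_types, lifting) add.assoc le_add1 le_add2 order_trans)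
qed (simp_all add: loop_bound_def Let_def c_def[symmetric] del: sel_bound.simps mult_Suc_right)

context input
begin

lemma prog_correct:
  assumes ts: "ts = encode_fo \<phi>" and sentence: "free_vars \<phi> = {}"
    and width: "\<And>A. A \<subseteq> {..<n} \<Longrightarrow> (\<forall>x\<in>A. \<forall>y\<in>A. \<not> lt x y) \<Longrightarrow> card A \<le> k"
    and Q: "loop_bound k L \<le> Q"
  shows "bounded w B Q prog (\<lambda>_ _. 0) \<and> (\<exists>u. labelled_poset n le u \<and>
    exe w prog (\<lambda>_ _. 0) VT 0 =
      (if true_in {..<n} (labelled_poset.le_rel n le) col (labelled_poset.lt_rel n le u) \<phi> then 1 else 0))"
proof -
  define c where "c = k * Suc L"
  define K where "K = class_bound c L"
  have L: "0 < L" using ts len_pos by simp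
  note Qs = order_trans[OF loop_bound_ge(2) Q, folded c_def] order_trans[OF loop_bound_ge(3) Q, folded c_def K_def]
    order_trans[OF loop_bound_ge(4) Q, folded c_def K_def]
  let ?s0 = "\<lambda>_ _. 0 :: nat"
  define s1 where "s1 = exe w setup ?s0"
  define s2 where "s2 = exe w partition_chains s1"
  define s3 where "s3 = exe w (roots;; colours;; labels) s2"
  define s4 where "s4 = exe w types0 s3"
  define s5 where "s5 = exe w refine s4"
  define s6 where "s6 = exe w select s5"
  define s7 where "s7 = exe w powers s6"
  define s8 where "s8 = exe w digits s7"
  define s9 where "s9 = exe w slots s8"
  have W: "written partition_chains = {it, don, x1, vis, qu, qn, fin, i1, y1, par, pv, nx, cur, t1, xx, nt}"
      "written (roots;; colours;; labels) = {x1, rt, t1, ccl, p1, lab, y1}"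
      "written types0 = {x1, y1, cv, TT}"
      "written refine = {qr, kn, x1, y1, fnd, r1, okv, z1, v1, hit, TN, rx, ry, TT}"
      "written select = {it, x1, fnd, e1, okv, a1, sel, sn, cn}"
      "written powers = {bs, pw, j1, acc, e1, nN, rN}"
      "written digits = {j1, cv, vl, as, dig}"
      "written slots = {j1, p1, slot}"
    by (auto simp: partition_chains_def search_def visit_def flip1_def roots_def colours_def labels_def types0_def
      refine_def classify_def same_type_def incl_def select_def select1_def compare_sel_def powers_def
      digits_def slots_def)
  have S1: "base s1" "bounded w B Q setup ?s0" "\<And>k i. k \<notin> {nV, row, fb, lV, acc, it} \<Longrightarrow> s1 k i = 0"
    using setup_correct[of ?s0] unfolding s1_def by auto
  have S2: "sp.matching 0 (s2 nx) (s2 pv)" "sp.stuck (s2 nx) (s2 pv)" "bounded w B Q partition_chains s1"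
    using partition_correct[OF S1(1) S1(3)] unfolding s2_def by auto
  have b2: "base s2" unfolding s2_def by (rule base_exe[OF _ S1(1)]) (simp add: W)
  obtain A where "A \<subseteq> {..<n}" "\<forall>x\<in>A. \<forall>y\<in>A. \<not> lt x y" "card (sp.root (s2 pv) ` {..<n}) \<le> card A"
    using sp.stuck_antichain[OF S2(1,2)] by blast
  then have "card (sp.root (s2 pv) ` {..<n}) \<le> k" using width order_trans by blast
  from labelling_correct[OF b2 S2(1) this]
  have S3: "good_labels c (s3 lab)" "bounded w B Q (roots;; colours;; labels) s2" unfolding s3_def c_def by auto
  have b3: "base s3" unfolding s3_def by (rule base_exe[OF _ b2]) (simp add: W del: written.simps)
  define u where "u = s3 lab"
  have S4: "typed u 0 (s4 TT)" "bounded w B Q types0 s3"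
    using types0_correct[OF b3 S3(1)] unfolding s4_def u_def by auto
  have b4: "base s4" unfolding s4_def by (rule base_exe[OF _ b3]) (simp add: W)
  have l4: "s4 lab = u" unfolding s4_def u_def by (rule exe_frame) (simp add: W)
  have S5: "typed u L (s5 TT)" "\<And>x y. x < n \<Longrightarrow> y < n \<Longrightarrow> s5 TT (n * x + y) < K" "bounded w B Q refine s4"
    using refine_correct[OF b4, of c, unfolded l4] S3(1) S4(1) Qs(1) L unfolding s5_def u_def K_def by blast+
  have b5: "base s5" unfolding s5_def by (rule base_exe[OF _ b4]) (simp add: W)
  have "s5 i = s1 i" if "i \<in> {sn, cn}" for i
    using that unfolding s5_def s4_def s3_def s2_def by (auto simp: exe_frame W simp del: written.simps exe.simps(3))
  then have z5: "s5 sn 0 = 0" "s5 cn 0 = 0" using S1(3) by simp_all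
  have S6: "sel_inv K (s5 TT) (s6 sel) (s6 cn) L" "s6 sn 0 = s6 cn L" "bounded w B Q select s5"
    using select_correct[OF b5 z5 S5(2) Qs(2)] unfolding s6_def by auto
  have b6: "base s6" unfolding s6_def by (rule base_exe[OF _ b5]) (simp add: W)
  define cs where "cs = s6 cn"
  have csL: "cs L \<le> sel_bound K L" using sel_inv_bound[OF S6(1)] unfolding cs_def by simp
  have NQ: "Suc (cs L) ^ L \<le> Q" using power_mono[of "Suc (cs L)" "Suc (sel_bound K L)" L] csL Qs(3) by simp
  have "Suc (cs L) \<le> Suc (cs L) ^ L" using L by (intro self_le_power) auto
  then have bQ: "Suc (s6 sn 0) \<le> Q" using NQ S6(2) unfolding cs_def by simp
  have S7: "s7 bs 0 = Suc (cs L)" "\<And>j. j \<le> L \<Longrightarrow> s7 pw j = Suc (cs L) ^ j" "s7 nN 0 = Suc (cs L) ^ L"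
      "\<And>j. j < L + 2 \<Longrightarrow> s7 rN j = j * Suc (cs L) ^ L" "bounded w B Q powers s6"
    using powers_correct[OF b6 bQ] S6(2) unfolding s7_def cs_def by auto
  have b7: "base s7" unfolding s7_def by (rule base_exe[OF _ b6]) (simp add: W)
  have S8: "\<forall>j<L. \<forall>a<Suc (cs L) ^ L. s8 dig (j * Suc (cs L) ^ L + a) = a div Suc (cs L) ^ j mod Suc (cs L)"
      "bounded w B Q digits s7"
    using digits_correct[OF b7, of "Suc (cs L)"] S7 NQ unfolding s8_def by auto
  have b8: "base s8" unfolding s8_def by (rule base_exe[OF _ b7]) (simp add: W)
  have "s8 slot = s1 slot"
    unfolding s8_def s7_def s6_def s5_def s4_def s3_def s2_def by (simp add: exe_frame W del: written.simps exe.simps(3))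
  then have "s8 slot j = 0" for j using S1(3)[of slot j] by simp
  note S9 = slots_correct[OF b8 this, folded s9_def]
  have b9: "base s9" unfolding s9_def by (rule base_exe[OF _ b8]) (simp add: W)
  have f9: "s9 lab = u" "s9 sel = s6 sel" "s9 cn = cs" "s9 pw = s7 pw" "s9 nN = s7 nN" "s9 rN = s7 rN" "s9 dig = s8 dig"
    unfolding s9_def s8_def s7_def s6_def s5_def cs_def
    by (simp_all add: exe_frame W l4 del: exe.simps(3) written.simps)
  interpret coloured_poset n le u col "set ts" using S3(1) unfolding u_def good_labels_def by blast
  interpret ev: evaluation w n le col ts B Q u "s5 TT" "s6 sel" cs K
    by unfold_locales (use L S5(1) S6(1) NQ in \<open>simp_all add: cs_def\<close>)
  have "ev.ready s9"
    unfolding ev.ready_def using b9 f9 S7 S8(1) S9 by (simp add: digit_def)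
  moreover have "subformula_at 0 \<phi>" unfolding subformula_at_def using ts by (intro exI[of _ "[]"]) simp
  ultimately have E: "exe w eval s9 VT 0 = (if holds (ev.env 0) \<phi> then 1 else 0)" "bounded w B Q eval s9"
    using ev.eval_correct sentence by blast+
  \<comment> \<open>Over the empty poset \<open>ev.env 0\<close> takes values outside of it; for a
    sentence every assignment gives the same truth value.\<close>
  have "holds (ev.env 0) \<phi> \<longleftrightarrow> true_in {..<n} le_rel col lt_rel \<phi>"
    unfolding true_in_def using sat_cong[of \<phi>] sentence by (metis empty_iff)
  moreover have "exe w prog ?s0 = exe w eval s9"
    by (simp add: prog_def s1_def s2_def s3_def s4_def s5_def s6_def s7_def s8_def s9_def)
  moreover have "bounded w B Q prog ?s0"
    using S1(2) S2(3) S3(2) S4(2) S5(3) S6(3) S7(5) S8(2) S9 E(2)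
    by (simp add: prog_def s1_def s2_def s3_def s4_def s5_def s6_def s7_def s8_def s9_def)
  ultimately show ?thesis using E(1) labelled_poset_axioms by auto
qed

end

section \<open>Isomorphic structures and the encoding of an instance\<close>

lemma sat_transport:
  assumes inj: "inj_on h P"
    and r: "\<And>x y. x \<in> P \<Longrightarrow> y \<in> P \<Longrightarrow> (x, y) \<in> r' \<longleftrightarrow> (h x, h y) \<in> r"
    and s: "\<And>x y. x \<in> P \<Longrightarrow> y \<in> P \<Longrightarrow> (x, y) \<in> s' \<longleftrightarrow> (h x, h y) \<in> s"
    and c: "\<And>x. x \<in> P \<Longrightarrow> col' x = col (h x)"
    and v: "\<And>v. v \<in> free_vars \<phi> \<Longrightarrow> \<sigma> v \<in> P"
  shows "sat P r' col' s' \<sigma> \<phi> = sat (h ` P) r col s (h \<circ> \<sigma>) \<phi>"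
  using v
proof (induction \<phi> arbitrary: \<sigma>)
  case (Exists x \<phi>)
  have "sat P r' col' s' (\<sigma>(x := a)) \<phi> = sat (h ` P) r col s ((h \<circ> \<sigma>)(x := h a)) \<phi>" if "a \<in> P" for a
    unfolding fun_upd_comp[symmetric] by (rule Exists.IH) (use Exists.prems that in auto)
  then show ?case unfolding sat.simps by blast
next
  case (Forall x \<phi>)
  have "sat P r' col' s' (\<sigma>(x := a)) \<phi> = sat (h ` P) r col s ((h \<circ> \<sigma>)(x := h a)) \<phi>" if "a \<in> P" for a
    unfolding fun_upd_comp[symmetric] by (rule Forall.IH) (use Forall.prems that in auto)
  then show ?case unfolding sat.simps by blast
qed (use inj r s c in \<open>auto dest: inj_onD\<close>)

lemma strict_linear_order_image:
  assumes inj: "inj_on h P" and s: "strict_linear_order_on P s" "s \<subseteq> P \<times> P"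
  shows "strict_linear_order_on (h ` P) (map_prod h h ` s)"
proof -
  have tr: "trans s" "irrefl s" "total_on P s" using s(1) by (simp_all add: strict_linear_order_on_def)
  have eq: "x = y" if "h x = h y" "x \<in> P" "y \<in> P" for x y using inj that by (meson inj_onD)
  show ?thesis unfolding strict_linear_order_on_def
  proof (intro conjI)
    show "trans (map_prod h h ` s)"
    proof (rule transI)
      fix x y z assume "(x, y) \<in> map_prod h h ` s" "(y, z) \<in> map_prod h h ` s"
      then obtain a b b' d where *: "(a, b) \<in> s" "(b', d) \<in> s" "x = h a" "y = h b" "y = h b'" "z = h d" by auto
      then have "b = b'" using eq[of b b'] s(2) by auto
      then have "(a, d) \<in> s" using * tr(1) by (meson transD)
      then show "(x, z) \<in> map_prod h h ` s" using * by force
    qed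
    show "irrefl (map_prod h h ` s)"
    proof (rule irreflI)
      fix x show "(x, x) \<notin> map_prod h h ` s"
      proof
        assume "(x, x) \<in> map_prod h h ` s"
        then obtain a b where "(a, b) \<in> s" "x = h a" "x = h b" by auto
        then have "(a, a) \<in> s" using eq[of a b] s(2) by auto
        then show False using tr(2) by (simp add: irrefl_def)
      qed
    qed
    show "total_on (h ` P) (map_prod h h ` s)"
    proof (rule total_onI)
      fix x y assume "x \<in> h ` P" "y \<in> h ` P" "x \<noteq> y"
      then obtain a b where "a \<in> P" "b \<in> P" "x = h a" "y = h b" "a \<noteq> b" by auto
      then have "(a, b) \<in> s \<or> (b, a) \<in> s" using tr(3) by (simp add: total_on_def)
      then show "(x, y) \<in> map_prod h h ` s \<or> (y, x) \<in> map_prod h h ` s"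
        using \<open>x = h a\<close> \<open>y = h b\<close> by force
    qed
  qed
qed

text \<open>The place where order-invariance enters: the one order built by the program decides the
  question.\<close>

lemma poset_models_eq:
  fixes P :: "nat set"
  assumes "order_invariant \<Lambda> \<phi>" "finite_coloured_poset \<Lambda> P r col" "strict_linear_order_on P s"
  shows "poset_models P r col \<phi> \<longleftrightarrow> true_in P r col s \<phi>"
  using assms unfolding order_invariant_def poset_models_def by blast

lemma card_antichain_le_width:
  assumes "finite P" "antichain_on P r A"
  shows "card A \<le> width P r"
proof -
  have "finite {A. antichain_on P r A}"
    by (rule finite_subset[of _ "Pow P"]) (use assms in \<open>auto simp: antichain_on_def\<close>)
  then show ?thesis unfolding width_def using assms(2) by (intro Max_ge) auto
qed

lemma concat_map_map_length: "length (concat (map (\<lambda>x. map (g x) ys) xs)) = length xs * length ys"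
  by (induction xs) auto

lemma concat_map_map_nth:
  "i < length xs \<Longrightarrow> j < length ys \<Longrightarrow> concat (map (\<lambda>x. map (g x) ys) xs) ! (length ys * i + j) = g (xs ! i) (ys ! j)"
proof (induction xs arbitrary: i)
  case (Cons x xs)
  then show ?case by (cases i) (auto simp: nth_append add.assoc)
qed simp

lemma encode_instance_input:
  fixes xs :: "'a list"
  assumes P: "partial_order_on (set xs) r" and d: "distinct xs" and Q: "length (encode_fo \<phi>) + 2 \<le> Q"
  shows "input (encode_instance xs r col \<phi>) (length xs) (\<lambda>i j. (xs ! i, xs ! j) \<in> r) (\<lambda>i. col (xs ! i))
     (encode_fo \<phi>) (Suc (length xs)) Q"
proof -
  let ?n = "length xs"
  let ?m = "concat (map (\<lambda>x. map (\<lambda>y. if (x, y) \<in> r then 1 else 0) xs) xs) :: nat list"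
  have w: "encode_instance xs r col \<phi> = ?n # ?m @ map col xs @ encode_fo \<phi>"
    by (simp add: encode_instance_def encode_poset_def)
  have len: "length ?m = ?n * ?n" by (rule concat_map_map_length)
  have po: "refl_on (set xs) r" "trans r" "antisym r"
    using P by (simp_all add: partial_order_on_def preorder_on_def)
  show ?thesis
  proof
    show "length (encode_instance xs r col \<phi>) = 1 + ?n * ?n + ?n + length (encode_fo \<phi>)"
      by (simp add: w len)
    show "encode_instance xs r col \<phi> ! 0 = ?n" by (simp add: w)
    fix x y assume x: "x < ?n" "y < ?n"
    have "?n * x + y < ?n * Suc x" using x by simp
    also have "\<dots> \<le> ?n * ?n" using x by (intro mult_le_mono) auto
    finally have "?n * x + y < length ?m" using len by simp
    then show "encode_instance xs r col \<phi> ! (1 + ?n * x + y) = (if (xs ! x, xs ! y) \<in> r then 1 else 0)"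
      using concat_map_map_nth[OF x, of "\<lambda>x y. if (x, y) \<in> r then 1 else 0"] by (simp add: w nth_append)
  next
    fix x assume "x < ?n"
    then show "encode_instance xs r col \<phi> ! (1 + ?n * ?n + x) = col (xs ! x)"
      by (simp add: w nth_append len)
  next
    fix p assume "p < length (encode_fo \<phi>)"
    then show "encode_instance xs r col \<phi> ! (1 + ?n * ?n + ?n + p) = encode_fo \<phi> ! p"
      by (simp add: w nth_append len)
  next
    fix x assume "x < ?n" then show "(xs ! x, xs ! x) \<in> r" using refl_onD[OF po(1), of "xs ! x"] by simp
  next
    fix x y assume "x < ?n" "y < ?n" "(xs ! x, xs ! y) \<in> r" "(xs ! y, xs ! x) \<in> r"
    then show "x = y" using po(3) d by (metis antisymD nth_eq_iff_index_eq)
  next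
    fix x y z assume "(xs ! x, xs ! y) \<in> r" "(xs ! y, xs ! z) \<in> r"
    then show "(xs ! x, xs ! z) \<in> r" using po(2) by (meson transD)
  qed (use Q in auto)
qed

theorem theorem6p3:
  shows "\<exists>(alg :: ram) (f :: nat \<Rightarrow> nat \<Rightarrow> nat).
    \<forall>(\<Lambda> :: nat set) (xs :: nat list) (r :: nat rel) (col :: nat \<Rightarrow> nat) (\<phi> :: nat fo).
      distinct xs \<longrightarrow> finite_coloured_poset \<Lambda> (set xs) r col \<longrightarrow>
      sentence_over \<Lambda> \<phi> \<longrightarrow> order_invariant \<Lambda> \<phi> \<longrightarrow>
      (\<exists>t. t \<le> f (width (set xs) r) (length (encode_fo \<phi>)) * (length (encode_poset xs r))\<^sup>2 \<and>
           ram_computes_in alg (encode_instance xs r col \<phi>) t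
             (if poset_models (set xs) r col \<phi> then 1 else 0))"
proof -
  \<comment> \<open>The factor 4 comes from \<open>(n + 1) ^ 4 \<le> 4 * (n * n + 1) ^ 2\<close>;
    the 13 steps read off the result, 11 for the array access and 2 to move it to register
    0.\<close>
  define f where "f = (\<lambda>k l. 4 * (weight prog * loop_bound k l ^ small_depth prog) + 13)"
  have "\<exists>t. t \<le> f (width (set xs) r) (length (encode_fo \<phi>)) * (length (encode_poset xs r))\<^sup>2 \<and>
           ram_computes_in (compile prog (Arr VT (N 0))) (encode_instance xs r col \<phi>) t
             (if poset_models (set xs) r col \<phi> then 1 else 0)"
    if d: "distinct xs" and P: "finite_coloured_poset \<Lambda> (set xs) r col"
      and \<phi>: "sentence_over \<Lambda> \<phi>" "order_invariant \<Lambda> \<phi>"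
    for \<Lambda> :: "nat set" and xs :: "nat list" and r :: "nat rel" and col :: "nat \<Rightarrow> nat" and \<phi> :: "nat fo"
  proof -
    let ?n = "length xs" and ?k = "width (set xs) r" and ?w = "encode_instance xs r col \<phi>"
    let ?le = "\<lambda>i j. (xs ! i, xs ! j) \<in> r" and ?col = "\<lambda>i. col (xs ! i)"
    let ?Q = "loop_bound ?k (len \<phi>)" and ?B = "Suc ?n" and ?s0 = "\<lambda>_ _. 0 :: nat"
    have fv: "free_vars \<phi> = {}" using \<phi>(1) by (simp add: sentence_over_def)
    have inj: "inj_on ((!) xs) {..<?n}" using d by (simp add: inj_on_nth)
    have img: "(!) xs ` {..<?n} = set xs" by (auto simp: in_set_conv_nth)
    interpret input ?w ?n ?le ?col "encode_fo \<phi>" ?B ?Q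
      by (rule encode_instance_input) (use P d loop_bound_ge(1) in \<open>auto simp: finite_coloured_poset_def\<close>)
    have width: "card A \<le> ?k" if A: "A \<subseteq> {..<?n}" "\<forall>x\<in>A. \<forall>y\<in>A. \<not> lt x y" for A
    proof -
      have "antichain_on (set xs) r ((!) xs ` A)"
        unfolding antichain_on_def using A img by fastforce
      then have "card ((!) xs ` A) \<le> ?k" by (intro card_antichain_le_width) auto
      then show ?thesis using card_image[OF inj_on_subset[OF inj A(1)]] by simp
    qed
    obtain u where bd: "bounded ?w ?B ?Q prog ?s0" and u: "labelled_poset ?n ?le u" and
      res: "exe ?w prog ?s0 VT 0 =
        (if true_in {..<?n} (labelled_poset.le_rel ?n ?le) ?col (labelled_poset.lt_rel ?n ?le u) \<phi> then 1 else 0)"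
      using prog_correct[OF refl fv width] by auto
    interpret lp: labelled_poset ?n ?le u by (rule u)
    define s where "s = map_prod ((!) xs) ((!) xs) ` lp.lt_rel"
    have ltP: "lp.lt_rel \<subseteq> {..<?n} \<times> {..<?n}" unfolding lp.lt_rel_def by auto
    have s: "strict_linear_order_on (set xs) s"
      using strict_linear_order_image[OF inj lp.strict_linear_lt_rel ltP] unfolding s_def img .
    have tr: "sat {..<?n} lp.le_rel ?col lp.lt_rel \<sigma> \<phi> = sat (set xs) r col s ((!) xs \<circ> \<sigma>) \<phi>" for \<sigma>
      unfolding img[symmetric]
    proof (rule sat_transport[OF inj])
      fix x y assume "x \<in> {..<?n}" "y \<in> {..<?n}"
      then show "(x, y) \<in> lp.lt_rel \<longleftrightarrow> (xs ! x, xs ! y) \<in> s"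
        unfolding s_def using ltP inj by (auto simp: inj_on_def; blast)
    qed (use fv in \<open>auto simp: lp.le_rel_def\<close>)
    \<comment> \<open>The transport reaches only assignments that factor through the list
      \<open>xs\<close>; for a sentence these stand for all.\<close>
    have any: "sat (set xs) r col s \<tau> \<phi> = sat (set xs) r col s \<tau>' \<phi>" for \<tau> \<tau>'
      by (rule sat_cong) (simp add: fv)
    have "true_in {..<?n} lp.le_rel ?col lp.lt_rel \<phi> \<longleftrightarrow> true_in (set xs) r col s \<phi>"
      unfolding true_in_def tr using any by blast
    then have models: "true_in {..<?n} lp.le_rel ?col lp.lt_rel \<phi> \<longleftrightarrow> poset_models (set xs) r col \<phi>"
      using poset_models_eq[OF \<phi>(2) P s] by simp
    let ?t = "run_time ?w prog ?s0 + exp_time (Arr VT (N 0)) + 2"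
    have "ram_computes_in (compile prog (Arr VT (N 0))) ?w ?t (ev ?w (exe ?w prog ?s0) (Arr VT (N 0)))"
      by (rule compile_computes[OF prog_wf]) simp
    then have comp: "ram_computes_in (compile prog (Arr VT (N 0))) ?w ?t
        (if poset_models (set xs) r col \<phi> then 1 else 0)"
      using res models by simp
    have len: "length (encode_poset xs r) = Suc (?n * ?n)"
      by (simp add: encode_poset_def concat_map_map_length)
    have "run_time ?w prog ?s0 \<le> weight prog * (?Q ^ small_depth prog * ?B ^ big_depth prog)"
      by (rule run_time_le[OF _ _ bd]) (use loop_bound_ge(1)[of "len \<phi>" ?k] in auto)
    also have "?B ^ big_depth prog \<le> 4 * (Suc (?n * ?n))\<^sup>2"
    proof -
      have "?B ^ 2 \<le> 2 * Suc (?n * ?n)"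
      proof -
        \<comment> \<open>That is, the square of \<open>?n - 1\<close> is not negative.\<close>
        have "2 * ?n \<le> 1 + ?n * ?n"
          by (cases ?n; cases "?n - 1") (auto simp: algebra_simps)
        then show ?thesis by (simp add: power2_eq_square)
      qed
      then have "(?B ^ 2) ^ 2 \<le> (2 * Suc (?n * ?n)) ^ 2" by (rule power_mono) simp
      then show ?thesis unfolding prog_big_depth power_mult_distrib power_mult[symmetric] by simp
    qed
    finally have "run_time ?w prog ?s0 \<le> 4 * (weight prog * ?Q ^ small_depth prog) * (Suc (?n * ?n))\<^sup>2"
      by (simp add: algebra_simps)
    moreover have "13 * 1 \<le> 13 * (Suc (?n * ?n))\<^sup>2" by (intro mult_le_mono) auto
    ultimately have "?t \<le> f ?k (len \<phi>) * (length (encode_poset xs r))\<^sup>2"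
      unfolding f_def len add_mult_distrib exp_time.simps by linarith
    then show ?thesis using comp by blast
  qed
  then show ?thesis by blast
qed

end
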